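(* Let $\mathbb{K}$ be an algebraically closed field of characteristic $0$ or of prime characteristic $p\ge 7$, and let $m\ge 5$ be an integer, with $m\le p-1$ if $\mathbb{K}$ has characteristic $p$. Let $V$ be the projective variety of $\mathrm{PG}(m-1,\mathbb{K})$ defined by the equations $X_1^k+X_2^k+\cdots+X_m^k=0$ for $1\le k\le m-2$. Then $V$, regarded as a variety in the hyperplane $X_1+\cdots+X_m=0$, which is identified with $\mathrm{PG}(m-2,\mathbb{K})$, is an irreducible non-singular curve of $\mathrm{PG}(m-2,\mathbb{K})$.
   Context: $\mathrm{PG}(n,\mathbb{K})$ denotes the $n$-dimensional projective space over $\mathbb{K}$. The equation with $k=1$ shows that $V$ is contained in the hyperplane $X_1+\cdots+X_m=0$ of $\mathrm{PG}(m-1,\mathbb{K})$. *)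

theory Defs
  imports
    "HOL-Library.Function_Algebras"
    "HOL-Library.Poly_Mapping"
    "HOL-Library.Extended_Nat"
    "HOL-Computational_Algebra.Computational_Algebra"
begin

text \<open>
  Coordinates are numbered from 0: \<open>PG(n, K)\<close> has homogeneous coordinates \<open>X\<^sub>0, \<dots>, X\<^sub>n\<close>.
  \<open>K\<^sup>n\<close> is the set of functions \<open>nat \<Rightarrow> K\<close> vanishing from \<open>n\<close> on.
\<close>

definition coord_space :: "nat \<Rightarrow> (nat \<Rightarrow> 'a::field) set" where
  "coord_space n = {v. \<forall>i\<ge>n. v i = 0}"

definition scale_fun :: "'a::field \<Rightarrow> (nat \<Rightarrow> 'a) \<Rightarrow> nat \<Rightarrow> 'a" where
  "scale_fun c v = (\<lambda>i. c * v i)"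

lemma vector_space_scale_fun: "vector_space (scale_fun :: 'a::field \<Rightarrow> _)"
  by unfold_locales (auto simp: scale_fun_def fun_eq_iff algebra_simps)

text \<open>A point is the set of all its homogeneous coordinate vectors.\<close>

definition proj_point :: "(nat \<Rightarrow> 'a::field) \<Rightarrow> (nat \<Rightarrow> 'a) set" where
  "proj_point v = {scale_fun c v | c. c \<noteq> 0}"

definition PG :: "nat \<Rightarrow> (nat \<Rightarrow> 'a::field) set set" where
  "PG n = proj_point ` (coord_space (Suc n) - {0})"

type_synonym 'a mvpoly = "(nat \<Rightarrow>\<^sub>0 nat) \<Rightarrow>\<^sub>0 'a"

definition mv_eval :: "'a::field mvpoly \<Rightarrow> (nat \<Rightarrow> 'a) \<Rightarrow> 'a" where
  "mv_eval F v = (\<Sum>\<mu>\<in>Poly_Mapping.keys F.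
     Poly_Mapping.lookup F \<mu> * (\<Prod>i\<in>Poly_Mapping.keys \<mu>. v i ^ Poly_Mapping.lookup \<mu> i))"

text \<open>Formal partial derivative. The subtraction on exponents truncates only where the
  coefficient \<open>lookup \<mu> i\<close> is 0.\<close>

definition mv_deriv :: "nat \<Rightarrow> 'a::field mvpoly \<Rightarrow> 'a mvpoly" where
  "mv_deriv i F =
     (\<Sum>\<mu>\<in>Poly_Mapping.keys F. Poly_Mapping.single (\<mu> - Poly_Mapping.single i 1)
                    (of_nat (Poly_Mapping.lookup \<mu> i) * Poly_Mapping.lookup F \<mu>))"

text \<open>Homogeneous polynomials (of any degree, including 0 and the nonzero constants) in
  \<open>X\<^sub>0, \<dots>, X\<^sub>n\<close>.\<close>

definition hom_polys :: "nat \<Rightarrow> 'a::field mvpoly set" where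
  "hom_polys n =
     {F. \<exists>d. \<forall>\<mu>\<in>Poly_Mapping.keys F. Poly_Mapping.keys \<mu> \<subseteq> {..n} \<and>
       (\<Sum>i\<in>Poly_Mapping.keys \<mu>. Poly_Mapping.lookup \<mu> i) = d}"

definition zero_locus :: "nat \<Rightarrow> 'a::field mvpoly set \<Rightarrow> (nat \<Rightarrow> 'a) set set" where
  "zero_locus n S = {P \<in> PG n. \<forall>F\<in>S. \<forall>v\<in>P. mv_eval F v = 0}"

definition proj_closed :: "nat \<Rightarrow> (nat \<Rightarrow> 'a::field) set set \<Rightarrow> bool" where
  "proj_closed n Z \<longleftrightarrow> (\<exists>S\<subseteq>hom_polys n. Z = zero_locus n S)"

definition irreducible_variety :: "nat \<Rightarrow> (nat \<Rightarrow> 'a::field) set set \<Rightarrow> bool" where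
  "irreducible_variety n Z \<longleftrightarrow> proj_closed n Z \<and> Z \<noteq> {} \<and>
     (\<forall>A B. proj_closed n A \<and> proj_closed n B \<and> Z = A \<union> B \<longrightarrow> Z = A \<or> Z = B)"

text \<open>Krull dimension: the supremum of the lengths of strictly increasing chains of
  irreducible closed subsets (which is 0 for the empty set).\<close>

definition variety_dim :: "nat \<Rightarrow> (nat \<Rightarrow> 'a::field) set set \<Rightarrow> enat" where
  "variety_dim n Z = Sup {enat d | d. \<exists>C :: nat \<Rightarrow> (nat \<Rightarrow> 'a) set set.
     (\<forall>i\<le>d. irreducible_variety n (C i) \<and> C i \<subseteq> Z) \<and> (\<forall>i<d. C i \<subset> C (Suc i))}"

text \<open>The homogeneous elements of the ideal of all polynomials vanishing on \<open>Z\<close>; they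
  generate it.\<close>

definition vanishing_polys :: "nat \<Rightarrow> (nat \<Rightarrow> 'a::field) set set \<Rightarrow> 'a mvpoly set" where
  "vanishing_polys n Z = {F \<in> hom_polys n. \<forall>P\<in>Z. \<forall>v\<in>P. mv_eval F v = 0}"

definition gradient :: "nat \<Rightarrow> 'a::field mvpoly \<Rightarrow> (nat \<Rightarrow> 'a) \<Rightarrow> nat \<Rightarrow> 'a" where
  "gradient n F v = (\<lambda>i. if i \<le> n then mv_eval (mv_deriv i F) v else 0)"

text \<open>Rank at \<open>v\<close> of the Jacobian matrix of (generators of) the homogeneous ideal of \<open>Z\<close>.\<close>

definition jacobian_rank :: "nat \<Rightarrow> (nat \<Rightarrow> 'a::field) set set \<Rightarrow> (nat \<Rightarrow> 'a) \<Rightarrow> nat" where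
  "jacobian_rank n Z v =
     vector_space.dim scale_fun ((\<lambda>F. gradient n F v) ` vanishing_polys n Z)"

text \<open>Jacobian criterion for a variety \<open>Z\<close> of \<open>PG(n, K)\<close>, all of whose components have the same
  dimension: at every point the rank is the codimension. By Euler's identity the
  rank of the homogeneous Jacobian equals that of the Jacobian in any affine chart around
  the point, in every characteristic.\<close>

definition nonsingular_variety :: "nat \<Rightarrow> (nat \<Rightarrow> 'a::field) set set \<Rightarrow> bool" where
  "nonsingular_variety n Z \<longleftrightarrow>
     (\<forall>P\<in>Z. \<forall>v\<in>P. enat (jacobian_rank n Z v) + variety_dim n Z = enat n)"

definition irreducible_nonsingular_curve :: "nat \<Rightarrow> (nat \<Rightarrow> 'a::field) set set \<Rightarrow> bool" where
  "irreducible_nonsingular_curve n Z \<longleftrightarrow>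
     irreducible_variety n Z \<and> variety_dim n Z = 1 \<and> nonsingular_variety n Z"

definition power_sum :: "nat \<Rightarrow> nat \<Rightarrow> 'a::field mvpoly" where
  "power_sum m k = (\<Sum>i<m. Poly_Mapping.single (Poly_Mapping.single i k) 1)"

definition power_sum_variety :: "nat \<Rightarrow> (nat \<Rightarrow> 'a::field) set set" where
  "power_sum_variety m = zero_locus (m - 1) (power_sum m ` {1..m - 2})"

definition sum_hyperplane :: "nat \<Rightarrow> (nat \<Rightarrow> 'a::field) set set" where
  "sum_hyperplane m = zero_locus (m - 1) {power_sum m 1}"

text \<open>An identification of \<open>PG(m - 2, K)\<close> with the hyperplane \<open>X\<^sub>0 + \<dots> + X\<^bsub>m-1\<^esub> = 0\<close> is
  induced by a linear isomorphism \<open>\<phi>\<close> of the underlying vector spaces. Only the values of \<open>\<phi>\<close> on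
  \<open>K\<^bsup>m-1\<^esup>\<close> matter; requiring \<open>\<phi>\<close> to be linear everywhere is no restriction, as a linear map on
  \<open>K\<^bsup>m-1\<^esup>\<close> extends.\<close>

definition hyperplane_identification ::
    "nat \<Rightarrow> ((nat \<Rightarrow> 'a::field) \<Rightarrow> (nat \<Rightarrow> 'a)) \<Rightarrow> bool" where
  "hyperplane_identification m \<phi> \<longleftrightarrow> Vector_Spaces.linear scale_fun scale_fun \<phi> \<and>
     bij_betw \<phi> (coord_space (m - 1)) {v \<in> coord_space m. (\<Sum>i<m. v i) = 0}"

text \<open>The standard identification eliminates the last coordinate.\<close>

lemma hyperplane_identification_standard:
  assumes "m \<ge> 1"
  shows "hyperplane_identification m
    (\<lambda>v i. if i < m - 1 then v i else if i = m - 1 then - (\<Sum>j<m - 1. v j) else (0 :: 'a::field))"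
    (is "hyperplane_identification m ?\<phi>")
proof -
  obtain n where m: "m = Suc n"
    using assms by (cases m) auto
  have "Vector_Spaces.linear scale_fun scale_fun ?\<phi>"
    by (auto simp: Vector_Spaces.linear_def module_hom_def module_hom_axioms_def
          vector_space_scale_fun module_iff_vector_space scale_fun_def fun_eq_iff
          sum.distrib sum_distrib_left)
  moreover have "bij_betw ?\<phi> (coord_space (m - 1)) {v \<in> coord_space m. (\<Sum>i<m. v i) = 0}"
    by (rule bij_betw_byWitness [where f' = "\<lambda>v i. if i < n then v i else 0"])
       (auto simp: m coord_space_def fun_eq_iff add_eq_0_iff
          intro: sum.cong)
  ultimately show ?thesis
    by (simp add: hyperplane_identification_def)
qed

text \<open>The subset of \<open>PG(n, K)\<close> corresponding to \<open>Z\<close> under the map of points induced by \<open>\<phi>\<close>.\<close>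

definition transport :: "nat \<Rightarrow> ((nat \<Rightarrow> 'a::field) \<Rightarrow> (nat \<Rightarrow> 'a)) \<Rightarrow>
    (nat \<Rightarrow> 'a) set set \<Rightarrow> (nat \<Rightarrow> 'a) set set" where
  "transport n \<phi> Z = {P \<in> PG n. \<phi> ` P \<in> Z}"

end

(*
  By Newton's identities a point x with vanishing power sums of exponents 1, ..., m - 2 is
  a tuple of all roots of a trinomial X^m + aX + b. Adjoining the roots one by one exhibits
  the polynomial functions modulo the power sums as a free module over K[a, b], and interpolation at
  the permutations of distinct roots shows that every polynomial vanishing on the variety lies in the
  ideal of the power sums. Hence the Jacobian matrix of the vanishing ideal is a Vandermonde matrix,
  of the right rank because X^m + aX + b has at most one multiple root, which is a double root.

  The variety is irreducible because the Galois group of X^m + aX + b is the full symmetric group: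
  the branches of X^m + tX - 1, X^m - X + t and X^m - mX + (m - 1) + t^2 at t = 0, whose roots are
  power series by Hensel's lemma, have the symmetries t -> wt. These show that the group is transitive,
  that a point stabiliser is transitive on the other roots, and that there is a transposition. The
  dimension is 1, as the norm of a form that does not vanish identically is a nonzero polynomial in
  a and b, so that the form has only finitely many zeros on the variety.
*)

theory Submission
  imports Defs "HOL-Combinatorics.Permutations" "HOL-Combinatorics.Cycles"
begin

text \<open>The characteristic enters only through the integers 1, ..., m being nonzero in K.
  Besides the points over K two kinds of points with coordinates in K[[t]] are needed: branches of
  the curve, where irreducibility can be read off because K[[t]] is a domain, and lines w + tu,
  along which the coefficient of t is a derivative. Such lines leave the cone over the variety. So
  "modulo the power sums" must say more than "vanishing on the cone": at every point, on the cone or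
  off it, the value has to lie in the ideal of K[[t]] generated by the values of the power sums at
  that point. Working with functions on points also avoids quotient rings. The Galois group appears
  without field extensions, as the set of rearrangements of the coordinates of one branch that
  satisfy the same homogeneous equations over K. Each symmetry is visible on a different branch. The
  branches can be compared because the scalings and permutations of any one of them are dense in the
  cone, so that all branches satisfy the same equations up to a rearrangement.\<close>

section \<open>Subrings of a commutative ring and adjunction of an element\<close>

definition subring_set :: "'b::comm_ring_1 set \<Rightarrow> bool" where
  "subring_set S \<longleftrightarrow> 0 \<in> S \<and> 1 \<in> S \<and> (\<forall>x\<in>S. - x \<in> S) \<and>
     (\<forall>x\<in>S. \<forall>y\<in>S. x + y \<in> S \<and> x * y \<in> S)"

definition poly_over :: "'b::comm_ring_1 set \<Rightarrow> 'b poly set" where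
  "poly_over S = {p. \<forall>k. coeff p k \<in> S}"

definition adjoin :: "'b::comm_ring_1 set \<Rightarrow> 'b \<Rightarrow> 'b set" where
  "adjoin S y = (\<lambda>p. poly p y) ` poly_over S"

lemma subring_setD:
  assumes "subring_set S"
  shows "0 \<in> S" "1 \<in> S" "x \<in> S \<Longrightarrow> - x \<in> S" "x \<in> S \<Longrightarrow> y \<in> S \<Longrightarrow> x + y \<in> S"
    "x \<in> S \<Longrightarrow> y \<in> S \<Longrightarrow> x * y \<in> S"
  using assms by (auto simp: subring_set_def)

lemma subring_set_diff: "subring_set S \<Longrightarrow> x \<in> S \<Longrightarrow> y \<in> S \<Longrightarrow> x - y \<in> S"
  using subring_setD(4)[of S x "- y"] subring_setD(3)[of S y] by simp

lemma subring_set_sum: "subring_set S \<Longrightarrow> (\<And>i. i \<in> I \<Longrightarrow> f i \<in> S) \<Longrightarrow> sum f I \<in> S"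
  by (induction I rule: infinite_finite_induct) (auto simp: subring_setD)

lemma subring_set_power: "subring_set S \<Longrightarrow> x \<in> S \<Longrightarrow> x ^ n \<in> S"
  by (induction n) (auto simp: subring_setD)

lemma subring_set_of_nat: "subring_set S \<Longrightarrow> of_nat n \<in> S"
  by (induction n) (auto simp: subring_setD)

lemma subring_poly_over:
  assumes S: "subring_set S"
  shows "subring_set (poly_over S)"
  unfolding subring_set_def poly_over_def
  by (auto simp: coeff_mult subring_setD[OF S] intro!: subring_set_sum[OF S])

lemma pCons_poly_over: "pCons c p \<in> poly_over S \<longleftrightarrow> c \<in> S \<and> p \<in> poly_over S"
proof
  assume "pCons c p \<in> poly_over S"
  then have *: "coeff (pCons c p) k \<in> S" for k
    by (auto simp: poly_over_def)
  from *[of 0] have "c \<in> S" by simp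
  moreover have "coeff p k \<in> S" for k
    using *[of "Suc k"] by simp
  ultimately show "c \<in> S \<and> p \<in> poly_over S"
    by (auto simp: poly_over_def)
qed (auto simp: poly_over_def coeff_pCons split: nat.split)

lemma subring_adjoin:
  assumes S: "subring_set S"
  shows "subring_set (adjoin S y)"
proof -
  note P = subring_setD[OF subring_poly_over[OF S]]
  have "poly 0 y \<in> adjoin S y" "poly 1 y \<in> adjoin S y"
    unfolding adjoin_def using P by blast+
  moreover have "- poly p y \<in> adjoin S y" if "p \<in> poly_over S" for p
    unfolding adjoin_def using P(3)[OF that] by (metis image_eqI poly_minus)
  moreover have "poly p y + poly q y \<in> adjoin S y" "poly p y * poly q y \<in> adjoin S y"
    if "p \<in> poly_over S" "q \<in> poly_over S" for p q
    unfolding adjoin_def using P(4,5)[OF that] by (metis image_eqI poly_add poly_mult)+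
  ultimately show ?thesis
    by (auto simp: subring_set_def adjoin_def)
qed

lemma subset_adjoin:
  assumes S: "subring_set S"
  shows "S \<subseteq> adjoin S y"
proof
  fix x assume "x \<in> S"
  then have "[:x:] \<in> poly_over S"
    by (auto simp: pCons_poly_over subring_setD[OF subring_poly_over[OF S]])
  then have "poly [:x:] y \<in> adjoin S y"
    unfolding adjoin_def by blast
  then show "x \<in> adjoin S y" by simp
qed

lemma in_adjoin:
  assumes S: "subring_set S"
  shows "y \<in> adjoin S y"
proof -
  have "[:0, 1:] \<in> poly_over S"
    by (simp add: pCons_poly_over subring_setD[OF S] subring_setD[OF subring_poly_over[OF S]])
  then have "poly [:0, 1:] y \<in> adjoin S y"
    unfolding adjoin_def by blast
  then show ?thesis by simp
qed

text \<open>In Horner's scheme the coefficients of the quotient are the values at \<open>y\<close>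
  of the successive tails of \<open>p\<close>.\<close>

lemma synthetic_div_poly_over:
  assumes S: "subring_set S" and p: "p \<in> poly_over S"
  shows "synthetic_div p y \<in> poly_over (adjoin S y)"
  using p
proof (induction p)
  case 0
  then show ?case
    using subring_setD(1)[OF subring_poly_over[OF subring_adjoin[OF S]]] by simp
next
  case (pCons a p)
  then show ?case
    by (auto simp: pCons_poly_over adjoin_def)
qed

text \<open>Splitting off the root \<open>y\<close> costs only the adjunction of \<open>y\<close>.
  Division by the monic X - y is unique in every commutative ring, so zero divisors do no
  harm.\<close>

lemma cofactor_poly_over:
  fixes y :: "'b::comm_ring_1"
  assumes S: "subring_set S" and p: "[:- y, 1:] * q \<in> poly_over S"
  shows "q \<in> poly_over (adjoin S y)"
proof -
  have "[:- y, 1:] * q + smult y q = pCons 0 q"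
    by (simp add: algebra_simps)
  then have "q = synthetic_div ([:- y, 1:] * q) y"
    using synthetic_div_unique by blast
  then show ?thesis
    using synthetic_div_poly_over[OF S p, of y] by simp
qed

text \<open>Division with remainder by a monic polynomial works over any commutative ring. It shows
  that the powers of \<open>y\<close> below \<open>degree f\<close> span \<open>adjoin S y\<close>
  over \<open>S\<close>.\<close>

lemma poly_over_reduce:
  fixes f :: "'b::comm_ring_1 poly"
  assumes S: "subring_set S" and f: "f \<in> poly_over S" "lead_coeff f = 1" "poly f y = 0"
    and p: "p \<in> poly_over S"
  shows "\<exists>q\<in>poly_over S. (\<forall>k\<ge>degree f. coeff q k = 0) \<and> poly q y = poly p y"
  using p
proof (induction "degree p" arbitrary: p rule: less_induct)
  case less
  note P = subring_setD[OF subring_poly_over[OF S]]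
  show ?case
  proof (cases "degree p < degree f")
    case True
    then show ?thesis
      using less.prems by (intro bexI[of _ p]) (auto simp: coeff_eq_0)
  next
    case False
    define d where "d = degree p - degree f"
    define q where "q = p - monom (lead_coeff p) d * f"
    have mono: "monom (lead_coeff p) d \<in> poly_over S"
      using less.prems by (auto simp: poly_over_def subring_setD[OF S])
    have q: "q \<in> poly_over S"
      unfolding q_def
      by (intro subring_set_diff[OF subring_poly_over[OF S]] P(5) less.prems mono f)
    have qy: "poly q y = poly p y"
      by (simp add: q_def f)
    have c: "coeff q k = 0" if "k \<ge> degree p" for k
    proof (cases "k = degree p")
      case True
      then show ?thesis
        using False f(2) by (simp add: q_def d_def coeff_monom_mult)
    next
      case False
      then have "coeff p k = 0" "k - d > degree f"
        using that \<open>\<not> degree p < degree f\<close> by (auto simp: coeff_eq_0 d_def)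
      then show ?thesis
        by (simp add: q_def coeff_monom_mult coeff_eq_0)
    qed
    \<comment> \<open>From degree 0 the degree cannot drop strictly; there the subtraction leaves
      0.\<close>
    show ?thesis
    proof (cases "degree p = 0")
      case True
      then have "q = 0"
        using c by (intro poly_eqI) auto
      then show ?thesis
        using qy P(1) by (intro bexI[of _ 0]) auto
    next
      case False
      then have "degree q < degree p"
        using c by (intro degree_lessI) auto
      from less.hyps[OF this q] show ?thesis
        using qy by simp
    qed
  qed
qed

subsection \<open>Newton's identities\<close>

definition root_poly :: "'i set \<Rightarrow> ('i \<Rightarrow> 'b::comm_ring_1) \<Rightarrow> 'b poly" where
  "root_poly I y = (\<Prod>i\<in>I. [:- y i, 1:])"

text \<open>The rings of functions used later have zero divisors, so degrees of products are
  controlled through the coefficients instead of by additivity.\<close>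

lemma
  assumes "finite I"
  shows degree_root_poly: "degree (root_poly I y) = card I"
    and coeff_root_poly_card: "coeff (root_poly I y) (card I) = 1"
proof -
  have "coeff (root_poly I y) (card I) = 1 \<and> (\<forall>k>card I. coeff (root_poly I y) k = 0)"
    using assms
  proof induction
    case (insert a I)
    then show ?case
      by (auto simp: root_poly_def coeff_pCons split: nat.split)
  qed (simp add: root_poly_def coeff_pCons split: nat.split)
  then have *: "coeff (root_poly I y) (card I) = 1" "\<forall>k>card I. coeff (root_poly I y) k = 0"
    by auto
  then show "coeff (root_poly I y) (card I) = 1" by simp
  have "degree (root_poly I y) \<le> card I"
    using *(2) by (rule degree_le)
  moreover have "card I \<le> degree (root_poly I y)"
    using *(1) by (intro le_degree) simp
  ultimately show "degree (root_poly I y) = card I" by simp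
qed

lemma poly_root_poly: "poly (root_poly I y) z = (\<Prod>i\<in>I. z - y i)"
  by (simp add: root_poly_def poly_prod)

lemma poly_root_poly_root: "finite I \<Longrightarrow> i \<in> I \<Longrightarrow> poly (root_poly I y) (y i) = 0"
  by (simp add: poly_root_poly prod.remove[of I i])

lemma root_poly_remove:
  "finite I \<Longrightarrow> i \<in> I \<Longrightarrow> root_poly I y = [:- y i, 1:] * root_poly (I - {i}) y"
  by (simp add: root_poly_def prod.remove)

lemma pderiv_root_poly:
  fixes v :: "nat \<Rightarrow> 'b::idom"
  assumes "finite I" "i \<in> I"
  shows "poly (pderiv (root_poly I v)) (v i) = (\<Prod>j\<in>I - {i}. v i - v j)"
  unfolding root_poly_remove[OF assms]
  by (simp add: pderiv_mult pderiv_pCons poly_root_poly del: mult_pCons_left mult_pCons_right)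

text \<open>This is the product rule: the products with one factor omitted add up to the derivative
  of \<open>root_poly I y\<close>.\<close>

lemma coeff_sum_cofactors:
  assumes "finite I"
  shows "coeff (\<Sum>i\<in>I. root_poly (I - {i}) y) k = of_nat (Suc k) * coeff (root_poly I y) (Suc k)"
  using assms
proof (induction I arbitrary: k)
  case (insert a I)
  have eq: "root_poly (insert a I) y = [:- y a, 1:] * root_poly I y"
    using insert by (simp add: root_poly_def)
  have "(\<Sum>i\<in>insert a I. root_poly (insert a I - {i}) y)
      = root_poly I y + (\<Sum>i\<in>I. [:- y a, 1:] * root_poly (I - {i}) y)"
  proof -
    have "root_poly (insert a I - {i}) y = [:- y a, 1:] * root_poly (I - {i}) y" if "i \<in> I" for i
    proof -
      have "insert a I - {i} = insert a (I - {i})" "a \<notin> I - {i}" "finite (I - {i})"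
        using that insert by auto
      then show ?thesis by (simp add: root_poly_def)
    qed
    moreover have "insert a I - {a} = I" using insert by auto
    ultimately show ?thesis using insert by simp
  qed
  also have "\<dots> = root_poly I y + [:- y a, 1:] * (\<Sum>i\<in>I. root_poly (I - {i}) y)"
    by (simp add: sum_distrib_left)
  finally have "coeff (\<Sum>i\<in>insert a I. root_poly (insert a I - {i}) y) k
    = coeff (root_poly I y + [:- y a, 1:] * (\<Sum>i\<in>I. root_poly (I - {i}) y)) k"
    by simp
  also have "\<dots> = of_nat (Suc k) * coeff (root_poly (insert a I) y) (Suc k)"
    unfolding eq by (cases k) (simp_all add: insert.IH algebra_simps coeff_pCons del: coeff_sum)
  finally show ?case .
qed (simp add: root_poly_def)

text \<open>Horner's scheme written out; summed over all roots \<open>c\<close>, the right-hand side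
  becomes a combination of power sums.\<close>

lemma coeff_synthetic_div:
  fixes p :: "'b::comm_ring_1 poly"
  assumes "degree p \<le> n"
  shows "coeff (synthetic_div p c) k = (\<Sum>j\<in>{k<..n}. coeff p j * c ^ (j - Suc k))"
  using assms
proof (induction p arbitrary: n k)
  case (pCons a p)
  show ?case
  proof (cases "p = 0")
    case True
    then show ?thesis
      by (auto simp: coeff_pCons intro!: sum.neutral split: nat.split)
  next
    case False
    then obtain n' where n: "n = Suc n'" "degree p \<le> n'"
      using pCons.prems by (cases n) auto
    show ?thesis
    proof (cases k)
      case 0
      have "coeff (synthetic_div (pCons a p) c) k = poly p c"
        using 0 by simp
      also have "\<dots> = (\<Sum>j\<le>n'. coeff p j * c ^ j)"
        by (rule poly_altdef[THEN trans], rule sum.mono_neutral_left) (use n in \<open>auto simp: coeff_eq_0\<close>)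
      also have "\<dots> = (\<Sum>j\<in>{k<..n}. coeff (pCons a p) j * c ^ (j - Suc k))"
        by (rule sum.reindex_bij_witness[of _ "\<lambda>j. j - 1" Suc]) (use 0 n in auto)
      finally show ?thesis .
    next
      case (Suc k')
      have "coeff (synthetic_div (pCons a p) c) k = (\<Sum>j\<in>{k'<..n'}. coeff p j * c ^ (j - Suc k'))"
        using Suc pCons.IH[OF n(2)] by simp
      also have "\<dots> = (\<Sum>j\<in>{k<..n}. coeff (pCons a p) j * c ^ (j - Suc k))"
        by (rule sum.reindex_bij_witness[of _ "\<lambda>j. j - 1" Suc]) (use Suc n in auto)
      finally show ?thesis .
    qed
  qed
qed simp

definition psum :: "'i set \<Rightarrow> ('i \<Rightarrow> 'b::comm_ring_1) \<Rightarrow> nat \<Rightarrow> 'b" where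
  "psum I y k = (\<Sum>i\<in>I. y i ^ k)"

text \<open>The sum of the cofactors f/(X - y_i) is computed twice: as the derivative of f, and by
  synthetic division, where summation over the roots produces power sums.\<close>

lemma newton_identity:
  fixes y :: "'i \<Rightarrow> 'b::comm_ring_1"
  assumes I: "finite I" and l: "l \<le> card I"
  shows "of_nat l * coeff (root_poly I y) (card I - l)
    = - (\<Sum>r\<in>{1..l}. coeff (root_poly I y) (card I - l + r) * psum I y r)"
proof -
  define f where "f = root_poly I y"
  have deg: "degree f = card I"
    using degree_root_poly[OF I] by (simp add: f_def)
  have *: "(\<Sum>r\<in>{0..l}. coeff f (card I - l + r) * psum I y r)
    = of_nat (card I - l) * coeff f (card I - l)"
  proof (cases "l = card I")
    \<comment> \<open>The cofactors have no coefficient of index -1; in this case the identity is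
      the sum of the equations f(y_i) = 0.\<close>
    case True
    have "(\<Sum>r\<in>{0..card I}. coeff f r * psum I y r) = (\<Sum>i\<in>I. poly f (y i))"
      unfolding psum_def poly_altdef deg sum_distrib_left
      by (subst sum.swap) (simp add: atMost_atLeast0)
    also have "\<dots> = 0"
      using I by (simp add: f_def poly_root_poly_root)
    finally show ?thesis using True by simp
  next
    case False
    then obtain k where k: "card I - l = Suc k"
      using l by (cases "card I - l") auto
    have co: "root_poly (I - {i}) y = synthetic_div f (y i)" if "i \<in> I" for i
    proof -
      have "f + smult (y i) (root_poly (I - {i}) y) = pCons 0 (root_poly (I - {i}) y)"
        unfolding f_def root_poly_remove[OF I that] by (simp add: algebra_simps)
      then show ?thesis
        using synthetic_div_unique by blast
    qed
    have "of_nat (Suc k) * coeff f (Suc k) = coeff (\<Sum>i\<in>I. root_poly (I - {i}) y) k"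
      using coeff_sum_cofactors[OF I, of y k] by (simp add: f_def)
    also have "\<dots> = (\<Sum>i\<in>I. \<Sum>j\<in>{k<..card I}. coeff f j * y i ^ (j - Suc k))"
      using deg by (simp add: coeff_sum co coeff_synthetic_div[of f "card I"])
    also have "\<dots> = (\<Sum>j\<in>{k<..card I}. coeff f j * psum I y (j - Suc k))"
      by (subst sum.swap) (simp add: psum_def sum_distrib_left)
    also have "\<dots> = (\<Sum>r\<in>{0..l}. coeff f (card I - l + r) * psum I y r)"
      by (rule sum.reindex_bij_witness[of _ "\<lambda>r. Suc k + r" "\<lambda>j. j - Suc k"])
        (use k l in auto)
    finally show ?thesis using k by simp
  qed
  \<comment> \<open>The term r = 0 contains \<open>psum I y 0\<close>, the number of roots; moving
    it to the other side leaves the factor \<open>l\<close>.\<close>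
  have "(\<Sum>r\<in>{0..l}. coeff f (card I - l + r) * psum I y r)
    = of_nat (card I) * coeff f (card I - l) + (\<Sum>r\<in>{1..l}. coeff f (card I - l + r) * psum I y r)"
    by (subst sum.atLeast_Suc_atMost) (auto simp: psum_def mult.commute)
  with * have "(\<Sum>r\<in>{1..l}. coeff f (card I - l + r) * psum I y r)
    = (of_nat (card I - l) - of_nat (card I)) * coeff f (card I - l)"
    by (simp add: algebra_simps)
  also have "\<dots> = - (of_nat l * coeff f (card I - l))"
    using l by (simp add: of_nat_diff algebra_simps)
  finally show ?thesis by (simp add: f_def)
qed

text \<open>Multiply f(y_i) = 0 by y_i^s and sum over the roots.\<close>

lemma psum_high:
  fixes y :: "'i \<Rightarrow> 'b::comm_ring_1"
  assumes I: "finite I"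
  shows "psum I y (card I + s) = - (\<Sum>j<card I. coeff (root_poly I y) j * psum I y (j + s))"
proof -
  define f where "f = root_poly I y"
  have deg: "degree f = card I" and lc: "coeff f (card I) = 1"
    using degree_root_poly[OF I, of y] coeff_root_poly_card[OF I, of y] by (auto simp: f_def)
  have "0 = (\<Sum>i\<in>I. y i ^ s * poly f (y i))"
    using I by (simp add: f_def poly_root_poly_root)
  also have "\<dots> = (\<Sum>i\<in>I. \<Sum>j\<le>card I. coeff f j * y i ^ (j + s))"
    by (simp add: poly_altdef deg sum_distrib_left power_add mult_ac)
  also have "\<dots> = (\<Sum>j\<le>card I. coeff f j * psum I y (j + s))"
    by (subst sum.swap) (simp add: psum_def sum_distrib_left)
  also have "\<dots> = (\<Sum>j<card I. coeff f j * psum I y (j + s)) + psum I y (card I + s)"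
    by (simp add: lc lessThan_Suc_atMost[symmetric])
  finally show ?thesis
    by (simp add: f_def add_eq_0_iff)
qed

text \<open>In Newton's identity the highest power sum has the leading coefficient 1 as its factor,
  so it can be solved for without any division.\<close>

lemma psum_in_subring:
  fixes y :: "'i \<Rightarrow> 'b::comm_ring_1"
  assumes S: "subring_set S" and I: "finite I" and f: "root_poly I y \<in> poly_over S"
  shows "psum I y k \<in> S"
proof (induction k rule: less_induct)
  case (less k)
  have c: "coeff (root_poly I y) j \<in> S" for j
    using f by (auto simp: poly_over_def)
  note SS = subring_setD[OF S]
  show ?case
  proof (cases "k < card I")
    case True
    show ?thesis
    proof (cases "k = 0")
      case True
      then show ?thesis by (simp add: psum_def subring_set_of_nat[OF S])
    next
      case False
      have "of_nat k * coeff (root_poly I y) (card I - k)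
        = - (\<Sum>r\<in>insert k {1..<k}. coeff (root_poly I y) (card I - k + r) * psum I y r)"
      proof -
        have "{1..k} = insert k {1..<k}" using False by auto
        then show ?thesis
          using newton_identity[OF I, of k y] True by simp
      qed
      also have "\<dots> = - (psum I y k + (\<Sum>r\<in>{1..<k}. coeff (root_poly I y) (card I - k + r) * psum I y r))"
        using True coeff_root_poly_card[OF I, of y] by simp
      finally have eq: "of_nat k * coeff (root_poly I y) (card I - k) = \<dots>" .
      have "psum I y k = - (of_nat k * coeff (root_poly I y) (card I - k))
        - (\<Sum>r\<in>{1..<k}. coeff (root_poly I y) (card I - k + r) * psum I y r)"
        unfolding eq by simp
      moreover have "(\<Sum>r\<in>{1..<k}. coeff (root_poly I y) (card I - k + r) * psum I y r) \<in> S"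
        using less c by (intro subring_set_sum[OF S] SS(5)) auto
      ultimately show ?thesis
        using c by (auto intro!: subring_set_diff[OF S] SS(3,5) subring_set_of_nat[OF S])
    qed
  next
    case False
    then have "psum I y k = - (\<Sum>j<card I. coeff (root_poly I y) j * psum I y (j + (k - card I)))"
      using psum_high[OF I, of y "k - card I"] by simp
    also have "\<dots> \<in> S"
      using less c False by (intro SS(3) subring_set_sum[OF S] SS(5)) auto
    finally show ?thesis .
  qed
qed

text \<open>By Newton's identities in both directions, as positive integers up to the number of roots are
  invertible.\<close>

lemma norm_in_subring:
  fixes y :: "'i \<Rightarrow> 'b::comm_ring_1"
  assumes S: "subring_set S" and I: "finite I" and f: "root_poly I y \<in> poly_over S"
    and q: "q \<in> poly_over S"
    and inv: "\<And>l. 0 < l \<Longrightarrow> l \<le> card I \<Longrightarrow> \<exists>u\<in>S. of_nat l * u = 1"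
  shows "(\<Prod>i\<in>I. poly q (y i)) \<in> S"
proof -
  note SS = subring_setD[OF S]
  define z where "z = (\<lambda>i. poly q (y i))"
  have ps: "psum I z k \<in> S" for k
  proof -
    have "psum I z k = (\<Sum>i\<in>I. poly (q ^ k) (y i))"
      by (simp add: psum_def z_def poly_power)
    also have "\<dots> = (\<Sum>j\<le>degree (q ^ k). coeff (q ^ k) j * psum I y j)"
      unfolding poly_altdef psum_def sum_distrib_left by (rule sum.swap)
    also have "\<dots> \<in> S"
      using subring_set_power[OF subring_poly_over[OF S] q, of k]
      by (intro subring_set_sum[OF S] SS(5) psum_in_subring[OF S I f]) (auto simp: poly_over_def)
    finally show ?thesis .
  qed
  \<comment> \<open>Newton's identity for the values \<open>z i\<close>, now solved for a
    coefficient; this direction has to divide by \<open>l\<close>.\<close>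
  have "l \<le> card I \<Longrightarrow> coeff (root_poly I z) (card I - l) \<in> S" for l
  proof (induction l rule: less_induct)
    case (less l)
    show ?case
    proof (cases "l = 0")
      case True
      then show ?thesis using True coeff_root_poly_card[OF I, of z] SS(2) by simp
    next
      case False
      then obtain u where u: "u \<in> S" "of_nat l * u = 1"
        using inv[of l] less.prems by auto
      have "coeff (root_poly I z) (card I - l + r) * psum I z r \<in> S" if "r \<in> {1..l}" for r
      proof -
        have eq: "card I - l + r = card I - (l - r)" using that less.prems by auto
        have "coeff (root_poly I z) (card I - (l - r)) \<in> S"
          by (rule less.IH) (use that less.prems in auto)
        then show ?thesis unfolding eq by (rule SS(5)[OF _ ps])
      qed
      then have "of_nat l * coeff (root_poly I z) (card I - l) \<in> S"
        unfolding newton_identity[OF I less.prems] by (rule SS(3)[OF subring_set_sum[OF S]])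
      then have "u * (of_nat l * coeff (root_poly I z) (card I - l)) \<in> S"
        by (rule SS(5)[OF u(1)])
      also have "u * (of_nat l * coeff (root_poly I z) (card I - l))
        = (of_nat l * u) * coeff (root_poly I z) (card I - l)"
        by (simp only: mult_ac)
      finally show ?thesis using u(2) by simp
    qed
  qed
  \<comment> \<open>The constant coefficient is the norm up to sign.\<close>
  from this[of "card I"] have "poly (root_poly I z) 0 \<in> S"
    by (simp add: poly_0_coeff_0)
  then have "(\<Prod>i\<in>I. - z i) \<in> S"
    by (simp add: poly_root_poly)
  then have "(- 1) ^ card I * (\<Prod>i\<in>I. - z i) \<in> S"
    using SS(2,3) subring_set_power[OF S, of "- 1"] by (intro SS(5)) auto
  also have "(- 1) ^ card I * (\<Prod>i\<in>I. - z i) = (\<Prod>i\<in>I. (- 1) * (- z i))"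
    by (simp only: prod.distrib prod_constant)
  finally show ?thesis by (simp add: z_def)
qed

subsection \<open>Polynomial functions modulo the power sums\<close>

lemma sum_fun_apply: "(\<Sum>i\<in>I. f i) x = (\<Sum>i\<in>I. f i x)"
  for f :: "'i \<Rightarrow> 'x \<Rightarrow> 'b::comm_ring_1"
  by (induction I rule: infinite_finite_induct) auto

lemma prod_fun_apply: "(\<Prod>i\<in>I. f i) x = (\<Prod>i\<in>I. f i x)"
  for f :: "'i \<Rightarrow> 'x \<Rightarrow> 'b::comm_ring_1"
  by (induction I rule: infinite_finite_induct) auto

lemma power_fun_apply: "(f ^ n) x = f x ^ n"
  for f :: "'x \<Rightarrow> 'b::comm_ring_1"
  by (induction n) auto

lemma of_nat_fun_apply: "(of_nat n :: 'x \<Rightarrow> 'b::comm_ring_1) x = of_nat n"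
  by (induction n) auto

lemma poly_fun_apply: "(poly p y) x = poly (map_poly (\<lambda>g. g x) p) (y x)"
  for y :: "'x \<Rightarrow> 'b::comm_ring_1"
  by (induction p) (auto simp: map_poly_pCons)

lemma coeff_root_poly_fun:
  fixes y :: "'i \<Rightarrow> 'x \<Rightarrow> 'b::comm_ring_1"
  shows "(coeff (root_poly I y) k) x = coeff (root_poly I (\<lambda>i. y i x)) k"
proof (induction I arbitrary: k rule: infinite_finite_induct)
  case (insert a I)
  then show ?case
    by (auto simp: root_poly_def coeff_pCons split: nat.split)
qed (auto simp: root_poly_def coeff_pCons split: nat.split)

lemma root_poly_permutes:
  assumes "\<sigma> permutes I"
  shows "root_poly I (y \<circ> \<sigma>) = root_poly I y"
  unfolding root_poly_def
  using prod.permute[OF assms, of "\<lambda>i. [:- y i, 1:]"] by (simp add: o_def)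

lemma psum_permutes:
  assumes "\<sigma> permutes I"
  shows "psum I (y \<circ> \<sigma>) k = psum I y k"
  unfolding psum_def
  using sum.permute[OF assms, of "\<lambda>i. y i ^ k"] by (simp add: o_def)

text \<open>Points have coordinates in \<open>K[[t]]\<close>; those with constant coordinates are the points over
  \<open>K\<close>.\<close>

type_synonym 'a pt = "nat \<Rightarrow> 'a fps"

definition ps_ideal :: "nat \<Rightarrow> 'a::field pt \<Rightarrow> 'a fps set" where
  "ps_ideal m x = {z. \<exists>q. z = (\<Sum>k\<in>{1..m - 2}. q k * psum {..<m} x k)}"

definition ps_cone :: "nat \<Rightarrow> 'a::field pt set" where
  "ps_cone m = {x. \<forall>k\<in>{1..m - 2}. psum {..<m} x k = 0}"

text \<open>Stands in for the ideal generated by the power sums; the multipliers may depend on the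
  point in any way. On the cone such functions vanish, and where the power sums vanish to first
  order in t, so do they.\<close>

definition ps_null :: "nat \<Rightarrow> ('a::field pt \<Rightarrow> 'a fps) set" where
  "ps_null m = {g. \<forall>x. g x \<in> ps_ideal m x}"

definition coord :: "nat \<Rightarrow> 'a::field pt \<Rightarrow> 'a fps" where
  "coord i = (\<lambda>x. x i)"

text \<open>Up to sign an elementary symmetric function of the first m coordinates.
  \<open>ecoeff m 1\<close> and \<open>ecoeff m 0\<close> are the coefficients a and b of the
  trinomial.\<close>

definition ecoeff :: "nat \<Rightarrow> nat \<Rightarrow> 'a::field pt \<Rightarrow> 'a fps" where
  "ecoeff m k x = coeff (root_poly {..<m} x) k"

definition const_funs :: "('a::field pt \<Rightarrow> 'a fps) set" where
  "const_funs = range (\<lambda>c x. fps_const c)"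

definition base_ring :: "nat \<Rightarrow> ('a::field pt \<Rightarrow> 'a fps) set" where
  "base_ring m = adjoin (adjoin const_funs (ecoeff m 0)) (ecoeff m 1)"

text \<open>Modulo the power sums, the ring of polynomial functions is built up by adjoining the roots
  of \<open>X\<^sup>m + aX + b\<close> one after the other to \<open>K[a, b]\<close>.\<close>

primrec tower :: "nat \<Rightarrow> nat \<Rightarrow> ('a::field pt \<Rightarrow> 'a fps) set" where
  "tower m 0 = {g + h | g h. g \<in> base_ring m \<and> h \<in> ps_null m}"
| "tower m (Suc i) = adjoin (tower m i) (coord i)"

lemma coeff_root_poly_coord: "coeff (root_poly {..<m} coord) k = ecoeff m k"
  by (rule ext) (simp add: coeff_root_poly_fun ecoeff_def coord_def)

lemma ps_idealI: "z = (\<Sum>k\<in>{1..m - 2}. q k * psum {..<m} x k) \<Longrightarrow> z \<in> ps_ideal m x"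
  by (auto simp: ps_ideal_def)

lemma ps_ideal_zero: "0 \<in> ps_ideal m x"
  by (rule ps_idealI[where q = "\<lambda>_. 0"]) simp

lemma ps_ideal_add: "u \<in> ps_ideal m x \<Longrightarrow> v \<in> ps_ideal m x \<Longrightarrow> u + v \<in> ps_ideal m x"
  unfolding ps_ideal_def
  by (force simp: sum.distrib[symmetric] distrib_right[symmetric])

lemma ps_ideal_mult: "u \<in> ps_ideal m x \<Longrightarrow> c * u \<in> ps_ideal m x"
  unfolding ps_ideal_def
  by (force simp: sum_distrib_left mult.assoc[symmetric])

lemma ps_ideal_psum:
  assumes "k \<in> {1..m - 2}"
  shows "psum {..<m} x k \<in> ps_ideal m x"
proof (rule ps_idealI)
  show "psum {..<m} x k = (\<Sum>j\<in>{1..m - 2}. (if j = k then 1 else 0) * psum {..<m} x j)"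
    using assms by (simp add: if_distrib[where f = "\<lambda>c. c * _"] cong: if_cong)
qed

lemma ps_ideal_cone: "x \<in> ps_cone m \<Longrightarrow> ps_ideal m x = {0}"
  using ps_ideal_zero by (auto simp: ps_ideal_def ps_cone_def)

lemma ps_null_cone: "h \<in> ps_null m \<Longrightarrow> x \<in> ps_cone m \<Longrightarrow> h x = 0"
  using ps_ideal_cone by (fastforce simp: ps_null_def)

lemma ps_cone_permutes: "x \<in> ps_cone m \<Longrightarrow> \<sigma> permutes {..<m} \<Longrightarrow> x \<circ> \<sigma> \<in> ps_cone m"
  by (simp add: ps_cone_def psum_permutes)

lemma ps_null_zero: "0 \<in> ps_null m"
  by (simp add: ps_null_def ps_ideal_zero)

lemma ps_null_add: "g \<in> ps_null m \<Longrightarrow> h \<in> ps_null m \<Longrightarrow> g + h \<in> ps_null m"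
  by (simp add: ps_null_def ps_ideal_add)

lemma ps_null_mult: "h \<in> ps_null m \<Longrightarrow> g * h \<in> ps_null m"
  by (simp add: ps_null_def ps_ideal_mult)

lemma ps_null_uminus: "h \<in> ps_null m \<Longrightarrow> - h \<in> ps_null m"
  using ps_null_mult[of h m "- 1"] by simp

lemma ps_null_sum: "(\<And>i. i \<in> I \<Longrightarrow> h i \<in> ps_null m) \<Longrightarrow> (\<Sum>i\<in>I. h i) \<in> ps_null m"
  by (induction I rule: infinite_finite_induct) (auto simp: ps_null_zero ps_null_add)

lemma ps_null_psum:
  assumes k: "k \<in> {1..m - 2}"
  shows "psum {..<m} coord k \<in> (ps_null m :: ('a::field pt \<Rightarrow> 'a fps) set)"
proof -
  have eq: "psum {..<m} coord k x = psum {..<m} x k" for x :: "'a pt"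
    by (simp add: psum_def sum_fun_apply power_fun_apply coord_def)
  show ?thesis
    unfolding ps_null_def by (rule CollectI, rule allI, subst eq, rule ps_ideal_psum[OF k])
qed

lemma subring_setI:
  assumes "0 \<in> S" "1 \<in> S" "\<And>x. x \<in> S \<Longrightarrow> - x \<in> S"
    "\<And>x y. x \<in> S \<Longrightarrow> y \<in> S \<Longrightarrow> x + y \<in> S" "\<And>x y. x \<in> S \<Longrightarrow> y \<in> S \<Longrightarrow> x * y \<in> S"
  shows "subring_set S"
  using assms by (simp add: subring_set_def)

lemma subring_const_funs: "subring_set (const_funs :: ('a::field pt \<Rightarrow> 'a fps) set)"
proof (rule subring_setI)
  show "0 \<in> (const_funs :: ('a pt \<Rightarrow> 'a fps) set)" "1 \<in> (const_funs :: ('a pt \<Rightarrow> 'a fps) set)"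
    unfolding const_funs_def
    by (rule range_eqI[of _ _ 0] range_eqI[of _ _ 1]; simp add: fun_eq_iff)+
next
  fix f g :: "'a pt \<Rightarrow> 'a fps" assume "f \<in> const_funs" "g \<in> const_funs"
  then obtain c d where *: "f = (\<lambda>x. fps_const c)" "g = (\<lambda>x. fps_const d)"
    by (auto simp: const_funs_def)
  show "f + g \<in> const_funs"
    unfolding const_funs_def * by (rule range_eqI[of _ _ "c + d"]) (simp add: fun_eq_iff)
  show "f * g \<in> const_funs"
    unfolding const_funs_def * by (rule range_eqI[of _ _ "c * d"]) (simp add: fun_eq_iff)
next
  fix f :: "'a pt \<Rightarrow> 'a fps" assume "f \<in> const_funs"
  then obtain c where *: "f = (\<lambda>x. fps_const c)"
    by (auto simp: const_funs_def)
  show "- f \<in> const_funs"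
    unfolding const_funs_def * by (rule range_eqI[of _ _ "- c"]) (simp add: fun_eq_iff)
qed

lemma subring_base_ring: "subring_set (base_ring m)"
  unfolding base_ring_def by (intro subring_adjoin subring_const_funs)

lemma tower_0I: "g \<in> base_ring m \<Longrightarrow> h \<in> ps_null m \<Longrightarrow> f = g + h \<Longrightarrow> f \<in> tower m 0"
  by auto

lemma tower_0E:
  assumes "f \<in> tower m 0"
  obtains g h where "g \<in> base_ring m" "h \<in> ps_null m" "f = g + h"
  using assms by auto

declare tower.simps(1) [simp del]

lemma subring_tower: "subring_set (tower m i)"
proof (induction i)
  case 0
  note S = subring_setD[OF subring_base_ring[of m]]
  show ?case
  proof (rule subring_setI)
    show "0 \<in> tower m 0" by (rule tower_0I[OF S(1) ps_null_zero]) simp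
    show "1 \<in> tower m 0" by (rule tower_0I[OF S(2) ps_null_zero]) simp
  next
    fix f :: "'a pt \<Rightarrow> 'a fps" assume "f \<in> tower m 0"
    then obtain g h where *: "g \<in> base_ring m" "h \<in> ps_null m" "f = g + h"
      by (rule tower_0E)
    show "- f \<in> tower m 0"
      by (rule tower_0I[OF S(3)[OF *(1)] ps_null_uminus[OF *(2)]]) (simp add: *)
  next
    fix f f' :: "'a pt \<Rightarrow> 'a fps" assume "f \<in> tower m 0" "f' \<in> tower m 0"
    then obtain g h g' h' where *: "g \<in> base_ring m" "h \<in> ps_null m" "f = g + h"
      and **: "g' \<in> base_ring m" "h' \<in> ps_null m" "f' = g' + h'"
      by (elim tower_0E)
    show "f + f' \<in> tower m 0"
      by (rule tower_0I[OF S(4)[OF *(1) **(1)] ps_null_add[OF *(2) **(2)]])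
        (simp add: * ** algebra_simps)
    have "g * h' + (f' * h) \<in> ps_null m"
      using * ** by (intro ps_null_add ps_null_mult)
    then show "f * f' \<in> tower m 0"
      by (rule tower_0I[OF S(5)[OF *(1) **(1)]]) (simp add: * ** algebra_simps)
  qed
next
  case (Suc i)
  then show ?case by (simp add: subring_adjoin)
qed

lemma tower_mono: "i \<le> j \<Longrightarrow> tower m i \<subseteq> tower m j"
proof (induction j rule: dec_induct)
  case (step n)
  then show ?case
    using subset_adjoin[OF subring_tower, of m n "coord n"] by auto
qed simp

lemma base_subset_tower: "base_ring m \<subseteq> tower m i"
  using tower_mono[of 0 i m] tower_0I[OF _ ps_null_zero] by fastforce

lemma null_subset_tower: "ps_null m \<subseteq> tower m i"
  using tower_mono[of 0 i m] tower_0I[OF subring_setD(1)[OF subring_base_ring]] by fastforce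

lemma const_in_base: "(\<lambda>x. fps_const c) \<in> base_ring m"
  using subset_adjoin[OF subring_const_funs] subset_adjoin[OF subring_adjoin[OF subring_const_funs]]
  unfolding base_ring_def const_funs_def by blast

lemma const_in_tower: "(\<lambda>x. fps_const c) \<in> tower m i"
  using const_in_base base_subset_tower by blast

lemma ecoeff_in_base: "ecoeff m 0 \<in> base_ring m" "ecoeff m 1 \<in> base_ring m"
  unfolding base_ring_def
  using in_adjoin[OF subring_const_funs] subset_adjoin[OF subring_adjoin[OF subring_const_funs]]
    in_adjoin[OF subring_adjoin[OF subring_const_funs]] by blast+

lemma ecoeff_in_tower: "ecoeff m 0 \<in> tower m i" "ecoeff m 1 \<in> tower m i"
  using ecoeff_in_base by (blast intro: subsetD[OF base_subset_tower])+

lemma coord_in_tower: "i < j \<Longrightarrow> coord i \<in> tower m j"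
  using in_adjoin[OF subring_tower, of "coord i" m i] tower_mono[of "Suc i" j m] by auto

lemma adjoin_invariant:
  fixes S :: "('x \<Rightarrow> 'b::comm_ring_1) set"
  assumes "\<And>s. s \<in> S \<Longrightarrow> s u = s v" "y u = y v" "r \<in> adjoin S y"
  shows "r u = r v"
proof -
  obtain p where p: "p \<in> poly_over S" "r = poly p y"
    using assms by (auto simp: adjoin_def)
  have "poly p y u = poly p y v"
    using p(1) by (induction p) (auto simp: pCons_poly_over assms)
  then show ?thesis using p by simp
qed

section \<open>Adjoining the roots one by one, interpolation and norms\<close>

text \<open>The parameter \<open>ty\<close> only carries the field. The second assumption says that
  the characteristic is 0 or exceeds m.\<close>

locale power_sums =
  fixes m :: nat and ty :: "'a::alg_closed_field itself"
  assumes m_ge: "m \<ge> 5"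
    and of_nat_nonzero: "\<And>l. 0 < l \<Longrightarrow> l \<le> m \<Longrightarrow> (of_nat l :: 'a) \<noteq> 0"
begin

abbreviation X :: "nat \<Rightarrow> 'a pt \<Rightarrow> 'a fps" where
  "X \<equiv> coord"

text \<open>Newton's identity for l = m - k involves only power sums of exponents up to m - 2, and l
  is invertible in K.\<close>

lemma ecoeff_null:
  assumes "2 \<le> k" "k < m"
  shows "ecoeff m k \<in> (ps_null m :: ('a pt \<Rightarrow> 'a fps) set)"
proof -
  define l where "l = m - k"
  have l: "0 < l" "l \<le> m - 2" "k = m - l" "l \<le> m"
    using assms by (auto simp: l_def)
  let ?c = "coeff (root_poly {..<m} X)"
  have "of_nat l * ?c k = - (\<Sum>r\<in>{1..l}. ?c (m - l + r) * psum {..<m} coord r)"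
    using newton_identity[of "{..<m}" l X] l by simp
  also have "\<dots> \<in> ps_null m"
    using l by (intro ps_null_uminus ps_null_sum ps_null_mult ps_null_psum) auto
  finally have "(\<lambda>x. fps_const (inverse (of_nat l))) * (of_nat l * ?c k) \<in> ps_null m"
    by (rule ps_null_mult)
  also have "(\<lambda>x. fps_const (inverse (of_nat l))) * (of_nat l * ?c k) = ?c k"
    using of_nat_nonzero[of l] l
    by (auto simp: fun_eq_iff of_nat_fun_apply fps_of_nat[symmetric] mult.assoc[symmetric])
  finally show ?thesis
    by (simp add: coeff_root_poly_coord)
qed

lemma root_poly_coord_over_tower:
  "i \<le> m \<Longrightarrow> root_poly {i..<m} X \<in> poly_over (tower m i)"
proof (induction i)
  case 0
  have "coeff (root_poly {..<m} X) k \<in> tower m 0" for k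
  proof -
    consider "k = 0" | "k = 1" | "2 \<le> k" "k < m" | "k = m" | "k > m"
      by linarith
    then show ?thesis
    proof cases
      case 3
      then show ?thesis
        using ecoeff_null null_subset_tower[of m 0] by (auto simp: coeff_root_poly_coord)
    next
      case 4
      then show ?thesis
        using coeff_root_poly_card[of "{..<m}" X]
          subring_setD(2)[OF subring_tower] by (simp)
    next
      case 5
      then show ?thesis
        using degree_root_poly[of "{..<m}" X]
          subring_setD(1)[OF subring_tower[of m 0]] by (simp add: coeff_eq_0)
    qed (simp_all only: coeff_root_poly_coord ecoeff_in_tower)
  qed
  then show ?case
    by (simp add: poly_over_def atLeast0LessThan)
next
  case (Suc i)
  have "{i..<m} - {i} = {Suc i..<m}" by auto
  then have "[:- coord i, 1:] * root_poly {Suc i..<m} coord = root_poly {i..<m} X"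
    using root_poly_remove[of "{i..<m}" i X] Suc.prems by simp
  then have "[:- coord i, 1:] * root_poly {Suc i..<m} X \<in> poly_over (tower m i)"
    using Suc by simp
  from cofactor_poly_over[OF subring_tower this] show ?case by simp
qed

text \<open>On the cone, a function of stage \<open>i\<close> depends only on the symmetric
  functions a and b and on the first \<open>i\<close> coordinates, since null functions vanish
  there.\<close>

lemma tower_invariant:
  fixes x :: "'a pt"
  assumes x: "x \<in> ps_cone m" and \<sigma>: "\<sigma> permutes {..<m}" and fixed: "\<And>j. j < i \<Longrightarrow> \<sigma> j = j"
    and r: "r \<in> tower m i"
  shows "r (x \<circ> \<sigma>) = r x"
  using fixed r
proof (induction i arbitrary: r)
  case 0
  then obtain g h where gh: "g \<in> base_ring m" "h \<in> ps_null m" "r = g + h"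
    by (elim tower_0E)
  have "g (x \<circ> \<sigma>) = g x"
  proof (rule adjoin_invariant[OF _ _ gh(1)[unfolded base_ring_def]])
    fix s :: "'a pt \<Rightarrow> 'a fps" assume "s \<in> adjoin const_funs (ecoeff m 0)"
    then show "s (x \<circ> \<sigma>) = s x"
      by (rule adjoin_invariant[rotated 2])
        (auto simp: const_funs_def ecoeff_def root_poly_permutes[OF \<sigma>])
  qed (simp add: ecoeff_def root_poly_permutes[OF \<sigma>])
  then show ?case
    using ps_null_cone[OF gh(2)] x ps_cone_permutes[OF x \<sigma>]
    unfolding gh(3) plus_fun_apply by simp
next
  case (Suc i)
  have "coord i (x \<circ> \<sigma>) = coord i x"
    using Suc.prems(1)[of i] by (simp add: coord_def)
  then show ?case
    using adjoin_invariant[of "tower m i" "x \<circ> \<sigma>" x "coord i" r] Suc by (simp del: comp_apply)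
qed

text \<open>The swap moves no index below \<open>i\<close>, so it leaves the values of the
  coefficients alone and only puts \<open>x l\<close> in place of \<open>x i\<close>.\<close>

lemma tower_swap:
  fixes x :: "'a pt"
  assumes x: "x \<in> ps_cone m" and q: "q \<in> poly_over (tower m i)" and l: "l \<in> {i..<m}"
  shows "poly q (coord i) (x \<circ> transpose i l) = poly (map_poly (\<lambda>g. g x) q) (x l)"
proof -
  have perm: "transpose i l permutes {..<m}"
    using l by (intro permutes_swap_id) auto
  have "map_poly (\<lambda>g. g (x \<circ> transpose i l)) q = map_poly (\<lambda>g. g x) q"
  proof (rule poly_eqI)
    fix n
    have "coeff q n (x \<circ> transpose i l) = coeff q n x"
      using q l by (intro tower_invariant[OF x perm, where i = i])
        (auto simp: poly_over_def transpose_apply_other)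
    then show "coeff (map_poly (\<lambda>g. g (x \<circ> transpose i l)) q) n = coeff (map_poly (\<lambda>g. g x) q) n"
      by (simp add: coeff_map_poly)
  qed
  then show ?thesis
    by (simp add: poly_fun_apply coord_def)
qed

text \<open>The last condition says that the image of \<open>Y\<close> in the plane of a and b is
  Zariski dense. Distinct coordinates and closure under swaps supply the nodes for
  interpolation.\<close>

definition generic :: "'a pt set \<Rightarrow> bool" where
  "generic Y \<longleftrightarrow> Y \<subseteq> ps_cone m \<and> (\<forall>x\<in>Y. inj_on x {..<m}) \<and>
     (\<forall>x\<in>Y. \<forall>i<m. \<forall>j<m. x \<circ> transpose i j \<in> Y) \<and>
     (\<forall>g\<in>base_ring m. (\<forall>x\<in>Y. g x = 0) \<longrightarrow> g = 0)"

text \<open>Lagrange interpolation in one coordinate after the other.\<close>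

lemma generic_vanishing:
  assumes Y: "generic Y" and "i \<le> m" "r \<in> tower m i" "\<And>x. x \<in> Y \<Longrightarrow> r x = 0"
  shows "r \<in> ps_null m"
  using assms(2-)
proof (induction i arbitrary: r)
  case 0
  then obtain g h where gh: "g \<in> base_ring m" "h \<in> ps_null m" "r = g + h"
    by (elim tower_0E)
  have "g x = 0" if "x \<in> Y" for x
    using 0(3)[OF that] gh ps_null_cone[OF gh(2), of x] that Y by (auto simp: generic_def)
  then have "g = 0"
    using Y gh(1) by (auto simp: generic_def)
  then show ?case using gh by simp
next
  case (Suc i)
  let ?f = "root_poly {i..<m} X"
  obtain p where p: "p \<in> poly_over (tower m i)" "r = poly p (coord i)"
    using Suc.prems(2) by (auto simp: adjoin_def)
  have f: "?f \<in> poly_over (tower m i)" "lead_coeff ?f = 1" "poly ?f (coord i) = 0"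
    using root_poly_coord_over_tower[of i] Suc.prems(1) 
      degree_root_poly[of "{i..<m}" X]
      coeff_root_poly_card[of "{i..<m}" X]
      poly_root_poly_root[of "{i..<m}" i X] by auto
  from poly_over_reduce[OF subring_tower f p(1)]
  obtain q where q: "q \<in> poly_over (tower m i)" "\<And>k. k \<ge> m - i \<Longrightarrow> coeff q k = 0"
      "poly q (coord i) = r"
    using degree_root_poly[of "{i..<m}" X] p(2) by auto
  \<comment> \<open>At a point of \<open>Y\<close> the polynomial \<open>q\<close> becomes one of
    degree below m - i that vanishes at the m - i distinct coordinates from \<open>i\<close> on,
    because swapping \<open>i\<close> with any of them stays in \<open>Y\<close>.\<close>
  have "coeff q k \<in> ps_null m" for k
  proof (rule Suc.IH)
    show "coeff q k \<in> tower m i"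
      using q(1) by (auto simp: poly_over_def)
  next
    fix x assume x: "x \<in> Y"
    define Q where "Q = map_poly (\<lambda>g. g x) q"
    have "poly Q (x l) = 0" if l: "l \<in> {i..<m}" for l
    proof -
      have "x \<circ> transpose i l \<in> Y"
        using Y x l unfolding generic_def by auto
      then have "0 = r (x \<circ> transpose i l)"
        using Suc.prems(3) by simp
      also have "\<dots> = poly Q (x l)"
        unfolding Q_def q(3)[symmetric] using Y x l
        by (intro tower_swap[OF _ q(1)]) (auto simp: generic_def)
      finally show ?thesis by simp
    qed
    then have roots: "x ` {i..<m} \<subseteq> {z. poly Q z = 0}" by auto
    have "inj_on x {i..<m}"
      using Y x by (auto simp: generic_def intro: inj_on_subset)
    then have card: "card (x ` {i..<m}) = m - i"
      by (simp add: card_image)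
    have "Q = 0"
    proof (rule ccontr)
      assume "Q \<noteq> 0"
      then have "m - i \<le> card {z. poly Q z = 0}"
        using card_mono[OF _ roots] poly_roots_finite card by metis
      also have "\<dots> \<le> degree Q"
        using \<open>Q \<noteq> 0\<close> by (rule card_poly_roots_bound)
      also have "\<dots> < m - i"
      proof -
        have "coeff Q n = 0" if "n \<ge> m - i" for n
          using q(2)[OF that] by (simp add: Q_def coeff_map_poly)
        then show ?thesis
          using \<open>Q \<noteq> 0\<close> leading_coeff_0_iff not_le by blast
      qed
      finally show False by simp
    qed
    then show "coeff q k x = 0"
      by (metis Q_def coeff_0 coeff_map_poly zero_fun_apply)
  qed (use Suc.prems in simp)
  moreover have "r = (\<Sum>k\<le>degree q. coeff q k * coord i ^ k)"
    using q(3) by (simp add: poly_altdef)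
  ultimately show ?case
    by (auto intro!: ps_null_sum simp: mult.commute[of _ "coord i ^ _"] intro: ps_null_mult)
qed

text \<open>The norm from one stage to the one below multiplies the conjugates, in which each
  remaining root takes the place of the root just adjoined. The list records which rearrangements
  occur, with multiplicity; since \<open>id\<close> is among them, a zero of \<open>r\<close> on the
  cone is a zero of the norm.\<close>

lemma tower_norm:
  fixes r :: "'a pt \<Rightarrow> 'a fps"
  assumes r: "r \<in> tower m m" and "i \<le> m"
  shows "\<exists>n\<in>tower m i. \<exists>L. id \<in> set L \<and> (\<forall>\<sigma>\<in>set L. \<sigma> permutes {..<m}) \<and>
    (\<forall>x\<in>ps_cone m. n x = (\<Prod>\<sigma>\<leftarrow>L. r (x \<circ> \<sigma>)))"
  using assms(2)
proof (induction i rule: inc_induct)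
  case base
  show ?case
    using r by (intro bexI[of _ r] exI[of _ "[id]"]) (auto simp: permutes_id[unfolded id_def])
next
  case (step i)
  then obtain n L where nL: "n \<in> tower m (Suc i)" "id \<in> set L"
      "\<And>\<sigma>. \<sigma> \<in> set L \<Longrightarrow> \<sigma> permutes {..<m}"
      "\<And>x. x \<in> ps_cone m \<Longrightarrow> n x = (\<Prod>\<sigma>\<leftarrow>L. r (x \<circ> \<sigma>))"
    by blast
  obtain q where q: "q \<in> poly_over (tower m i)" "n = poly q (coord i)"
    using nL(1) by (auto simp: adjoin_def)
  define N where "N = (\<Prod>l\<in>{i..<m}. poly q (coord l))"
  have inv: "\<exists>u\<in>(tower m i :: ('a pt \<Rightarrow> 'a fps) set). of_nat l * u = 1" if "0 < l" "l \<le> card {i..<m}" for l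
    using that(1) of_nat_nonzero[of l] le_trans[OF that(2), of m]
    by (intro bexI[OF _ const_in_tower[of "inverse (of_nat l) :: 'a"]])
      (auto simp: fun_eq_iff of_nat_fun_apply fps_of_nat[symmetric])
  have "N \<in> tower m i"
    unfolding N_def
    by (rule norm_in_subring[OF subring_tower _ root_poly_coord_over_tower q(1) inv])
      (use step.hyps in auto)
  moreover define L' where "L' = concat (map (\<lambda>l. map (\<lambda>\<sigma>. transpose i l \<circ> \<sigma>) L) [i..<m])"
  have "id \<in> set L'"
    using step.hyps nL(2) by (auto simp: L'_def intro!: bexI[of _ i] image_eqI[of _ _ id])
  moreover have "\<sigma> permutes {..<m}" if "\<sigma> \<in> set L'" for \<sigma>
    using that nL(3) step.hyps
    by (auto simp: L'_def intro!: permutes_compose permutes_swap_id)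
  moreover have "N x = (\<Prod>\<sigma>\<leftarrow>L'. r (x \<circ> \<sigma>))" if x: "x \<in> ps_cone m" for x
  proof -
    have "poly q (coord l) x = (\<Prod>\<sigma>\<leftarrow>L. r (x \<circ> (transpose i l \<circ> \<sigma>)))" if l: "l \<in> {i..<m}" for l
    proof -
      have perm: "transpose i l permutes {..<m}"
        using l by (intro permutes_swap_id) auto
      have "poly q (coord l) x = n (x \<circ> transpose i l)"
        unfolding q(2) tower_swap[OF x q(1) l] by (simp add: poly_fun_apply coord_def)
      also have "\<dots> = (\<Prod>\<sigma>\<leftarrow>L. r (x \<circ> transpose i l \<circ> \<sigma>))"
        using nL(4) ps_cone_permutes[OF x perm] by simp
      finally show ?thesis by (simp add: o_assoc)
    qed
    then have "N x = (\<Prod>l\<in>{i..<m}. \<Prod>\<sigma>\<leftarrow>L. r (x \<circ> (transpose i l \<circ> \<sigma>)))"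
      by (simp add: N_def prod_fun_apply)
    also have "\<dots> = (\<Prod>l\<leftarrow>[i..<m]. \<Prod>\<sigma>\<leftarrow>L. r (x \<circ> (transpose i l \<circ> \<sigma>)))"
      by (subst prod.distinct_set_conv_list[symmetric]) auto
    also have "\<dots> = (\<Prod>\<sigma>\<leftarrow>L'. r (x \<circ> \<sigma>))"
    proof -
      have "(\<Prod>l\<leftarrow>ls. \<Prod>\<sigma>\<leftarrow>L. r (x \<circ> (transpose i l \<circ> \<sigma>)))
        = (\<Prod>\<sigma>\<leftarrow>concat (map (\<lambda>l. map (\<lambda>\<sigma>. transpose i l \<circ> \<sigma>) L) ls). r (x \<circ> \<sigma>))" for ls
        by (induction ls) (auto simp: o_def)
      then show ?thesis by (simp add: L'_def)
    qed
    finally show ?thesis .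
  qed
  ultimately show ?case by blast
qed

end

section \<open>Polynomial relations between the coefficients a and b\<close>

definition fps_eval :: "'a::field poly \<Rightarrow> 'a fps \<Rightarrow> 'a fps" where
  "fps_eval h z = poly (map_poly fps_const h) z"

lemma fps_eval_0 [simp]: "fps_eval 0 z = 0"
  by (simp add: fps_eval_def)

lemma fps_eval_pCons: "fps_eval (pCons c h) z = fps_const c + z * fps_eval h z"
  by (simp add: fps_eval_def map_poly_pCons)

lemma fps_eval_smult: "fps_eval (smult c h) z = fps_const c * fps_eval h z"
  by (induction h) (simp_all add: fps_eval_pCons algebra_simps flip: fps_const_mult)

lemma fps_eval_add: "fps_eval (g + h) z = fps_eval g z + fps_eval h z"
proof (induction g arbitrary: h)
  case (pCons a g)
  show ?case
  proof (cases h)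
    case (pCons b k)
    have "fps_eval (pCons a g + h) z = fps_const (a + b) + z * fps_eval (g + k) z"
      by (simp add: pCons fps_eval_pCons)
    also have "\<dots> = fps_eval (pCons a g) z + fps_eval h z"
      unfolding pCons.IH by (simp add: pCons fps_eval_pCons algebra_simps flip: fps_const_add)
    finally show ?thesis .
  qed
qed simp

lemma fps_eval_sum: "fps_eval (\<Sum>i\<in>I. h i) z = (\<Sum>i\<in>I. fps_eval (h i) z)"
  by (induction I rule: infinite_finite_induct) (auto simp: fps_eval_add)

lemma fps_eval_const: "fps_eval h (fps_const c) = fps_const (poly h c)"
  by (induction h) (simp_all add: fps_eval_pCons)

lemma fps_eval_monom: "fps_eval (monom c n) z = fps_const c * z ^ n"
  by (induction n) (simp_all add: fps_eval_pCons monom_Suc monom_0 mult_ac)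

lemma fps_eval_linear_factor: "fps_eval ([:- c, 1:] * h) z = (z - fps_const c) * fps_eval h z"
proof -
  have "[:- c, 1:] * h = smult (- c) h + pCons 0 h" by simp
  then show ?thesis
    by (simp only: fps_eval_add fps_eval_smult fps_eval_pCons)
      (simp add: algebra_simps flip: fps_const_neg)
qed

lemma fps_const_mult_nonconst:
  fixes c :: "'a::field"
  assumes "c \<noteq> 0" "z \<notin> range fps_const"
  shows "fps_const c * z \<notin> range fps_const"
proof
  assume "fps_const c * z \<in> range fps_const"
  then obtain d where "fps_const c * z = fps_const d" by auto
  then have "fps_const (inverse c) * (fps_const c * z) = fps_const (inverse c * d)"
    by simp
  then have "z = fps_const (inverse c * d)"
    using assms(1) by (simp add: mult.assoc[symmetric])
  then show False using assms(2) by blast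
qed

lemma fps_X_nonconst: "fps_X \<notin> range (fps_const :: 'a::field \<Rightarrow> 'a fps)"
proof
  assume "fps_X \<in> range (fps_const :: 'a \<Rightarrow> 'a fps)"
  then obtain c :: 'a where "fps_X = fps_const c" by auto
  then have "fps_X $ 1 = fps_const c $ 1" by simp
  then show False by simp
qed

lemma fps_const_in: "c \<noteq> 0 \<Longrightarrow> fps_const c \<in> fps_const ` (- {0 :: 'a::field})"
  by simp

text \<open>A nonconstant power series is transcendental over K: over an algebraically closed field
  a relation would split into factors \<open>z - fps_const c\<close>, none of which is 0.\<close>

lemma fps_eval_nonconst:
  fixes h :: "'a::alg_closed_field poly"
  assumes z: "z \<notin> range fps_const" and "fps_eval h z = 0"
  shows "h = 0"
  using assms(2)
proof (induction "degree h" arbitrary: h rule: less_induct)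
  case less
  show ?case
  proof (cases "degree h > 0")
    case False
    then obtain c where "h = [:c:]"
      by (metis degree_eq_zeroE gr0I)
    then show ?thesis
      using less.prems by (simp add: fps_eval_pCons)
  next
    case True
    then obtain c where "poly h c = 0"
      using alg_closed_imp_poly_has_root by blast
    then obtain g where g: "h = [:- c, 1:] * g"
      by (metis poly_eq_0_iff_dvd dvdE)
    have "z - fps_const c \<noteq> 0"
      using z by auto
    then have "fps_eval g z = 0"
      using less.prems unfolding g fps_eval_linear_factor by simp
    moreover have "degree g < degree h"
      using True unfolding g by (cases "g = 0") (auto simp: degree_mult_eq simp del: mult_pCons_left)
    ultimately show ?thesis
      using less.hyps g by force
  qed
qed

lemma adjoin_const_funsE:
  assumes "s \<in> adjoin const_funs y"
  obtains h where "\<And>x. s x = fps_eval h (y x)"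
proof -
  obtain p where p: "p \<in> poly_over const_funs" "s = poly p y"
    using assms by (auto simp: adjoin_def)
  have "\<exists>h. \<forall>x. poly p y x = fps_eval h (y x)"
    using p(1)
  proof (induction p)
    case 0
    then show ?case by (intro exI[of _ 0]) auto
  next
    case (pCons a p)
    then obtain h c where "\<forall>x. poly p y x = fps_eval h (y x)" "a = (\<lambda>x. fps_const c)"
      by (auto simp: pCons_poly_over const_funs_def)
    then show ?case
      by (intro exI[of _ "pCons c h"]) (simp add: fps_eval_pCons)
  qed
  then show ?thesis
    using that p(2) by blast
qed

lemma base_ringE:
  assumes "g \<in> base_ring m"
  obtains h d where "\<And>x. g x = (\<Sum>i\<le>d. fps_eval (h i) (ecoeff m 0 x) * ecoeff m 1 x ^ i)"
proof -
  obtain p where p: "p \<in> poly_over (adjoin const_funs (ecoeff m 0))" "g = poly p (ecoeff m 1)"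
    using assms[unfolded base_ring_def adjoin_def[of _ "ecoeff m 1"]] by blast
  have "\<exists>h. \<forall>x. coeff p i x = fps_eval h (ecoeff m 0 x)" for i
  proof -
    have "coeff p i \<in> adjoin const_funs (ecoeff m 0)"
      using p(1) by (auto simp: poly_over_def)
    then show ?thesis by (elim adjoin_const_funsE) blast
  qed
  then obtain h where h: "\<And>i x. coeff p i x = fps_eval (h i) (ecoeff m 0 x)"
    by metis
  have "g x = (\<Sum>i\<le>degree p. fps_eval (h i) (ecoeff m 0 x) * ecoeff m 1 x ^ i)" for x
    by (simp add: p(2) poly_altdef sum_fun_apply power_fun_apply h)
  then show ?thesis by (rule that)
qed

lemma coeff_sum_monom: "coeff (\<Sum>i\<le>d. monom (c i) i) n = (if n \<le> d then c n else 0)"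
  by (simp add: coeff_sum)

text \<open>Fix a = \<alpha>: the resulting polynomial in b has to be zero. Each of its coefficients
  is a polynomial in \<alpha> with infinitely many zeros, so it vanishes too.\<close>

lemma base_ring_vanishing_0:
  fixes g :: "'a::alg_closed_field pt \<Rightarrow> 'a fps"
  assumes g: "g \<in> base_ring m" "\<And>x. x \<in> X \<Longrightarrow> g x = 0" and S: "infinite S"
    and X: "\<And>\<alpha> h. \<alpha> \<in> S \<Longrightarrow>
      (\<And>x. x \<in> X \<Longrightarrow> ecoeff m 1 x = fps_const \<alpha> \<Longrightarrow> fps_eval h (ecoeff m 0 x) = 0) \<Longrightarrow> h = 0"
  shows "g = 0"
proof -
  obtain h d where h: "\<And>x. g x = (\<Sum>i\<le>d. fps_eval (h i) (ecoeff m 0 x) * ecoeff m 1 x ^ i)"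
    using base_ringE[OF g(1)] by blast
  have q: "(\<Sum>i\<le>d. smult (\<alpha> ^ i) (h i)) = 0" if "\<alpha> \<in> S" for \<alpha>
  proof (rule X[OF that])
    fix x assume "x \<in> X" "ecoeff m 1 x = fps_const \<alpha>"
    then show "fps_eval (\<Sum>i\<le>d. smult (\<alpha> ^ i) (h i)) (ecoeff m 0 x) = 0"
      using g(2)[of x] by (simp add: h fps_eval_sum fps_eval_smult fps_const_power mult.commute)
  qed
  have "coeff (h i) j = 0" if "i \<le> d" for i j
  proof -
    define P where "P = (\<Sum>i\<le>d. monom (coeff (h i) j) i)"
    have "poly P \<alpha> = 0" if "\<alpha> \<in> S" for \<alpha>
      using arg_cong[OF q[OF that], of "\<lambda>p. coeff p j"]
      by (simp add: P_def poly_sum poly_monom coeff_sum mult.commute)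
    then have "S \<subseteq> {\<alpha>. poly P \<alpha> = 0}" by auto
    then have "P = 0"
      using S poly_roots_finite finite_subset by blast
    then show ?thesis
      using that coeff_sum_monom[of "\<lambda>i. coeff (h i) j" d i] by (simp add: P_def)
  qed
  then have "h i = 0" if "i \<le> d" for i
    using that by (auto intro: poly_eqI)
  then show ?thesis
    by (simp add: fun_eq_iff h)
qed

text \<open>Same argument with the slices b = \<beta>, for points whose b is constant.\<close>

lemma base_ring_vanishing_1:
  fixes g :: "'a::alg_closed_field pt \<Rightarrow> 'a fps"
  assumes g: "g \<in> base_ring m" "\<And>x. x \<in> X \<Longrightarrow> g x = 0" and S: "infinite S"
    and X: "\<And>\<beta> h. \<beta> \<in> S \<Longrightarrow>
      (\<And>x. x \<in> X \<Longrightarrow> ecoeff m 0 x = fps_const \<beta> \<Longrightarrow> fps_eval h (ecoeff m 1 x) = 0) \<Longrightarrow> h = 0"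
  shows "g = 0"
proof -
  obtain h d where h: "\<And>x. g x = (\<Sum>i\<le>d. fps_eval (h i) (ecoeff m 0 x) * ecoeff m 1 x ^ i)"
    using base_ringE[OF g(1)] by blast
  have q: "(\<Sum>i\<le>d. monom (poly (h i) \<beta>) i) = 0" if "\<beta> \<in> S" for \<beta>
  proof (rule X[OF that])
    fix x assume "x \<in> X" "ecoeff m 0 x = fps_const \<beta>"
    then show "fps_eval (\<Sum>i\<le>d. monom (poly (h i) \<beta>) i) (ecoeff m 1 x) = 0"
      using g(2)[of x] by (simp add: h fps_eval_sum fps_eval_monom fps_eval_const)
  qed
  have "h i = 0" if "i \<le> d" for i
  proof -
    have "poly (h i) \<beta> = 0" if "\<beta> \<in> S" for \<beta>
      using arg_cong[OF q[OF that], of "\<lambda>p. coeff p i"] \<open>i \<le> d\<close> by (simp add: coeff_sum_monom)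
    then have "S \<subseteq> {\<beta>. poly (h i) \<beta> = 0}" by auto
    then show ?thesis
      using S poly_roots_finite finite_subset by blast
  qed
  then show ?thesis
    by (simp add: fun_eq_iff h)
qed

text \<open>Over a finite field the product of all X - x, increased by 1, is nonconstant and takes
  only the value 1.\<close>

lemma infinite_UNIV_alg_closed: "infinite (UNIV :: 'a::alg_closed_field set)"
proof
  assume fin: "finite (UNIV :: 'a set)"
  define p where "p = root_poly (UNIV :: 'a set) (\<lambda>x. x) + 1"
  have "coeff p (card (UNIV :: 'a set)) = 1"
    using coeff_root_poly_card[OF fin] fin by (simp add: p_def coeff_eq_0 finite_UNIV_card_ge_0)
  then have "card (UNIV :: 'a set) \<le> degree p"
    by (intro le_degree) simp
  then have "degree p > 0"
    using fin finite_UNIV_card_ge_0 by force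
  then obtain x where "poly p x = 0"
    using alg_closed_imp_poly_has_root by blast
  moreover have "poly p x = 1"
    using poly_root_poly_root[OF fin, of x "\<lambda>x. x"] by (simp add: p_def)
  ultimately show False by simp
qed

subsection \<open>Points with given elementary symmetric functions\<close>

definition trinomial :: "nat \<Rightarrow> 'b::comm_ring_1 \<Rightarrow> 'b \<Rightarrow> 'b poly" where
  "trinomial m a b = monom 1 m + [:b, a:]"

lemma poly_trinomial: "poly (trinomial m a b) z = z ^ m + a * z + b"
  by (simp add: trinomial_def poly_monom algebra_simps)

lemma coeff_trinomial:
  "m \<ge> 2 \<Longrightarrow> coeff (trinomial m a b) k = (if k = m then 1 else if k = 0 then b else if k = 1 then a else 0)"
  by (auto simp: trinomial_def coeff_pCons split: nat.split)

lemma degree_trinomial: "m \<ge> 2 \<Longrightarrow> degree (trinomial m a b) = m"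
  by (rule antisym) (auto intro!: degree_le le_degree simp: coeff_trinomial)

lemma exists_root_poly:
  fixes p :: "'a::alg_closed_field poly"
  assumes "lead_coeff p = 1"
  shows "\<exists>v. p = root_poly {..<degree p} v"
proof -
  have "p \<noteq> 0" using assms by auto
  then obtain A where A: "size A = degree p" "p = smult (lead_coeff p) (\<Prod>x\<in>#A. [:- x, 1:])"
    using alg_closed_imp_factorization[OF \<open>p \<noteq> 0\<close>] by blast
  obtain xs where xs: "mset xs = A" using ex_mset by blast
  have "p = (\<Prod>x\<in>#A. [:- x, 1:])"
    using A(2) unfolding assms by simp
  also have "\<dots> = (\<Prod>x\<leftarrow>xs. [:- x, 1:])"
    unfolding xs[symmetric] by (simp flip: mset_map add: prod_mset_prod_list)
  also have "\<dots> = (\<Prod>i<length xs. [:- (xs ! i), 1:])"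
    by (simp add: prod.list_conv_set_nth atLeast0LessThan)
  finally show ?thesis
    using A xs by (intro exI[of _ "(!) xs"]) (auto simp: root_poly_def)
qed

lemma root_poly_eq_of_roots:
  fixes x :: "nat \<Rightarrow> 'b::idom"
  assumes "degree p = m" "lead_coeff p = 1" "inj_on x {..<m}" "\<And>i. i < m \<Longrightarrow> poly p (x i) = 0"
  shows "root_poly {..<m} x = p"
proof (rule ccontr)
  assume ne: "root_poly {..<m} x \<noteq> p"
  let ?d = "root_poly {..<m} x - p"
  have "coeff ?d k = 0" if "k \<ge> m" for k
    using that assms coeff_root_poly_card[of "{..<m}" x] degree_root_poly[of "{..<m}" x]
    by (cases "k = m") (auto simp: coeff_eq_0)
  moreover have "lead_coeff ?d \<noteq> 0"
    using ne leading_coeff_0_iff[of ?d] by simp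
  ultimately have deg: "degree ?d < m"
    by (meson not_le)
  have "x ` {..<m} \<subseteq> {z. poly ?d z = 0}"
    using assms(4) by (auto simp: poly_root_poly_root)
  then have "card (x ` {..<m}) \<le> card {z. poly ?d z = 0}"
    using ne by (intro card_mono poly_roots_finite) auto
  also have "\<dots> \<le> degree ?d"
    using ne by (intro card_poly_roots_bound) auto
  finally show False
    using deg by (simp add: card_image[OF assms(3)])
qed

lemma root_poly_const:
  "root_poly I (\<lambda>i. fps_const (v i)) = map_poly fps_const (root_poly I v)"
proof (rule poly_eqI)
  fix k
  show "coeff (root_poly I (\<lambda>i. fps_const (v i))) k = coeff (map_poly fps_const (root_poly I v)) k"
  proof (induction I arbitrary: k rule: infinite_finite_induct)
    case (insert a I)
    then show ?case
      by (auto simp: root_poly_def coeff_pCons coeff_map_poly split: nat.split)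
  qed (auto simp: root_poly_def coeff_pCons coeff_map_poly split: nat.split)
qed

text \<open>Coefficient \<open>k\<close> has degree \<open>card I - k\<close> in the roots. The
  factor c^k on the left avoids both division by \<open>c\<close> and a subtraction in the
  exponent.\<close>

lemma coeff_root_poly_scale:
  fixes c :: "'b::comm_ring_1"
  assumes "finite I"
  shows "c ^ k * coeff (root_poly I (\<lambda>i. c * x i)) k = c ^ card I * coeff (root_poly I x) k"
  using assms
proof (induction I arbitrary: k)
  case (insert a I)
  show ?case
  proof (cases k)
    case 0
    have *: "coeff (root_poly (insert a I) y) 0 = - y a * coeff (root_poly I y) 0" for y :: "_ \<Rightarrow> 'b"
      using insert by (simp add: root_poly_def)
    have "coeff (root_poly I (\<lambda>i. c * x i)) 0 = c ^ card I * coeff (root_poly I x) 0"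
      using insert.IH[of 0] by simp
    then show ?thesis
      unfolding 0 * using insert by (simp add: mult_ac)
  next
    case (Suc l)
    have "c ^ k * coeff (root_poly (insert a I) (\<lambda>i. c * x i)) k
      = c * (c ^ l * coeff (root_poly I (\<lambda>i. c * x i)) l)
        - c * x a * (c ^ k * coeff (root_poly I (\<lambda>i. c * x i)) k)"
      using insert Suc by (simp add: root_poly_def algebra_simps)
    also have "\<dots> = c ^ card (insert a I) * coeff (root_poly (insert a I) x) k"
      unfolding insert.IH using insert Suc by (simp add: root_poly_def algebra_simps)
    finally show ?thesis .
  qed
qed (simp add: root_poly_def coeff_pCons split: nat.split)

lemma ecoeff_scale:
  "ecoeff m 0 (\<lambda>i. c * x i) = c ^ m * ecoeff m 0 x"
  "c * ecoeff m 1 (\<lambda>i. c * x i) = c ^ m * ecoeff m 1 x"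
  using coeff_root_poly_scale[of "{..<m}" c 0 x] coeff_root_poly_scale[of "{..<m}" c 1 x]
  by (simp_all add: ecoeff_def)

context power_sums
begin

lemma root_poly_cone:
  fixes x :: "'a pt"
  assumes "x \<in> ps_cone m"
  shows "root_poly {..<m} x = trinomial m (ecoeff m 1 x) (ecoeff m 0 x)"
proof (rule poly_eqI)
  fix k
  consider "k = 0" | "k = 1" | "2 \<le> k" "k < m" | "k = m" | "k > m"
    by linarith
  then show "coeff (root_poly {..<m} x) k = coeff (trinomial m (ecoeff m 1 x) (ecoeff m 0 x)) k"
  proof cases
    case 3
    then show ?thesis
      using ps_null_cone[OF ecoeff_null[OF 3] assms] m_ge by (simp add: coeff_trinomial ecoeff_def)
  next
    case 4
    then show ?thesis
      using coeff_root_poly_card[of "{..<m}" x] m_ge by (simp add: coeff_trinomial)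
  next
    case 5
    then show ?thesis
      using degree_root_poly[of "{..<m}" x] m_ge by (simp add: coeff_trinomial coeff_eq_0)
  qed (use m_ge in \<open>simp_all add: coeff_trinomial ecoeff_def\<close>)
qed

text \<open>In Newton's identity for \<open>k\<close> the coefficient of index m - k is 0 and the
  lower power sums vanish by induction, which leaves the k-th power sum with factor 1. Hence no
  integer has to be inverted.\<close>

lemma psum_trinomial:
  fixes x :: "nat \<Rightarrow> 'b::comm_ring_1"
  assumes f: "root_poly {..<m} x = trinomial m a b" and "k \<in> {1..m - 2}"
  shows "psum {..<m} x k = 0"
  using assms(2)
proof (induction k rule: less_induct)
  case (less k)
  have k: "1 \<le> k" "k \<le> m - 2" "m - k \<noteq> 0" "m - k \<noteq> 1" "m - k \<noteq> m" "m \<ge> 2" "k \<le> m"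
    using less.prems m_ge by auto
  have eq: "{1..k} = insert k {1..<k}" using k by auto
  have "0 = of_nat k * coeff (root_poly {..<m} x) (m - k)"
    using k by (simp add: f coeff_trinomial)
  also have "\<dots> = - (\<Sum>r\<in>{1..k}. coeff (root_poly {..<m} x) (m - k + r) * psum {..<m} x r)"
    using newton_identity[of "{..<m}" k x] k by simp
  also have "(\<Sum>r\<in>{1..k}. coeff (root_poly {..<m} x) (m - k + r) * psum {..<m} x r)
    = psum {..<m} x k"
  proof -
    have "(\<Sum>r\<in>{1..<k}. coeff (root_poly {..<m} x) (m - k + r) * psum {..<m} x r) = 0"
      using less k by (intro sum.neutral) auto
    then show ?thesis
      unfolding eq using k by (simp add: f coeff_trinomial)
  qed
  finally show ?case by simp
qed

lemma cone_trinomial: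
  fixes x :: "'a pt"
  assumes "root_poly {..<m} x = trinomial m a b"
  shows "x \<in> ps_cone m" "ecoeff m 0 x = b" "ecoeff m 1 x = a"
  using psum_trinomial[OF assms] m_ge
  by (auto simp: ps_cone_def ecoeff_def assms coeff_trinomial)

lemma cone_scale: "x \<in> ps_cone m \<Longrightarrow> (\<lambda>i. c * x i) \<in> ps_cone m"
  by (auto simp: ps_cone_def psum_def power_mult_distrib simp flip: sum_distrib_left)

definition const_pt :: "(nat \<Rightarrow> 'a) \<Rightarrow> 'a pt" where
  "const_pt v = (\<lambda>i. fps_const (v i))"

lemma const_pt_trinomial:
  assumes "root_poly {..<m} v = trinomial m a b"
  shows "root_poly {..<m} (const_pt v) = trinomial m (fps_const a) (fps_const b)"
  unfolding const_pt_def root_poly_const assms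
  using m_ge by (intro poly_eqI) (auto simp: coeff_map_poly coeff_trinomial)

lemma exists_trinomial_roots:
  obtains v :: "nat \<Rightarrow> 'a" where "root_poly {..<m} v = trinomial m a b"
  using exists_root_poly[of "trinomial m a b"] m_ge by (auto simp: degree_trinomial coeff_trinomial)

lemma trinomial_multiple_root:
  fixes x :: "nat \<Rightarrow> 'b::idom"
  assumes f: "root_poly {..<m} x = trinomial m a b" and ij: "i < m" "j < m" "i \<noteq> j" "x i = x j"
  shows "of_nat m * x i ^ (m - 1) + a = 0" "x i ^ m + a * x i + b = 0"
proof -
  define q where "q = root_poly ({..<m} - {i} - {j}) x"
  have q: "trinomial m a b = [:- x i, 1:] * ([:- x i, 1:] * q)"
    using ij root_poly_remove[of "{..<m}" i x] root_poly_remove[of "{..<m} - {i}" j x]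
    by (simp add: f[symmetric] q_def)
  have "poly (pderiv (trinomial m a b)) (x i) = 0"
    unfolding q by (simp add: pderiv_mult pderiv_pCons del: mult_pCons_left mult_pCons_right)
  then show "of_nat m * x i ^ (m - 1) + a = 0"
    by (simp add: trinomial_def pderiv_add pderiv_monom pderiv_pCons poly_monom)
  have "poly (trinomial m a b) (x i) = 0"
    unfolding q by simp
  then show "x i ^ m + a * x i + b = 0"
    by (simp add: poly_trinomial)
qed

lemma genericI:
  assumes "\<And>x. x \<in> Y \<Longrightarrow> x \<in> ps_cone m" "\<And>x. x \<in> Y \<Longrightarrow> inj_on x {..<m}"
    "\<And>x \<sigma>. x \<in> Y \<Longrightarrow> \<sigma> permutes {..<m} \<Longrightarrow> x \<circ> \<sigma> \<in> Y"
    "\<And>g. g \<in> base_ring m \<Longrightarrow> (\<And>x. x \<in> Y \<Longrightarrow> g x = 0) \<Longrightarrow> g = 0"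
  shows "generic Y"
  unfolding generic_def using assms by (auto intro!: assms(3) permutes_swap_id)

lemma inj_on_permutes:
  assumes "inj_on x {..<m}" "\<sigma> permutes {..<m}"
  shows "inj_on (x \<circ> \<sigma>) {..<m}"
  using assms comp_inj_on[of \<sigma> "{..<m}" x] permutes_inj_on[of \<sigma> "{..<m}"] permutes_image[of \<sigma> "{..<m}"]
  by simp

text \<open>Every pair (a, b) is attained over the algebraically closed K, and for fixed a only
  finitely many b give a multiple root.\<close>

lemma generic_const_pts:
  "generic {x \<in> ps_cone m. x \<in> range const_pt \<and> inj_on x {..<m}}" (is "generic ?X")
proof (rule genericI)
  fix x \<sigma> assume x: "x \<in> ?X" and \<sigma>: "\<sigma> permutes {..<m}"
  then obtain v where "x = const_pt v" by auto
  then have "x \<circ> \<sigma> = const_pt (v \<circ> \<sigma>)" by (auto simp: const_pt_def)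
  then show "x \<circ> \<sigma> \<in> ?X"
    using x \<sigma> ps_cone_permutes[of x m \<sigma>] inj_on_permutes[of x \<sigma>] by auto
next
  fix g :: "'a pt \<Rightarrow> 'a fps" assume g: "g \<in> base_ring m" "\<And>x. x \<in> ?X \<Longrightarrow> g x = 0"
  show "g = 0"
  proof (rule base_ring_vanishing_0[OF g])
    have "infinite (UNIV :: 'a set)" by (rule infinite_UNIV_alg_closed)
    then show "infinite (UNIV :: 'a set)" .
    fix \<alpha> :: 'a and h
    assume h: "\<And>x. x \<in> ?X \<Longrightarrow> ecoeff m 1 x = fps_const \<alpha> \<Longrightarrow> fps_eval h (ecoeff m 0 x) = 0"
    \<comment> \<open>The critical points of X^m + \<alpha>X + \<beta> are the same for all \<beta>,
      and each of them is a root for just one \<beta>.\<close>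
    define R where "R = {y. poly (monom (of_nat m) (m - 1) + [:\<alpha>:]) y = 0}"
    have "coeff (monom (of_nat m) (m - 1) + [:\<alpha>:]) (m - 1) \<noteq> (0::'a)"
      using of_nat_nonzero[of m] m_ge by (simp add: coeff_pCons split: nat.split)
    then have "monom (of_nat m) (m - 1) + [:\<alpha>:] \<noteq> 0" by (metis coeff_0)
    then have R: "finite R"
      unfolding R_def by (rule poly_roots_finite)
    have "poly h \<beta> = 0" if \<beta>: "\<beta> \<notin> (\<lambda>y. - (y ^ m + \<alpha> * y)) ` R" for \<beta>
    proof -
      obtain v where v: "root_poly {..<m} v = trinomial m \<alpha> \<beta>"
        by (rule exists_trinomial_roots)
      have "inj_on v {..<m}"
      proof (rule inj_onI, rule ccontr)
        fix i j assume ij: "i \<in> {..<m}" "j \<in> {..<m}" "v i = v j" "i \<noteq> j"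
        note * = trinomial_multiple_root[OF v _ _ ij(4,3)]
        have "v i \<in> R"
          using *(1) ij by (simp add: R_def poly_monom)
        moreover have "\<beta> = - (v i ^ m + \<alpha> * v i)"
          using *(2) ij by (simp only: add_eq_0_iff lessThan_iff)
        ultimately show False using \<beta> by blast
      qed
      then have "inj_on (const_pt v) {..<m}"
        by (auto simp: inj_on_def const_pt_def)
      then have "const_pt v \<in> ?X"
        using cone_trinomial[OF const_pt_trinomial[OF v]] by auto
      from h[OF this] show ?thesis
        using cone_trinomial[OF const_pt_trinomial[OF v]] by (simp add: fps_eval_const)
    qed
    then have "- ((\<lambda>y. - (y ^ m + \<alpha> * y)) ` R) \<subseteq> {\<beta>. poly h \<beta> = 0}" by auto
    moreover have "infinite (- ((\<lambda>y. - (y ^ m + \<alpha> * y)) ` R))"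
      using R \<open>infinite UNIV\<close> by (simp add: Compl_eq_Diff_UNIV)
    ultimately show "h = 0"
      using poly_roots_finite finite_subset by blast
  qed
qed auto

text \<open>A branch of the curve, with one of the two coefficients normalised to a constant.\<close>

definition arc :: "'a pt \<Rightarrow> 'a fps \<Rightarrow> 'a fps \<Rightarrow> bool" where
  "arc \<eta> a b \<longleftrightarrow> root_poly {..<m} \<eta> = trinomial m a b \<and> inj_on \<eta> {..<m} \<and>
     (a \<in> fps_const ` (- {0}) \<and> b \<notin> range fps_const \<or>
      b \<in> fps_const ` (- {0}) \<and> a \<notin> range fps_const)"

definition arc_orbit :: "'a pt \<Rightarrow> 'a pt set" where
  "arc_orbit \<eta> = {\<lambda>i. fps_const c * \<eta> (\<sigma> i) | c \<sigma>. c \<noteq> 0 \<and> \<sigma> permutes {..<m}}"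

text \<open>Scaling by c multiplies a by c^(m-1) and b by c^m. So the constant one of the two can be
  moved to any prescribed nonzero value, while the other stays nonconstant and thus transcendental
  over K.\<close>

lemma generic_arc_orbit:
  assumes "arc \<eta> a b"
  shows "generic (arc_orbit \<eta>)"
proof (rule genericI)
  note arc = assms[unfolded arc_def]
  note \<eta> = cone_trinomial[OF arc[THEN conjunct1]]
  show "x \<in> ps_cone m" if x: "x \<in> arc_orbit \<eta>" for x
  proof -
    obtain c \<sigma> where c: "\<sigma> permutes {..<m}" "x = (\<lambda>i. fps_const c * \<eta> (\<sigma> i))"
      using x unfolding arc_orbit_def by blast
    then show ?thesis
      using cone_scale[OF ps_cone_permutes[OF \<eta>(1) c(1)], of "fps_const c"] by (simp add: o_def)
  qed
  show "inj_on x {..<m}" if x: "x \<in> arc_orbit \<eta>" for x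
  proof -
    obtain c \<sigma> where c: "c \<noteq> 0" "\<sigma> permutes {..<m}" "x = (\<lambda>i. fps_const c * \<eta> (\<sigma> i))"
      using x unfolding arc_orbit_def by blast
    have inj: "inj_on (\<eta> \<circ> \<sigma>) {..<m}"
      by (rule inj_on_permutes[OF arc[THEN conjunct2, THEN conjunct1] c(2)])
    show ?thesis
    proof (rule inj_onI)
      fix i j assume ij: "i \<in> {..<m}" "j \<in> {..<m}" "x i = x j"
      then have "\<eta> (\<sigma> i) = \<eta> (\<sigma> j)"
        using c(1) by (simp add: c(3))
      then show "i = j"
        using inj_onD[OF inj, of i j] ij by simp
    qed
  qed
  show "x \<circ> \<sigma> \<in> arc_orbit \<eta>" if x: "x \<in> arc_orbit \<eta>" and \<sigma>: "\<sigma> permutes {..<m}" for x \<sigma>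
  proof -
    obtain c \<tau> where c: "c \<noteq> 0" "\<tau> permutes {..<m}" "x = (\<lambda>i. fps_const c * \<eta> (\<tau> i))"
      using x unfolding arc_orbit_def by blast
    have "x \<circ> \<sigma> = (\<lambda>i. fps_const c * \<eta> ((\<tau> \<circ> \<sigma>) i))"
      by (simp add: c(3) o_def)
    then show ?thesis
      using permutes_compose[OF \<sigma> c(2)] c(1) unfolding arc_orbit_def by blast
  qed
  have orb: "(\<lambda>i. fps_const c * \<eta> i) \<in> arc_orbit \<eta>" if "c \<noteq> 0" for c
  proof -
    have "(\<lambda>i. fps_const c * \<eta> i) = (\<lambda>i. fps_const c * \<eta> (id i))" by simp
    then show ?thesis
      using that permutes_id[of "{..<m}"] unfolding arc_orbit_def by blast
  qed
  have e0: "ecoeff m 0 (\<lambda>i. fps_const c * \<eta> i) = fps_const (c ^ m) * b" for c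
    using ecoeff_scale(1)[of m "fps_const c" \<eta>] \<eta> by (simp add: fps_const_power)
  have e1: "ecoeff m 1 (\<lambda>i. fps_const c * \<eta> i) = fps_const (c ^ (m - 1)) * a" if "c \<noteq> 0" for c
  proof -
    have "fps_const c * ecoeff m 1 (\<lambda>i. fps_const c * \<eta> i) = fps_const c * (fps_const (c ^ (m - 1)) * a)"
      using ecoeff_scale(2)[of "fps_const c" m \<eta>] \<eta> m_ge power_Suc[of c "m - 1"]
      by (simp add: fps_const_power mult.assoc[symmetric])
    then show ?thesis using that by simp
  qed
  fix g :: "'a pt \<Rightarrow> 'a fps" assume g: "g \<in> base_ring m" "\<And>x. x \<in> arc_orbit \<eta> \<Longrightarrow> g x = 0"
  have inf: "infinite (- {0 :: 'a})"
    using infinite_UNIV_alg_closed[where ?'a = 'a] by (simp add: Compl_eq_Diff_UNIV)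
  consider "a \<in> fps_const ` (- {0})" "b \<notin> range fps_const"
    | "b \<in> fps_const ` (- {0})" "a \<notin> range fps_const"
    using arc by blast
  then show "g = 0"
  proof cases
    case 1
    then obtain a0 where a0: "a = fps_const a0" "a0 \<noteq> 0" by auto
    show ?thesis
    proof (rule base_ring_vanishing_0[OF g inf])
      fix \<alpha> :: 'a and h
      assume \<alpha>: "\<alpha> \<in> - {0}" and h: "\<And>x. x \<in> arc_orbit \<eta> \<Longrightarrow> ecoeff m 1 x = fps_const \<alpha> \<Longrightarrow>
        fps_eval h (ecoeff m 0 x) = 0"
      obtain c where c: "c ^ (m - 1) = \<alpha> / a0"
        using nth_root_exists[of "m - 1" "\<alpha> / a0"] m_ge by auto
      then have "c \<noteq> 0" using \<alpha> a0 m_ge by (auto simp: power_0_left)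
      then have "fps_eval h (fps_const (c ^ m) * b) = 0"
        using h[OF orb[of c]] e0[of c] e1[of c] a0 c by simp
      moreover have "fps_const (c ^ m) * b \<notin> range fps_const"
        using \<open>c \<noteq> 0\<close> 1 by (intro fps_const_mult_nonconst) auto
      ultimately show "h = 0"
        using fps_eval_nonconst by blast
    qed
  next
    case 2
    then obtain b0 where b0: "b = fps_const b0" "b0 \<noteq> 0" by auto
    show ?thesis
    proof (rule base_ring_vanishing_1[OF g inf])
      fix \<beta> :: 'a and h
      assume \<beta>: "\<beta> \<in> - {0}" and h: "\<And>x. x \<in> arc_orbit \<eta> \<Longrightarrow> ecoeff m 0 x = fps_const \<beta> \<Longrightarrow>
        fps_eval h (ecoeff m 1 x) = 0"
      obtain c where c: "c ^ m = \<beta> / b0"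
        using nth_root_exists[of m "\<beta> / b0"] m_ge by auto
      then have "c \<noteq> 0" using \<beta> b0 m_ge by (auto simp: power_0_left)
      then have "fps_eval h (fps_const (c ^ (m - 1)) * a) = 0"
        using h[OF orb[of c]] e0[of c] e1[of c] b0 c by simp
      moreover have "fps_const (c ^ (m - 1)) * a \<notin> range fps_const"
        using \<open>c \<noteq> 0\<close> 2 by (intro fps_const_mult_nonconst) auto
      ultimately show "h = 0"
        using fps_eval_nonconst by blast
    qed
  qed
qed

end

subsection \<open>Branches and their stabilisers\<close>

text \<open>Forms of degree \<open>d\<close> in the first m coordinates, as functions. Their
  coefficients lie in K and not in K[[t]], so that they commute with substitutions such as t ->
  wt.\<close>

inductive hpol :: "nat \<Rightarrow> nat \<Rightarrow> ('a::field pt \<Rightarrow> 'a fps) \<Rightarrow> bool" for m where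
  hpol_const: "hpol m 0 (\<lambda>x. fps_const c)"
| hpol_coord: "i < m \<Longrightarrow> hpol m 1 (\<lambda>x. x i)"
| hpol_add: "hpol m d f \<Longrightarrow> hpol m d g \<Longrightarrow> hpol m d (\<lambda>x. f x + g x)"
| hpol_mult: "hpol m d f \<Longrightarrow> hpol m e g \<Longrightarrow> hpol m (d + e) (\<lambda>x. f x * g x)"

lemma hpol_in_tower: "hpol m d f \<Longrightarrow> f \<in> tower m m"
proof (induction rule: hpol.induct)
  case (hpol_const c)
  show ?case by (rule const_in_tower)
next
  case (hpol_coord i)
  then show ?case using coord_in_tower[of i m m] by (simp add: coord_def)
next
  case (hpol_add d f g)
  then show ?case
    using subring_setD(4)[OF subring_tower, of f m m g] by (simp add: plus_fun_def)
next
  case (hpol_mult d f e g)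
  then show ?case
    using subring_setD(5)[OF subring_tower, of f m m g] by (simp add: times_fun_def)
qed

lemma hpol_scale: "hpol m d f \<Longrightarrow> f (\<lambda>i. c * x i) = c ^ d * f x"
  by (induction rule: hpol.induct) (simp_all add: algebra_simps power_add)

lemma hpol_permutes:
  assumes "\<sigma> permutes {..<m}" "hpol m d f"
  shows "hpol m d (\<lambda>x. f (x \<circ> \<sigma>))"
  using assms(2)
proof (induction rule: hpol.induct)
  case (hpol_coord i)
  then have "\<sigma> i < m"
    using permutes_in_image[OF assms(1), of i] by simp
  then show ?case using hpol.hpol_coord[of "\<sigma> i" m] by simp
qed (auto intro: hpol.intros)

lemma hpol_cong: "hpol m d f \<Longrightarrow> (\<And>i. i < m \<Longrightarrow> x i = y i) \<Longrightarrow> f x = f y"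
  by (induction rule: hpol.induct) auto

lemma hpol_hom:
  assumes "hpol m d f" "\<And>c. \<tau> (fps_const c) = fps_const c"
    "\<And>u v. \<tau> (u + v) = \<tau> u + \<tau> v" "\<And>u v. \<tau> (u * v) = \<tau> u * \<tau> v"
  shows "f (\<lambda>i. \<tau> (x i)) = \<tau> (f x)"
  using assms(1) by (induction rule: hpol.induct) (simp_all add: assms(2-))

lemma hpol_prod:
  assumes "\<And>s. s \<in> S \<Longrightarrow> hpol m (d s) (f s)"
  shows "hpol m (sum d S) (\<lambda>x. \<Prod>s\<in>S. f s x)"
  using assms
proof (induction S rule: infinite_finite_induct)
  case (insert a S)
  then show ?case using hpol_mult[of m "d a" "f a" "sum d S"] by simp
qed (use hpol_const[of m 1] in auto)

definition fps_subst :: "'a::field \<Rightarrow> 'a fps \<Rightarrow> 'a fps" where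
  "fps_subst w z = z oo (fps_const w * fps_X)"

lemma fps_subst_nth [simp]: "fps_subst w z $ n = w ^ n * z $ n"
  by (simp add: fps_subst_def)

lemma fps_subst_const [simp]: "fps_subst w (fps_const c) = fps_const c"
  by (simp add: fps_subst_def)

lemma fps_subst_0 [simp]: "fps_subst w 0 = 0"
  by (simp add: fps_subst_def)

lemma fps_subst_add: "fps_subst w (u + v) = fps_subst w u + fps_subst w v"
  by (simp add: fps_subst_def fps_compose_add_distrib)

lemma fps_subst_mult: "fps_subst w (u * v) = fps_subst w u * fps_subst w v"
  by (simp add: fps_subst_def fps_compose_mult_distrib)

lemma fps_subst_power: "fps_subst w (u ^ n) = fps_subst w u ^ n"
  using fps_subst_const[of w 1] by (induction n) (simp_all add: fps_subst_mult)

lemma fps_subst_X: "fps_subst w fps_X = fps_const w * fps_X"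
  by (simp add: fps_subst_def)

lemma fps_subst_inj: "w \<noteq> 0 \<Longrightarrow> fps_subst w u = fps_subst w v \<longleftrightarrow> u = v"
  by (auto simp: fps_eq_iff)

section \<open>The Galois group as the stabiliser of a branch\<close>

context power_sums
begin

text \<open>The Galois group of \<open>X\<^sup>m + aX + b\<close>, as the stabiliser of a component of the cone.\<close>

definition stab :: "'a pt \<Rightarrow> (nat \<Rightarrow> nat) set" where
  "stab \<eta> = {\<sigma>. \<sigma> permutes {..<m} \<and> (\<forall>d f. hpol m d f \<longrightarrow> (f \<eta> = 0 \<longleftrightarrow> f (\<eta> \<circ> \<sigma>) = 0))}"

lemma stabD: "\<sigma> \<in> stab \<eta> \<Longrightarrow> hpol m d f \<Longrightarrow> f (\<eta> \<circ> \<sigma>) = 0 \<longleftrightarrow> f \<eta> = 0"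
  by (auto simp: stab_def)

lemma stab_permutes: "\<sigma> \<in> stab \<eta> \<Longrightarrow> \<sigma> permutes {..<m}"
  by (simp add: stab_def)

lemma stab_id: "id \<in> stab \<eta>"
  by (simp add: stab_def permutes_id[unfolded id_def] id_def comp_def)

lemma stab_comp:
  assumes "\<sigma> \<in> stab \<eta>" "\<tau> \<in> stab \<eta>"
  shows "\<sigma> \<circ> \<tau> \<in> stab \<eta>"
  unfolding stab_def
proof safe
  show "\<sigma> \<circ> \<tau> permutes {..<m}"
    using assms by (intro permutes_compose) (auto dest: stab_permutes)
  fix d and f :: "'a pt \<Rightarrow> 'a fps" assume f: "hpol m d f"
  have "f (\<eta> \<circ> (\<sigma> \<circ> \<tau>)) = 0 \<longleftrightarrow> f ((\<eta> \<circ> \<sigma>) \<circ> \<tau>) = 0"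
    by (simp add: o_assoc)
  also have "\<dots> \<longleftrightarrow> f (\<eta> \<circ> \<tau>) = 0"
    using stabD[OF assms(1) hpol_permutes[OF stab_permutes[OF assms(2)] f]] .
  also have "\<dots> \<longleftrightarrow> f \<eta> = 0"
    using stabD[OF assms(2) f] .
  finally show "f \<eta> = 0 \<Longrightarrow> f (\<eta> \<circ> (\<sigma> \<circ> \<tau>)) = 0" "f (\<eta> \<circ> (\<sigma> \<circ> \<tau>)) = 0 \<Longrightarrow> f \<eta> = 0"
    by auto
qed

lemma stab_inv:
  assumes "\<sigma> \<in> stab \<eta>"
  shows "inv \<sigma> \<in> stab \<eta>"
  unfolding stab_def
proof safe
  note \<sigma> = stab_permutes[OF assms]
  show perm: "inv \<sigma> permutes {..<m}"
    using \<sigma> by (rule permutes_inv)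
  fix d and f :: "'a pt \<Rightarrow> 'a fps" assume f: "hpol m d f"
  have "f (\<eta> \<circ> inv \<sigma>) = 0 \<longleftrightarrow> f ((\<eta> \<circ> \<sigma>) \<circ> inv \<sigma>) = 0"
    by (rule stabD[OF assms hpol_permutes[OF perm f], symmetric])
  also have "(\<eta> \<circ> \<sigma>) \<circ> inv \<sigma> = \<eta>"
    using permutes_inv_o(1)[OF \<sigma>] by (simp flip: o_assoc)
  finally show "f \<eta> = 0 \<Longrightarrow> f (\<eta> \<circ> inv \<sigma>) = 0" "f (\<eta> \<circ> inv \<sigma>) = 0 \<Longrightarrow> f \<eta> = 0"
    by blast+
qed

text \<open>By homogeneity such a form vanishes on all scalings of the rearrangements as well, and
  these form a generic set.\<close>

lemma arc_vanishing:
  assumes arc: "arc \<eta> a b" and f: "hpol m d f" and "\<And>\<sigma>. \<sigma> permutes {..<m} \<Longrightarrow> f (\<eta> \<circ> \<sigma>) = 0"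
  shows "f \<in> ps_null m"
proof (rule generic_vanishing[OF generic_arc_orbit[OF arc] _ hpol_in_tower[OF f]])
  fix x assume "x \<in> arc_orbit \<eta>"
  then obtain c \<sigma> where c: "\<sigma> permutes {..<m}" "x = (\<lambda>i. fps_const c * \<eta> (\<sigma> i))"
    unfolding arc_orbit_def by blast
  have "f x = fps_const c ^ d * f (\<lambda>i. \<eta> (\<sigma> i))"
    unfolding c by (rule hpol_scale[OF f])
  then show "f x = 0"
    using assms(3)[OF c(1)] by (simp add: o_def)
qed simp

lemma arc_in_cone: "arc \<eta> a b \<Longrightarrow> \<eta> \<in> ps_cone m"
  unfolding arc_def using cone_trinomial(1) by blast

text \<open>Prime avoidance: the intersection of the vanishing ideals of the \<open>\<theta> \<circ> \<pi>\<close> consists of functions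
  vanishing on the whole cone, in particular at \<open>\<eta>\<close>.\<close>

lemma arc_dominates:
  assumes \<eta>: "arc \<eta> a b" and \<theta>: "arc \<theta> a' b'"
  obtains \<pi> where "\<pi> permutes {..<m}" "\<And>d f. hpol m d f \<Longrightarrow> f (\<theta> \<circ> \<pi>) = 0 \<Longrightarrow> f \<eta> = 0"
proof (rule ccontr)
  assume "\<not> thesis"
  then have "\<forall>\<pi>. \<exists>d f. \<pi> permutes {..<m} \<longrightarrow> hpol m d f \<and> f (\<theta> \<circ> \<pi>) = 0 \<and> f \<eta> \<noteq> 0"
    using that by blast
  then obtain d f where df: "\<And>\<pi>. \<pi> permutes {..<m} \<Longrightarrow> hpol m (d \<pi>) (f \<pi>)"
    "\<And>\<pi>. \<pi> permutes {..<m} \<Longrightarrow> f \<pi> (\<theta> \<circ> \<pi>) = 0" "\<And>\<pi>. \<pi> permutes {..<m} \<Longrightarrow> f \<pi> \<eta> \<noteq> 0"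
    by metis
  let ?S = "{\<pi>. \<pi> permutes {..<m}}"
  have fin: "finite ?S" by (rule finite_permutations) simp
  have "(\<lambda>x. \<Prod>\<pi>\<in>?S. f \<pi> x) \<in> ps_null m"
  proof (rule arc_vanishing[OF \<theta>])
    show "hpol m (sum d ?S) (\<lambda>x. \<Prod>\<pi>\<in>?S. f \<pi> x)"
      by (rule hpol_prod) (use df in auto)
    show "(\<Prod>\<pi>\<in>?S. f \<pi> (\<theta> \<circ> \<sigma>)) = 0" if "\<sigma> permutes {..<m}" for \<sigma>
      using that df(2) fin by (intro prod_zero) auto
  qed
  from ps_null_cone[OF this arc_in_cone[OF \<eta>]] show False
    using fin df(3) by (simp add: prod_zero_iff)
qed

text \<open>Dominating in both directions gives inclusions between the vanishing ideals. Composed,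
  they say that the ideal of \<open>\<eta> \<circ> \<sigma>\<close> is contained in that of
  \<open>\<eta>\<close>, for \<sigma> = \<rho> \<circ> \<pi>; since \<sigma> has finite order, the
  inclusion is an equality.\<close>

lemma arcs_conjugate:
  assumes \<eta>: "arc \<eta> a b" and \<theta>: "arc \<theta> a' b'"
  obtains \<pi> where "\<pi> permutes {..<m}" "\<And>d f. hpol m d f \<Longrightarrow> f (\<theta> \<circ> \<pi>) = 0 \<longleftrightarrow> f \<eta> = 0"
proof -
  obtain \<pi> where \<pi>: "\<pi> permutes {..<m}" "\<And>d f. hpol m d f \<Longrightarrow> f (\<theta> \<circ> \<pi>) = 0 \<Longrightarrow> f \<eta> = 0"
    using arc_dominates[OF \<eta> \<theta>] by blast
  obtain \<rho> where \<rho>: "\<rho> permutes {..<m}" "\<And>d f. hpol m d f \<Longrightarrow> f (\<eta> \<circ> \<rho>) = 0 \<Longrightarrow> f \<theta> = 0"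
    using arc_dominates[OF \<theta> \<eta>] by blast
  define \<sigma> where "\<sigma> = \<rho> \<circ> \<pi>"
  have \<sigma>: "\<sigma> permutes {..<m}"
    unfolding \<sigma>_def by (rule permutes_compose[OF \<pi>(1) \<rho>(1)])
  have step1: "f (\<theta> \<circ> \<pi>) = 0" if f: "hpol m d f" and "f (\<eta> \<circ> \<sigma>) = 0" for d f
    using \<rho>(2)[OF hpol_permutes[OF \<pi>(1) f]] that(2) by (simp add: \<sigma>_def o_assoc)
  have pow: "f (\<eta> \<circ> \<sigma> ^^ n) = 0 \<Longrightarrow> f \<eta> = 0" if f: "hpol m d f" for d f n
    using f
  proof (induction n arbitrary: f)
    case (Suc n)
    have "f (\<eta> \<circ> \<sigma> \<circ> \<sigma> ^^ n) = 0"
      using Suc.prems(1) by (simp only: funpow.simps o_assoc)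
    then have "f (\<eta> \<circ> \<sigma> ^^ n) = 0"
      using hpol_permutes[OF permutes_funpow[OF \<sigma>, of n] Suc.prems(2)]
        \<pi>(2) step1 by blast
    then show ?case
      using Suc by blast
  qed simp
  have "permutation \<sigma>"
    using \<sigma> by (auto simp: permutation_permutes)
  then obtain N where N: "\<sigma> ^^ N = id" "N > 0"
    by (rule permutation_is_nilpotent)
  have "f (\<theta> \<circ> \<pi>) = 0" if f: "hpol m d f" and "f \<eta> = 0" for d f
  \<comment> \<open>Going once around the cycle of powers of \<sigma> reverses the inclusion: apply
    \<open>pow\<close> with exponent N - 1 to the form \<sigma> has acted on.\<close>
  proof (rule step1[OF f])
    have "\<sigma> ^^ (N - 1) \<circ> \<sigma> = id"
      using N funpow_Suc_right[of "N - 1" \<sigma>] by simp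
    then have "f (\<eta> \<circ> \<sigma> ^^ (N - 1) \<circ> \<sigma>) = 0"
      using that(2) by (simp flip: o_assoc)
    then show "f (\<eta> \<circ> \<sigma>) = 0"
      using pow[OF hpol_permutes[OF \<sigma> f], of "N - 1"] by simp
  qed
  then show thesis
    using \<pi> that by blast
qed

lemma stab_conjugate:
  assumes \<pi>: "\<pi> permutes {..<m}" "\<And>d f. hpol m d f \<Longrightarrow> f (\<theta> \<circ> \<pi>) = 0 \<longleftrightarrow> f \<eta> = 0"
    and \<sigma>: "\<sigma> \<in> stab \<theta>"
  shows "inv \<pi> \<circ> \<sigma> \<circ> \<pi> \<in> stab \<eta>"
proof -
  let ?\<sigma> = "inv \<pi> \<circ> \<sigma> \<circ> \<pi>"
  have perm: "?\<sigma> permutes {..<m}"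
    by (intro permutes_compose permutes_inv \<pi>(1) stab_permutes[OF \<sigma>])
  have "f (\<eta> \<circ> ?\<sigma>) = 0 \<longleftrightarrow> f \<eta> = 0" if f: "hpol m d f" for d f
  proof -
    have "f (\<eta> \<circ> ?\<sigma>) = 0 \<longleftrightarrow> f (\<theta> \<circ> \<pi> \<circ> ?\<sigma>) = 0"
      using \<pi>(2)[OF hpol_permutes[OF perm f]] by simp
    also have "\<theta> \<circ> \<pi> \<circ> ?\<sigma> = \<theta> \<circ> \<sigma> \<circ> \<pi>"
      using permutes_inv_o(1)[OF \<pi>(1)] by (metis comp_id o_assoc)
    also have "f (\<theta> \<circ> \<sigma> \<circ> \<pi>) = 0 \<longleftrightarrow> f (\<theta> \<circ> \<pi>) = 0"
      using stabD[OF \<sigma> hpol_permutes[OF \<pi>(1) f]] .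
    also have "\<dots> \<longleftrightarrow> f \<eta> = 0"
      using \<pi>(2)[OF f] .
    finally show ?thesis .
  qed
  then show ?thesis
    using perm by (auto simp: stab_def)
qed

lemma arc_root:
  assumes "arc \<eta> a b" "poly (trinomial m a b) y = 0"
  obtains j where "j < m" "y = \<eta> j"
  using assms poly_root_poly[of "{..<m}" \<eta> y] that by (auto simp: arc_def)

text \<open>Forms over K commute with t -> wt and pick up only a nonzero factor under scaling by
  \<open>c\<close>. If both together map roots of the trinomial to roots, they rearrange the
  coordinates of \<open>\<eta>\<close> without changing which forms vanish there.\<close>

lemma arc_automorphism:
  assumes arc: "arc \<eta> a b" and w: "w \<noteq> 0" and c: "c \<noteq> 0"
    and root: "\<And>y. poly (trinomial m a b) y = 0 \<Longrightarrow>
      poly (trinomial m a b) (fps_const c * fps_subst w y) = 0"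
  obtains \<sigma> where "\<sigma> \<in> stab \<eta>" "\<And>i. i < m \<Longrightarrow> \<eta> (\<sigma> i) = fps_const c * fps_subst w (\<eta> i)"
proof -
  have inj: "inj_on \<eta> {..<m}" and rp: "root_poly {..<m} \<eta> = trinomial m a b"
    using arc by (auto simp: arc_def)
  have "\<exists>j<m. \<eta> j = fps_const c * fps_subst w (\<eta> i)" if "i < m" for i
  proof -
    have "poly (trinomial m a b) (\<eta> i) = 0"
      using that poly_root_poly_root[of "{..<m}" i \<eta>] by (simp add: rp)
    from arc_root[OF arc root[OF this]] show ?thesis by metis
  qed
  then obtain s where s: "\<And>i. i < m \<Longrightarrow> s i < m"
    "\<And>i. i < m \<Longrightarrow> \<eta> (s i) = fps_const c * fps_subst w (\<eta> i)"
    by metis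
  define \<sigma> where "\<sigma> i = (if i < m then s i else i)" for i
  have "inj_on \<sigma> {..<m}"
  proof (rule inj_onI)
    fix i j assume ij: "i \<in> {..<m}" "j \<in> {..<m}" "\<sigma> i = \<sigma> j"
    then have "s i = s j"
      by (simp add: \<sigma>_def)
    then have "fps_const c * fps_subst w (\<eta> i) = fps_const c * fps_subst w (\<eta> j)"
      using s(2)[of i] s(2)[of j] ij by (metis lessThan_iff)
    then have "\<eta> i = \<eta> j"
      using c w by (simp add: fps_subst_inj)
    then show "i = j"
      using inj_onD[OF inj] ij by blast
  qed
  moreover have "\<sigma> ` {..<m} \<subseteq> {..<m}"
    using s(1) by (auto simp: \<sigma>_def)
  ultimately have "bij_betw \<sigma> {..<m} {..<m}"
    by (simp add: bij_betw_def endo_inj_surj)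
  then have perm: "\<sigma> permutes {..<m}"
    by (rule bij_imp_permutes) (simp add: \<sigma>_def)
  have "f (\<eta> \<circ> \<sigma>) = 0 \<longleftrightarrow> f \<eta> = 0" if f: "hpol m d f" for d f
  proof -
    have "f (\<eta> \<circ> \<sigma>) = f (\<lambda>i. fps_const c * fps_subst w (\<eta> i))"
      by (rule hpol_cong[OF f]) (simp add: \<sigma>_def s(2))
    also have "\<dots> = fps_const c ^ d * f (\<lambda>i. fps_subst w (\<eta> i))"
      by (rule hpol_scale[OF f])
    also have "f (\<lambda>i. fps_subst w (\<eta> i)) = fps_subst w (f \<eta>)"
      by (rule hpol_hom[OF f]) (auto simp: fps_subst_add fps_subst_mult)
    finally have eq: "f (\<eta> \<circ> \<sigma>) = fps_const c ^ d * fps_subst w (f \<eta>)" .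
    have "fps_subst w (f \<eta>) = 0 \<longleftrightarrow> f \<eta> = 0"
      using fps_subst_inj[OF w, of "f \<eta>" 0] by (simp add: fps_subst_def)
    then show ?thesis
      unfolding eq using c by simp
  qed
  then have "\<sigma> \<in> stab \<eta>"
    using perm by (auto simp: stab_def)
  then show thesis
    using that s(2) by (simp add: \<sigma>_def)
qed

end

subsection \<open>Hensel's lemma\<close>

abbreviation poly_nth0 :: "'a::field fps poly \<Rightarrow> 'a poly" where
  "poly_nth0 F \<equiv> map_poly (\<lambda>c. c $ 0) F"

lemma poly_fps_nth_0: "poly F r $ 0 = poly (poly_nth0 F) (r $ 0)"
  by (induction F) (auto simp: map_poly_pCons)

lemma pderiv_poly_nth0: "poly_nth0 (pderiv F) = pderiv (poly_nth0 F)"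
  by (rule poly_eqI) (simp add: coeff_map_poly coeff_pderiv fps_of_nat[symmetric])

lemma poly_fps_nth_cong:
  fixes r s :: "'a::field fps"
  assumes "\<And>k. k \<le> n \<Longrightarrow> r $ k = s $ k"
  shows "k \<le> n \<Longrightarrow> poly F r $ k = poly F s $ k"
proof (induction F arbitrary: k)
  case (pCons c F)
  have "(r * poly F r) $ k = (s * poly F s) $ k"
    using pCons assms by (auto simp: fps_mult_nth intro!: sum.cong)
  then show ?case by simp
qed simp

text \<open>Taylor expansion with an unspecified quadratic remainder, which avoids dividing by
  factorials.\<close>

lemma poly_taylor1:
  fixes r h :: "'b::idom"
  shows "\<exists>q. poly F (r + h) = poly F r + h * poly (pderiv F) r + h ^ 2 * q"
proof (induction F)
  case (pCons c F)
  then obtain q where "poly F (r + h) = poly F r + h * poly (pderiv F) r + h ^ 2 * q"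
    by blast
  then have "poly (pCons c F) (r + h) = poly (pCons c F) r + h * poly (pderiv (pCons c F)) r
    + h ^ 2 * (poly (pderiv F) r + r * q + h * q)"
    by (simp add: pderiv_pCons algebra_simps power2_eq_square)
  then show ?case by blast
qed simp

lemma fps_hensel:
  fixes F :: "'a::field fps poly"
  assumes root: "poly (poly_nth0 F) \<rho> = 0" and simple: "poly (pderiv (poly_nth0 F)) \<rho> \<noteq> 0"
  shows "\<exists>r. r $ 0 = \<rho> \<and> poly F r = 0"
proof -
  define D where "D = poly (pderiv (poly_nth0 F)) \<rho>"
  \<comment> \<open>Newton iteration, one coefficient at a time. Each correction solves the
    linearised equation, whose slope is always \<open>D\<close> because the constant coefficient
    stays \<open>\<rho>\<close>.\<close>
  define R where "R = rec_nat (fps_const \<rho>)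
    (\<lambda>n r. r + fps_const (- (poly F r $ Suc n) / D) * fps_X ^ Suc n)"
  have R0: "R 0 = fps_const \<rho>"
    and RS: "R (Suc n) = R n + fps_const (- (poly F (R n) $ Suc n) / D) * fps_X ^ Suc n" for n
    by (simp_all add: R_def)
  have stable: "R (Suc n) $ k = R n $ k" if "k \<le> n" for n k
    using that by (simp add: RS fps_X_power_iff del: power_Suc)
  have stable': "k \<le> n \<Longrightarrow> R n $ k = R k $ k" for n k
    by (induction n rule: dec_induct) (simp_all add: stable)
  have R_nth0: "R n $ 0 = \<rho>" for n
    using stable'[of 0 n] by (simp add: R0)
  have vanish: "k \<le> n \<Longrightarrow> poly F (R n) $ k = 0" for n k
  proof (induction n arbitrary: k)
    case 0
    then show ?case
      using root by (simp add: poly_fps_nth_0 R0)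
  next
    case (Suc n)
    show ?case
    proof (cases "k \<le> n")
      case True
      have "poly F (R (Suc n)) $ k = poly F (R n) $ k"
        by (rule poly_fps_nth_cong[OF _ True]) (rule stable)
      then show ?thesis using Suc.IH[OF True] by simp
    next
      case False
      then have k: "k = Suc n" using Suc.prems by simp
      define c where "c = - (poly F (R n) $ Suc n) / D"
      obtain q where "poly F (R (Suc n)) = poly F (R n)
        + (fps_const c * fps_X ^ Suc n) * poly (pderiv F) (R n) + (fps_const c * fps_X ^ Suc n) ^ 2 * q"
        using poly_taylor1 unfolding RS c_def[symmetric] by blast
      \<comment> \<open>The quadratic remainder is divisible by t^(2n+2) and does not reach the
        coefficient of index n + 1.\<close>
      also have "(fps_const c * fps_X ^ Suc n) ^ 2 * q = fps_X ^ Suc n * (fps_X ^ Suc n * (fps_const (c ^ 2) * q))"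
        by (simp only: power2_eq_square mult_ac fps_const_mult[symmetric])
      also have "poly F (R n) + (fps_const c * fps_X ^ Suc n) * poly (pderiv F) (R n)
        + fps_X ^ Suc n * (fps_X ^ Suc n * (fps_const (c ^ 2) * q))
        = poly F (R n) + fps_X ^ Suc n * (fps_const c * poly (pderiv F) (R n)
          + fps_X ^ Suc n * (fps_const (c ^ 2) * q))"
        by (simp only: distrib_left mult_ac add_ac)
      finally have "poly F (R (Suc n)) $ k = poly F (R n) $ Suc n + c * (poly (pderiv F) (R n) $ 0)"
        by (simp add: k fps_X_power_mult_nth del: power_Suc)
      also have "poly (pderiv F) (R n) $ 0 = D"
        by (simp add: poly_fps_nth_0 pderiv_poly_nth0 R_nth0 D_def)
      finally show ?thesis
        using simple by (simp add: c_def D_def)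
    qed
  qed
  define r where "r = Abs_fps (\<lambda>n. R n $ n)"
  have "poly F r $ n = 0" for n
  proof -
    have "poly F r $ n = poly F (R n) $ n"
    proof (rule poly_fps_nth_cong[of n])
      show "r $ k = R n $ k" if "k \<le> n" for k
        using stable'[OF that] by (simp add: r_def)
    qed simp
    then show ?thesis using vanish by simp
  qed
  then show ?thesis
    by (intro exI[of _ r]) (simp add: fps_eq_iff r_def R0)
qed

section \<open>Three branches and the full symmetric group\<close>

context power_sums
begin

lemma poly_nth0_trinomial: "poly_nth0 (trinomial m a b) = trinomial m (a $ 0) (b $ 0)"
  using m_ge by (intro poly_eqI) (auto simp: coeff_map_poly coeff_trinomial)

lemma lift_simple_roots:
  fixes a b :: "'a fps"
  assumes v: "root_poly {..<m} v = trinomial m (a $ 0) (b $ 0)" and inj: "inj_on v {..<m}"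
  obtains \<eta> where "root_poly {..<m} \<eta> = trinomial m a b" "inj_on \<eta> {..<m}"
    "\<And>i. i < m \<Longrightarrow> \<eta> i $ 0 = v i"
proof -
  have "\<exists>r. r $ 0 = v i \<and> poly (trinomial m a b) r = 0" if i: "i < m" for i
  proof (rule fps_hensel)
    show "poly (poly_nth0 (trinomial m a b)) (v i) = 0"
      using i poly_root_poly_root[of "{..<m}" i v] by (simp add: poly_nth0_trinomial v[symmetric])
    show "poly (pderiv (poly_nth0 (trinomial m a b))) (v i) \<noteq> 0"
      using i inj by (auto simp: poly_nth0_trinomial v[symmetric] pderiv_root_poly inj_on_def)
  qed
  then obtain \<eta> where \<eta>: "\<And>i. i < m \<Longrightarrow> \<eta> i $ 0 = v i" "\<And>i. i < m \<Longrightarrow> poly (trinomial m a b) (\<eta> i) = 0"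
    by metis
  have inj\<eta>: "inj_on \<eta> {..<m}"
  proof (rule inj_onI)
    fix i j assume "i \<in> {..<m}" "j \<in> {..<m}" "\<eta> i = \<eta> j"
    then show "i = j"
      using \<eta>(1)[of i] \<eta>(1)[of j] inj by (auto simp: inj_on_def)
  qed
  have "root_poly {..<m} \<eta> = trinomial m a b"
    using m_ge \<eta>(2) inj\<eta> by (intro root_poly_eq_of_roots) (auto simp: degree_trinomial coeff_trinomial)
  then show thesis
    using that inj\<eta> \<eta>(1) by blast
qed

lemma trinomial_roots_simple:
  fixes a b :: 'a
  assumes "root_poly {..<m} v = trinomial m a b"
    and "\<And>y. of_nat m * y ^ (m - 1) + a = 0 \<Longrightarrow> y ^ m + a * y + b = 0 \<Longrightarrow> False"
  shows "inj_on v {..<m}"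
  using trinomial_multiple_root[OF assms(1)] assms(2) by (intro inj_onI) (metis lessThan_iff)

text \<open>If the roots at t = 0 are distinct, they label the roots of the branch. The permutation
  induced by t -> wt and scaling by \<open>c\<close> can then be read off from multiplication by
  \<open>c\<close> at t = 0.\<close>

lemma simple_branch:
  assumes v: "root_poly {..<m} v = trinomial m (a $ 0) (b $ 0)" "inj_on v {..<m}"
    and ab: "a \<in> fps_const ` (- {0}) \<and> b \<notin> range fps_const \<or>
      b \<in> fps_const ` (- {0}) \<and> a \<notin> range fps_const"
  obtains \<theta> where "arc \<theta> a b"
    "\<And>w c. w \<noteq> 0 \<Longrightarrow> c \<noteq> 0 \<Longrightarrow> (\<And>y. poly (trinomial m a b) y = 0 \<Longrightarrow>
        poly (trinomial m a b) (fps_const c * fps_subst w y) = 0) \<Longrightarrow>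
      \<exists>\<sigma>\<in>stab \<theta>. \<forall>i<m. \<forall>j<m. v j = c * v i \<longrightarrow> \<sigma> i = j"
proof -
  obtain \<theta> where \<theta>: "root_poly {..<m} \<theta> = trinomial m a b" "inj_on \<theta> {..<m}"
    "\<And>i. i < m \<Longrightarrow> \<theta> i $ 0 = v i"
    using lift_simple_roots[OF v] by blast
  then have arc: "arc \<theta> a b"
    unfolding arc_def using ab by blast
  have "\<exists>\<sigma>\<in>stab \<theta>. \<forall>i<m. \<forall>j<m. v j = c * v i \<longrightarrow> \<sigma> i = j"
    if wc: "w \<noteq> 0" "c \<noteq> 0" and root: "\<And>y. poly (trinomial m a b) y = 0 \<Longrightarrow>
        poly (trinomial m a b) (fps_const c * fps_subst w y) = 0" for w c
  proof -
    obtain \<sigma> where \<sigma>: "\<sigma> \<in> stab \<theta>" "\<And>i. i < m \<Longrightarrow> \<theta> (\<sigma> i) = fps_const c * fps_subst w (\<theta> i)"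
      using arc_automorphism[OF arc wc root] by blast
    have "\<sigma> i = j" if ij: "i < m" "j < m" "v j = c * v i" for i j
    proof -
      have "\<sigma> i < m"
        using stab_permutes[OF \<sigma>(1)] ij(1) by (simp add: permutes_in_image flip: lessThan_iff)
      moreover have "v (\<sigma> i) = v j"
        using arg_cong[OF \<sigma>(2)[OF ij(1)], of "\<lambda>z. z $ 0"] \<theta>(3) ij \<open>\<sigma> i < m\<close> by simp
      ultimately show ?thesis
        using v(2) ij by (auto simp: inj_on_def)
    qed
    then show ?thesis using \<sigma>(1) by blast
  qed
  then show thesis
    using that[OF arc] by blast
qed

text \<open>The branch of \<open>X\<^sup>m + tX - 1\<close> at \<open>t = 0\<close>, with the substitution \<open>t \<mapsto> \<omega>t\<close> for \<open>\<omega>\<^sup>m = 1\<close>.\<close>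

lemma arc_transitive:
  obtains \<theta> a b where "arc \<theta> a b" "\<And>i j. i < m \<Longrightarrow> j < m \<Longrightarrow> \<exists>\<sigma>\<in>stab \<theta>. \<sigma> i = j"
proof -
  obtain v :: "nat \<Rightarrow> 'a" where v: "root_poly {..<m} v = trinomial m 0 (- 1)"
    by (rule exists_trinomial_roots)
  have root: "v i ^ m = 1" if "i < m" for i
    using poly_root_poly_root[of "{..<m}" i v] that by (simp add: v poly_trinomial)
  \<comment> \<open>The derivative of X^m - 1 vanishes only at 0, which is not a root.\<close>
  have inj: "inj_on v {..<m}"
    by (rule trinomial_roots_simple[OF v]) (use of_nat_nonzero[of m] m_ge in \<open>auto simp: power_0_left\<close>)
  have "root_poly {..<m} v = trinomial m ((fps_X :: 'a fps) $ 0) ((- 1 :: 'a fps) $ 0)"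
    using v by simp
  moreover have "- 1 \<in> fps_const ` (- {0 :: 'a})"
    using fps_const_in[of "- 1 :: 'a"] by (simp flip: fps_const_neg)
  ultimately obtain \<theta> where arc: "arc \<theta> (fps_X :: 'a fps) (- 1)"
    and sym: "\<And>w c. w \<noteq> 0 \<Longrightarrow> c \<noteq> 0 \<Longrightarrow> (\<And>y. poly (trinomial m fps_X (- 1)) y = 0 \<Longrightarrow>
        poly (trinomial m fps_X (- 1)) (fps_const c * fps_subst w y) = 0) \<Longrightarrow>
      \<exists>\<sigma>\<in>stab \<theta>. \<forall>i<m. \<forall>j<m. v j = c * v i \<longrightarrow> \<sigma> i = j"
    using simple_branch[OF _ inj] fps_X_nonconst by blast
  have "\<exists>\<sigma>\<in>stab \<theta>. \<sigma> i = j" if ij: "i < m" "j < m" for i j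
  proof -
    \<comment> \<open>With this m-th root of unity, w y(wt) is a root of X^m + tX - 1 whenever y(t)
      is: w^m = 1, and t times the scaling factor w is the new parameter wt.\<close>
    define w where "w = v j / v i"
    have nz: "v i \<noteq> 0" "v j \<noteq> 0"
      using root[of i] root[of j] ij m_ge by (auto simp: power_0_left)
    have wm: "w ^ m = 1"
      by (simp add: w_def power_divide root ij)
    have w: "w \<noteq> 0" using nz by (simp add: w_def)
    have "\<exists>\<sigma>\<in>stab \<theta>. \<forall>i<m. \<forall>j<m. v j = w * v i \<longrightarrow> \<sigma> i = j"
    proof (rule sym[OF w w])
      fix y :: "'a fps" assume "poly (trinomial m fps_X (- 1)) y = 0"
      then have "fps_subst w (y ^ m + fps_X * y + fps_const (- 1)) = fps_subst w (fps_const 0)"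
        by (simp add: poly_trinomial flip: fps_const_neg)
      then have "fps_subst w y ^ m + fps_const w * fps_X * fps_subst w y + fps_const (- 1) = 0"
        by (simp add: fps_subst_add fps_subst_mult fps_subst_power fps_subst_X del: fps_const_neg)
      moreover have "(fps_const w * fps_subst w y) ^ m = fps_subst w y ^ m"
        by (simp add: power_mult_distrib fps_const_power wm)
      ultimately show "poly (trinomial m fps_X (- 1)) (fps_const w * fps_subst w y) = 0"
        by (simp add: poly_trinomial mult_ac flip: fps_const_neg)
    qed
    moreover have "v j = w * v i" using nz by (simp add: w_def)
    ultimately show ?thesis using ij by blast
  qed
  with arc show thesis by (rule that)
qed

text \<open>The branch of \<open>X\<^sup>m - X + t\<close> at \<open>t = 0\<close>, with the substitution \<open>t \<mapsto> \<omega>t\<close> for \<open>\<omega>\<^sup>m\<^sup>-\<^sup>1 = 1\<close>.\<close>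

lemma arc_stabiliser_transitive:
  obtains \<theta> q where "arc \<theta> (- 1) fps_X" "q < m"
    "\<And>i j. i < m \<Longrightarrow> j < m \<Longrightarrow> i \<noteq> q \<Longrightarrow> j \<noteq> q \<Longrightarrow> \<exists>\<sigma>\<in>stab \<theta>. \<sigma> q = q \<and> \<sigma> i = j"
proof -
  obtain v :: "nat \<Rightarrow> 'a" where v: "root_poly {..<m} v = trinomial m (- 1) 0"
    by (rule exists_trinomial_roots)
  have root: "v i ^ m = v i" if "i < m" for i
    using poly_root_poly_root[of "{..<m}" i v] that by (simp add: v poly_trinomial)
  have inj: "inj_on v {..<m}"
  proof (rule trinomial_roots_simple[OF v])
    fix y :: 'a assume y: "of_nat m * y ^ (m - 1) + - 1 = 0" "y ^ m + - 1 * y + 0 = 0"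
    have "y ^ m = y * y ^ (m - 1)"
      using m_ge by (simp flip: power_Suc)
    then have "y = 0 \<or> y ^ (m - 1) = 1"
      using y(2) by auto
    \<comment> \<open>In the second case m y^(m-1) = 1 would make m - 1 zero in K.\<close>
    then show False
    proof
      assume "y = 0"
      then show False using y(1) m_ge by (simp add: power_0_left)
    next
      assume "y ^ (m - 1) = 1"
      then have "(of_nat (m - 1) :: 'a) = 0"
        using y(1) m_ge by (simp add: of_nat_diff)
      then show False using of_nat_nonzero[of "m - 1"] m_ge by simp
    qed
  qed
  have "(\<Prod>i<m. 0 - v i) = 0"
    using poly_root_poly[of "{..<m}" v 0] m_ge by (simp add: v poly_trinomial power_0_left)
  then obtain q where q: "q < m" "v q = 0" by auto
  have "root_poly {..<m} v = trinomial m ((- 1 :: 'a fps) $ 0) ((fps_X :: 'a fps) $ 0)"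
    using v by simp
  moreover have "- 1 \<in> fps_const ` (- {0 :: 'a})"
    using fps_const_in[of "- 1 :: 'a"] by (simp flip: fps_const_neg)
  ultimately obtain \<theta> where arc: "arc \<theta> (- 1) (fps_X :: 'a fps)"
    and sym: "\<And>w c. w \<noteq> 0 \<Longrightarrow> c \<noteq> 0 \<Longrightarrow> (\<And>y. poly (trinomial m (- 1) fps_X) y = 0 \<Longrightarrow>
        poly (trinomial m (- 1) fps_X) (fps_const c * fps_subst w y) = 0) \<Longrightarrow>
      \<exists>\<sigma>\<in>stab \<theta>. \<forall>i<m. \<forall>j<m. v j = c * v i \<longrightarrow> \<sigma> i = j"
    using simple_branch[OF _ inj] fps_X_nonconst by blast
  have "\<exists>\<sigma>\<in>stab \<theta>. \<sigma> q = q \<and> \<sigma> i = j" if ij: "i < m" "j < m" "i \<noteq> q" "j \<noteq> q" for i j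
  proof -
    \<comment> \<open>\<open>w\<close> and \<open>c\<close> are inverse roots of unity of order
      dividing m - 1. If y(t) is a root of X^m - X + t, so is c y(wt): as c^m = c, the first two
      terms give c times -wt, which is -t. The root that is 0 at t = 0 is fixed.\<close>
    define w where "w = v i / v j"
    define c where "c = v j / v i"
    have nz: "v i \<noteq> 0" "v j \<noteq> 0"
      using ij inj q by (auto simp: inj_on_def)
    have cm: "c ^ m = c"
      by (simp add: c_def power_divide root ij)
    have wc: "w \<noteq> 0" "c \<noteq> 0" "c * w = 1" using nz by (simp_all add: w_def c_def)
    have "\<exists>\<sigma>\<in>stab \<theta>. \<forall>i<m. \<forall>j<m. v j = c * v i \<longrightarrow> \<sigma> i = j"
    proof (rule sym[OF wc(1,2)])
      fix y :: "'a fps" assume "poly (trinomial m (- 1) fps_X) y = 0"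
      then have "fps_subst w (y ^ m + fps_const (- 1) * y + fps_X) = fps_subst w (fps_const 0)"
        by (simp add: poly_trinomial flip: fps_const_neg)
      then have *: "fps_subst w y ^ m + fps_const (- 1) * fps_subst w y + fps_const w * fps_X = 0"
        by (simp add: fps_subst_add fps_subst_mult fps_subst_power fps_subst_X del: fps_const_neg)
      have "poly (trinomial m (- 1) fps_X) (fps_const c * fps_subst w y)
        = fps_const c * (fps_subst w y ^ m + fps_const (- 1) * fps_subst w y)
          + fps_const (c * w) * fps_X"
        by (simp add: poly_trinomial power_mult_distrib fps_const_power cm wc(3) algebra_simps flip: fps_const_neg)
      also have "\<dots> = fps_const c * (fps_subst w y ^ m + fps_const (- 1) * fps_subst w y + fps_const w * fps_X)"
        by (simp add: algebra_simps flip: fps_const_mult)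
      finally show "poly (trinomial m (- 1) fps_X) (fps_const c * fps_subst w y) = 0"
        using * by simp
    qed
    moreover have "v j = c * v i" "v q = c * v q" using nz q(2) by (simp_all add: c_def)
    ultimately show ?thesis using ij q(1) by blast
  qed
  with arc q(1) show thesis by (rule that)
qed

text \<open>The branch of \<open>X\<^sup>m - mX + (m - 1) + t\<^sup>2\<close> at \<open>t = 0\<close>: the substitution \<open>t \<mapsto> -t\<close> swaps the two roots
  \<open>1 + tZ\<close> over the double root \<open>1\<close>.\<close>

lemma arc_transposition:
  obtains \<theta> a b p q where "arc \<theta> a b" "p < m" "q < m" "p \<noteq> q" "transpose p q \<in> stab \<theta>"
proof -
  define M where "M = (of_nat m :: 'a)"
  have M: "M \<noteq> 0" "M - 1 \<noteq> 0" "M - 1 = of_nat (m - 1)" "(2 :: 'a) \<noteq> 0"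
    using of_nat_nonzero[of m] of_nat_nonzero[of "m - 1"] of_nat_nonzero[of 2] m_ge
    by (auto simp: M_def of_nat_diff)
  define f0 where "f0 = trinomial m (- M) (M - 1)"
  have f0': "pderiv f0 = monom M (m - 1) + [:- M:]"
    by (simp add: f0_def trinomial_def pderiv_add pderiv_monom pderiv_pCons M_def)
  \<comment> \<open>The derivative is m(X^(m-1) - 1), and where y^(m-1) = 1 the value of
    \<open>f0\<close> is (m - 1)(1 - y).\<close>
  have crit: "y = 1" if "poly f0 y = 0" "poly (pderiv f0) y = 0" for y
  proof -
    have "M * (y ^ (m - 1) - 1) = 0"
      using that(2) by (simp add: f0' poly_monom algebra_simps)
    then have "y ^ (m - 1) = 1"
      using M by simp
    then have "y ^ m = y"
      using m_ge power_Suc[of y "m - 1"] by simp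
    then have "(M - 1) * (1 - y) = 0"
      using that(1) by (simp add: f0_def poly_trinomial algebra_simps)
    then show "y = 1" using M by simp
  qed
  have "poly f0 1 = 0"
    by (simp add: f0_def poly_trinomial)
  then obtain q where q: "f0 = [:- 1, 1:] * q"
    by (metis poly_eq_0_iff_dvd dvdE)
  have "poly (pderiv f0) 1 = 0"
    by (simp add: f0' poly_monom)
  then have "poly q 1 = 0"
    unfolding q by (simp add: pderiv_mult pderiv_pCons del: mult_pCons_left mult_pCons_right)
  then obtain g where "q = [:- 1, 1:] * g"
    by (metis poly_eq_0_iff_dvd dvdE)
  then have g: "f0 = [:- 1, 1:] * ([:- 1, 1:] * g)" using q by simp
  have deg_f0: "degree f0 = m" "coeff f0 m = 1"
    using m_ge by (simp_all add: f0_def degree_trinomial coeff_trinomial)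
  have "g \<noteq> 0" using g deg_f0 by auto
  then have deg_g: "degree g = m - 2"
    using deg_f0 arg_cong[OF g, of degree]
    by (simp add: degree_mult_eq del: mult_pCons_left mult_pCons_right)
  have "lead_coeff f0 = lead_coeff g"
    unfolding g lead_coeff_mult by simp
  then have lc_g: "lead_coeff g = 1"
    using deg_f0 by simp
  \<comment> \<open>The second derivative of \<open>f0\<close> at 1 is m(m - 1), so 1 is no more
    than a double root.\<close>
  have g1: "poly g 1 \<noteq> 0"
  proof
    assume "poly g 1 = 0"
    then have "poly (pderiv (pderiv f0)) 1 = 0"
      unfolding g by (simp add: pderiv_mult pderiv_add pderiv_pCons del: mult_pCons_left mult_pCons_right)
    moreover have "poly (pderiv (pderiv f0)) 1 = (M - 1) * M"
      by (simp add: f0' pderiv_add pderiv_monom pderiv_pCons poly_monom M(3))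
    ultimately show False using M by simp
  qed
  obtain v where v: "g = root_poly {..<m - 2} v"
    using exists_root_poly[OF lc_g] deg_g by auto
  have gv: "poly g (v i) = 0" if "i < m - 2" for i
    using that by (simp add: v poly_root_poly_root)
  then have v1: "v i \<noteq> 1" if "i < m - 2" for i
    using g1 that by metis
  have fv: "poly f0 (v i) = 0" if "i < m - 2" for i
    using gv[OF that] by (simp add: g)
  have injv: "inj_on v {..<m - 2}"
  proof (rule inj_onI, rule ccontr)
    fix i j assume ij: "i \<in> {..<m - 2}" "j \<in> {..<m - 2}" "v i = v j" "i \<noteq> j"
    define h where "h = root_poly ({..<m - 2} - {i} - {j}) v"
    have "g = [:- v i, 1:] * ([:- v i, 1:] * h)"
      using ij root_poly_remove[of "{..<m - 2}" i v] root_poly_remove[of "{..<m - 2} - {i}" j v]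
      by (simp add: v h_def)
    then have "poly (pderiv f0) (v i) = 0"
      unfolding g by (simp add: pderiv_mult pderiv_pCons del: mult_pCons_left mult_pCons_right)
    then show False
      using crit[OF fv] v1 ij(1) by auto
  qed
  define a where "a = fps_const (- M)"
  \<comment> \<open>The roots near 1 behave like the two square roots of the perturbation of b;
    perturbing by t^2 makes them power series in t.\<close>
  define b where "b = fps_const (M - 1) + fps_X ^ 2"
  let ?F = "trinomial m a b"
  have F0: "poly_nth0 ?F = f0"
    by (simp add: poly_nth0_trinomial a_def b_def f0_def)
  have evg: "fps_eval f0 z = (z - 1) ^ 2 * fps_eval g z" for z
    unfolding g fps_eval_linear_factor by (simp add: power2_eq_square algebra_simps)
  have F: "poly ?F z = (z - 1) ^ 2 * fps_eval g z + fps_X ^ 2" for z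
    unfolding evg[symmetric]
    by (simp add: f0_def poly_trinomial trinomial_def fps_eval_add fps_eval_monom fps_eval_pCons a_def b_def
        poly_monom algebra_simps)
  have "\<exists>r. r $ 0 = v i \<and> poly ?F r = 0" if i: "i < m - 2" for i
    by (rule fps_hensel) (use fv[OF i] crit[OF fv[OF i]] v1[OF i] in \<open>auto simp: F0\<close>)
  then obtain r where r: "\<And>i. i < m - 2 \<Longrightarrow> r i $ 0 = v i" "\<And>i. i < m - 2 \<Longrightarrow> poly ?F (r i) = 0"
    by metis
  define G where "G = map_poly fps_const g"
  \<comment> \<open>What remains of \<open>?F\<close> after substituting 1 + tz for X and dividing
    by t^2. The double root is thereby resolved: at t = 0 the roots of \<open>P\<close> are simple,
    and Hensel's lemma applies.\<close>
  define P where "P = monom 1 2 * pcompose G [:1, fps_X:] + 1"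
  have P: "poly P z = z ^ 2 * fps_eval g (1 + fps_X * z) + 1" for z
    by (simp add: P_def poly_pcompose poly_monom fps_eval_def G_def mult.commute)
  have ev0: "fps_eval g z $ 0 = poly g (z $ 0)" for z
  proof -
    have "poly_nth0 (map_poly fps_const g) = g"
      by (rule poly_eqI) (simp add: coeff_map_poly)
    then show ?thesis by (simp add: fps_eval_def poly_fps_nth_0)
  qed
  have P0: "poly (poly_nth0 P) \<rho> = \<rho> ^ 2 * poly g 1 + 1" for \<rho>
    using poly_fps_nth_0[of P "fps_const \<rho>"] by (simp add: P ev0 fps_power_zeroth)
  have P0': "poly (pderiv (poly_nth0 P)) \<rho> = 2 * \<rho> * poly g 1" for \<rho>
  proof -
    have "poly (pderiv (poly_nth0 P)) \<rho> = poly (pderiv P) (fps_const \<rho>) $ 0"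
      by (simp add: poly_fps_nth_0 pderiv_poly_nth0)
    also have "\<dots> = 2 * \<rho> * poly (pcompose G [:1, fps_X:]) (fps_const \<rho>) $ 0"
      by (simp add: P_def pderiv_add pderiv_mult pderiv_monom pderiv_pcompose pderiv_pCons poly_monom)
    also have "poly (pcompose G [:1, fps_X:]) (fps_const \<rho>) $ 0 = poly g 1"
      by (simp add: poly_pcompose G_def flip: fps_eval_def) (simp add: ev0)
    finally show ?thesis .
  qed
  obtain \<kappa> where \<kappa>: "\<kappa> ^ 2 = - 1 / poly g 1"
    using nth_root_exists[of 2 "- 1 / poly g 1"] by auto
  have \<kappa>0: "\<kappa> \<noteq> 0" using \<kappa> g1 by auto
  have \<kappa>2: "- \<kappa> \<noteq> \<kappa>"
  proof
    assume "- \<kappa> = \<kappa>"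
    then have "2 * \<kappa> = 0" by (metis add.right_inverse mult_2)
    then show False using M(4) \<kappa>0 by simp
  qed
  have lift: "\<exists>z. z $ 0 = \<rho> \<and> poly ?F (1 + fps_X * z) = 0" if \<rho>: "\<rho> ^ 2 = - 1 / poly g 1" "\<rho> \<noteq> 0" for \<rho>
  proof -
    have "\<exists>z. z $ 0 = \<rho> \<and> poly P z = 0"
      by (rule fps_hensel) (use \<rho> g1 M(4) in \<open>auto simp: P0 P0'\<close>)
    then obtain z where z: "z $ 0 = \<rho>" "poly P z = 0" by blast
    have "poly ?F (1 + fps_X * z) = fps_X ^ 2 * poly P z"
      by (simp add: F P power_mult_distrib algebra_simps)
    then show ?thesis using z by auto
  qed
  obtain z1 where z1: "z1 $ 0 = \<kappa>" "poly ?F (1 + fps_X * z1) = 0"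
    using lift[OF \<kappa> \<kappa>0] by blast
  obtain z2 where z2: "z2 $ 0 = - \<kappa>" "poly ?F (1 + fps_X * z2) = 0"
    using lift[of "- \<kappa>"] \<kappa> \<kappa>0 by auto
  \<comment> \<open>The last two indices carry the roots through 1. These agree at t = 0 and are
    told apart by their coefficients of t, \<open>\<kappa>\<close> and
    \<open>- \<kappa>\<close>.\<close>
  define \<theta> where "\<theta> i = (if i < m - 2 then r i else if i = m - 2 then 1 + fps_X * z1
    else 1 + fps_X * z2)" for i
  have \<theta>0: "\<theta> i $ 0 = (if i < m - 2 then v i else 1)" for i
    using r(1) by (simp add: \<theta>_def)
  have \<theta>1: "\<theta> (m - 2) $ 1 = \<kappa>" "\<theta> (m - 1) $ 1 = - \<kappa>"
  proof -
    have "\<not> m - 1 < m - 2" "m - 1 \<noteq> m - 2" using m_ge by auto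
    then show "\<theta> (m - 2) $ 1 = \<kappa>" "\<theta> (m - 1) $ 1 = - \<kappa>"
      using z1 z2 unfolding \<theta>_def by simp_all
  qed
  have cases: "i < m - 2 \<or> i = m - 2 \<or> i = m - 1" if "i < m" for i
    using that by linarith
  have inj: "inj_on \<theta> {..<m}"
  proof (rule inj_onI)
    fix i j assume ij: "i \<in> {..<m}" "j \<in> {..<m}" "\<theta> i = \<theta> j"
    show "i = j"
    proof (cases "i < m - 2")
      case True
      then have "j < m - 2" "v i = v j"
        using arg_cong[OF ij(3), of "\<lambda>z. z $ 0"] v1[of i] by (auto simp: \<theta>0 split: if_splits)
      then show ?thesis
        using injv True by (auto simp: inj_on_def)
    next
      case False
      then have "\<not> j < m - 2"
        using arg_cong[OF ij(3), of "\<lambda>z. z $ 0"] v1[of j] by (auto simp: \<theta>0 split: if_splits)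
      then show ?thesis
        using False cases[of i] cases[of j] ij arg_cong[OF ij(3), of "\<lambda>z. z $ 1"] \<theta>1 \<kappa>2
        by (metis lessThan_iff)
    qed
  qed
  have "poly ?F (\<theta> i) = 0" if "i < m" for i
    using r(2) z1 z2 by (simp add: \<theta>_def)
  then have "root_poly {..<m} \<theta> = ?F"
    using inj m_ge by (intro root_poly_eq_of_roots) (auto simp: degree_trinomial coeff_trinomial)
  moreover have "b \<notin> range fps_const"
  proof
    assume "b \<in> range fps_const"
    then obtain c where "b = fps_const c" by auto
    from arg_cong[OF this, of "\<lambda>z. z $ 2"] show False
      by (simp add: b_def)
  qed
  moreover have "a \<in> fps_const ` (- {0})"
    unfolding a_def using M by (intro fps_const_in) auto
  ultimately have arc: "arc \<theta> a b"
    using inj by (simp add: arc_def)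
  \<comment> \<open>\<open>a\<close> and \<open>b\<close> are even in t, so t -> -t permutes the
    roots. It keeps the constant coefficients and negates those of t: the simple roots are fixed,
    the other two exchanged.\<close>
  obtain \<sigma> where \<sigma>: "\<sigma> \<in> stab \<theta>" "\<And>i. i < m \<Longrightarrow> \<theta> (\<sigma> i) = fps_const 1 * fps_subst (- 1) (\<theta> i)"
  proof (rule arc_automorphism[OF arc, of "- 1" 1])
    fix y assume "poly ?F y = 0"
    then have "fps_subst (- 1) (y ^ m + a * y + b) = fps_subst (- 1) 0"
      by (simp add: poly_trinomial)
    moreover have "fps_subst (- 1) a = a" "fps_subst (- 1) b = b"
      by (simp_all add: a_def b_def fps_subst_add fps_subst_power fps_subst_X power_mult_distrib fps_const_power)
    ultimately show "poly ?F (fps_const 1 * fps_subst (- 1) y) = 0"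
      by (simp add: poly_trinomial fps_subst_add fps_subst_mult fps_subst_power)
  qed auto
  have lt: "\<sigma> k < m" if "k < m" for k
    using stab_permutes[OF \<sigma>(1)] that by (simp add: permutes_in_image flip: lessThan_iff)
  have s0: "\<theta> (\<sigma> k) $ 0 = \<theta> k $ 0" and s1: "\<theta> (\<sigma> k) $ 1 = - (\<theta> k $ 1)" if "k < m" for k
    using \<sigma>(2)[OF that] by simp_all
  have small: "\<sigma> k = k" if "k < m - 2" for k
  proof -
    have "k < m" using that by simp
    have "\<sigma> k < m - 2" "v (\<sigma> k) = v k"
      using s0[OF \<open>k < m\<close>] that v1[OF that] by (auto simp: \<theta>0 split: if_splits)
    then show ?thesis
      using injv that by (auto simp: inj_on_def)
  qed
  have large: "\<sigma> k = m - 2 \<or> \<sigma> k = m - 1" if "k = m - 2 \<or> k = m - 1" for k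
  proof -
    have k: "k < m" "\<not> k < m - 2" using that m_ge by auto
    then have "\<not> \<sigma> k < m - 2"
      using s0[OF k(1)] v1[of "\<sigma> k"] by (auto simp: \<theta>0 split: if_splits)
    then show ?thesis using cases[OF lt[OF k(1)]] by blast
  qed
  have "\<theta> (\<sigma> (m - 2)) $ 1 = - \<kappa>" "\<theta> (\<sigma> (m - 1)) $ 1 = \<kappa>"
  proof -
    have "m - 2 < m" "m - 1 < m" using m_ge by auto
    from s1[OF this(1)] s1[OF this(2)] show "\<theta> (\<sigma> (m - 2)) $ 1 = - \<kappa>" "\<theta> (\<sigma> (m - 1)) $ 1 = \<kappa>"
      unfolding \<theta>1 by (simp_all only: minus_minus)
  qed
  then have "\<sigma> (m - 2) \<noteq> m - 2" "\<sigma> (m - 1) \<noteq> m - 1"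
    using \<theta>1 \<kappa>2 by metis+
  then have swap: "\<sigma> (m - 2) = m - 1" "\<sigma> (m - 1) = m - 2"
    using large[of "m - 2"] large[of "m - 1"] by blast+
  have "\<sigma> = transpose (m - 2) (m - 1)"
  proof
    fix k
    consider "k < m - 2" | "k = m - 2" | "k = m - 1" | "k \<notin> {..<m}"
      by fastforce
    then show "\<sigma> k = transpose (m - 2) (m - 1) k"
    proof cases
      case 4
      then have "\<sigma> k = k"
        using stab_permutes[OF \<sigma>(1)] by (simp add: permutes_not_in)
      then show ?thesis using 4 m_ge by (auto simp: transpose_def)
    qed (use small swap m_ge in \<open>auto simp: transpose_def\<close>)
  qed
  then have tr: "transpose (m - 2) (m - 1) \<in> stab \<theta>"
    using \<sigma>(1) by simp
  show thesis
    by (rule that[OF arc _ _ _ tr]) (use m_ge in auto)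
qed

text \<open>\<open>\<eta>\<close> is the branch with the transitive point stabiliser. Transitivity
  and the transposition are imported from the other branches, whose stabilisers are conjugate to
  that of \<open>\<eta>\<close>. A doubly transitive group with one transposition contains all of
  them.\<close>

lemma full_stab:
  obtains \<eta> where "arc \<eta> (- 1) fps_X" "\<And>\<sigma>. \<sigma> permutes {..<m} \<Longrightarrow> \<sigma> \<in> stab \<eta>"
proof -
  obtain \<eta> r where \<eta>: "arc \<eta> (- 1) fps_X" and r: "r < m"
    and fix_r: "\<And>i j. i < m \<Longrightarrow> j < m \<Longrightarrow> i \<noteq> r \<Longrightarrow> j \<noteq> r \<Longrightarrow> \<exists>\<sigma>\<in>stab \<eta>. \<sigma> r = r \<and> \<sigma> i = j"
    by (rule arc_stabiliser_transitive) blast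
  obtain \<theta>1 a1 b1 where \<theta>1: "arc \<theta>1 a1 b1" "\<And>i j. i < m \<Longrightarrow> j < m \<Longrightarrow> \<exists>\<sigma>\<in>stab \<theta>1. \<sigma> i = j"
    by (rule arc_transitive) blast
  obtain \<theta>2 a2 b2 p q where \<theta>2: "arc \<theta>2 a2 b2" "p < m" "q < m" "p \<noteq> q" "transpose p q \<in> stab \<theta>2"
    by (rule arc_transposition)
  have lt: "\<pi> i < m \<longleftrightarrow> i < m" if "\<pi> permutes {..<m}" for \<pi> i
    using permutes_in_image[OF that, of i] by simp
  have trans: "\<exists>\<sigma>\<in>stab \<eta>. \<sigma> i = j" if ij: "i < m" "j < m" for i j
  proof -
    obtain \<pi> where \<pi>: "\<pi> permutes {..<m}" "\<And>d f. hpol m d f \<Longrightarrow> f (\<theta>1 \<circ> \<pi>) = 0 \<longleftrightarrow> f \<eta> = 0"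
      using arcs_conjugate[OF \<eta> \<theta>1(1)] by blast
    obtain \<sigma> where \<sigma>: "\<sigma> \<in> stab \<theta>1" "\<sigma> (\<pi> i) = \<pi> j"
      using \<theta>1(2)[of "\<pi> i" "\<pi> j"] ij lt[OF \<pi>(1)] by auto
    have "inv \<pi> \<circ> \<sigma> \<circ> \<pi> \<in> stab \<eta>"
      by (rule stab_conjugate[where \<theta> = \<theta>1]) (use \<pi> \<sigma>(1) in auto)
    then show ?thesis
      using \<sigma>(2) permutes_inverses(2)[OF \<pi>(1), of j] by (intro bexI) auto
  qed
  obtain \<pi> where \<pi>: "\<pi> permutes {..<m}" "\<And>d f. hpol m d f \<Longrightarrow> f (\<theta>2 \<circ> \<pi>) = 0 \<longleftrightarrow> f \<eta> = 0"
    using arcs_conjugate[OF \<eta> \<theta>2(1)] by blast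
  define i where "i = inv \<pi> p"
  define j where "j = inv \<pi> q"
  have ij: "i < m" "j < m" "i \<noteq> j"
    using lt[OF permutes_inv[OF \<pi>(1)]] \<theta>2 permutes_inv[OF \<pi>(1)]
    by (auto simp: i_def j_def dest: permutes_inj injD)
  have "inv \<pi> \<circ> transpose p q \<circ> \<pi> \<in> stab \<eta>"
    by (rule stab_conjugate[where \<theta> = \<theta>2]) (use \<pi> \<theta>2(5) in auto)
  also have "inv \<pi> \<circ> transpose p q \<circ> \<pi> = transpose i j"
    unfolding i_def j_def o_assoc[symmetric] transpose_comp_eq[OF permutes_bij[OF \<pi>(1)]]
    using permutes_inv_o(2)[OF \<pi>(1)] by (simp add: o_assoc)
  finally have tr: "transpose i j \<in> stab \<eta>" .
  have all: "transpose k l \<in> stab \<eta>" if kl: "k < m" "l < m" "k \<noteq> l" for k l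
  proof -
    \<comment> \<open>Construct an element taking \<open>k\<close> to \<open>i\<close> and
      \<open>l\<close> to \<open>j\<close>: bring \<open>k\<close> and \<open>i\<close> to
      \<open>r\<close>, match the images of \<open>l\<close> and \<open>j\<close> by an element
      fixing \<open>r\<close>, and go back. Conjugation by it turns one transposition into the
      other.\<close>
    obtain \<alpha> where \<alpha>: "\<alpha> \<in> stab \<eta>" "\<alpha> k = r" using trans[OF kl(1) r] by blast
    obtain \<beta> where \<beta>: "\<beta> \<in> stab \<eta>" "\<beta> i = r" using trans[OF ij(1) r] by blast
    have "\<alpha> l \<noteq> r" "\<beta> j \<noteq> r"
      using permutes_inj[OF stab_permutes[OF \<alpha>(1)]] permutes_inj[OF stab_permutes[OF \<beta>(1)]]
        \<alpha>(2) \<beta>(2) kl ij by (metis injD)+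
    moreover have "\<alpha> l < m" "\<beta> j < m"
      using lt[OF stab_permutes[OF \<alpha>(1)]] lt[OF stab_permutes[OF \<beta>(1)]] kl ij by auto
    ultimately obtain \<gamma> where \<gamma>: "\<gamma> \<in> stab \<eta>" "\<gamma> r = r" "\<gamma> (\<alpha> l) = \<beta> j"
      using fix_r by blast
    define \<sigma> where "\<sigma> = inv \<beta> \<circ> \<gamma> \<circ> \<alpha>"
    have \<sigma>: "\<sigma> \<in> stab \<eta>"
      unfolding \<sigma>_def by (intro stab_comp stab_inv \<alpha> \<beta> \<gamma>)
    have "\<sigma> k = i" "\<sigma> l = j"
      using \<alpha>(2) \<gamma>(2,3) \<beta>(2) permutes_inverses(2)[OF stab_permutes[OF \<beta>(1)]]
      by (auto simp: \<sigma>_def) (metis \<beta>(2))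
    then have inv: "inv \<sigma> i = k" "inv \<sigma> j = l"
      using permutes_inverses(2)[OF stab_permutes[OF \<sigma>]] by auto
    have "inv \<sigma> \<circ> (transpose i j \<circ> \<sigma>) \<in> stab \<eta>"
      by (intro stab_comp stab_inv \<sigma> tr)
    also have "inv \<sigma> \<circ> (transpose i j \<circ> \<sigma>) = transpose k l"
      unfolding transpose_comp_eq[OF permutes_bij[OF stab_permutes[OF \<sigma>]]] inv
      using permutes_inv_o(2)[OF stab_permutes[OF \<sigma>]] by (simp add: o_assoc)
    finally show ?thesis .
  qed
  have "\<sigma> \<in> stab \<eta>" if "\<sigma> permutes {..<m}" for \<sigma>
    using that finite_lessThan
  proof (induction rule: permutes_induct)
    case id
    show ?case by (rule stab_id)
  next
    case (swap a b p)
    then show ?case by (intro stab_comp all) auto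
  qed
  with \<eta> show thesis by (rule that)
qed

section \<open>Forms on the cone: radical ideal, primality, finitely many zeros\<close>

text \<open>The points over K with distinct coordinates are generic, so vanishing there already puts
  a form into the ideal of the power sums at every point, including those with power series
  coordinates.\<close>

lemma hpol_vanishing:
  fixes f :: "'a pt \<Rightarrow> 'a fps"
  assumes f: "hpol m d f"
    and 0: "\<And>v. const_pt v \<in> ps_cone m \<Longrightarrow> inj_on v {..<m} \<Longrightarrow> f (const_pt v) = 0"
  shows "f \<in> ps_null m"
proof (rule generic_vanishing[OF generic_const_pts _ hpol_in_tower[OF f]])
  fix x :: "'a pt" assume "x \<in> {x \<in> ps_cone m. x \<in> range const_pt \<and> inj_on x {..<m}}"
  then obtain v where v: "x = const_pt v" "x \<in> ps_cone m" "inj_on x {..<m}" by auto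
  then have "inj_on v {..<m}"
    by (auto simp: inj_on_def const_pt_def)
  then show "f x = 0" using 0 v by blast
qed simp

text \<open>K[[t]] is a domain, so one factor vanishes at \<eta>. As every permutation stabilises
  \<eta>, this factor vanishes at all rearrangements of \<eta>, hence is null.\<close>

lemma hpol_null_prime:
  fixes f g :: "'a pt \<Rightarrow> 'a fps"
  assumes f: "hpol m d f" and g: "hpol m e g" and fg: "(\<lambda>x. f x * g x) \<in> ps_null m"
  shows "f \<in> ps_null m \<or> g \<in> ps_null m"
proof -
  obtain \<eta> where \<eta>: "arc \<eta> (- 1) fps_X" "\<And>\<sigma>. \<sigma> permutes {..<m} \<Longrightarrow> \<sigma> \<in> stab \<eta>"
    using full_stab by blast
  have null: "h \<in> ps_null m" if h: "hpol m k h" "h \<eta> = 0" for h k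
    by (rule arc_vanishing[OF \<eta>(1) h(1)]) (use stabD[OF \<eta>(2) h(1)] h(2) in blast)
  have "f \<eta> * g \<eta> = 0"
    using ps_null_cone[OF fg arc_in_cone[OF \<eta>(1)]] .
  then show ?thesis
    using null[OF f] null[OF g] by auto
qed

lemma const_pt_cone:
  assumes "const_pt v \<in> ps_cone m"
  obtains a b where "root_poly {..<m} v = trinomial m a b"
proof
  have "map_poly fps_const (root_poly {..<m} v)
    = trinomial m (ecoeff m 1 (const_pt v)) (ecoeff m 0 (const_pt v))"
    using root_poly_cone[OF assms] by (simp add: const_pt_def root_poly_const)
  then have eq: "fps_const (coeff (root_poly {..<m} v) k)
    = coeff (trinomial m (ecoeff m 1 (const_pt v)) (ecoeff m 0 (const_pt v))) k" for k
    by (metis coeff_map_poly fps_const_0_eq_0)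
  show "root_poly {..<m} v = trinomial m (coeff (root_poly {..<m} v) 1) (coeff (root_poly {..<m} v) 0)"
  proof (rule poly_eqI)
    fix k
    show "coeff (root_poly {..<m} v) k
      = coeff (trinomial m (coeff (root_poly {..<m} v) 1) (coeff (root_poly {..<m} v) 0)) k"
      using eq[of k] m_ge by (auto simp: coeff_trinomial split: if_splits)
  qed
qed

lemma root_poly_scale_trinomial:
  fixes v :: "nat \<Rightarrow> 'a"
  assumes v: "root_poly {..<m} v = trinomial m a b" and c: "c \<noteq> 0"
  shows "root_poly {..<m} (\<lambda>i. c * v i) = trinomial m (c ^ (m - 1) * a) (c ^ m * b)"
proof (rule poly_eqI)
  fix k
  have "c ^ k * coeff (root_poly {..<m} (\<lambda>i. c * v i)) k = c ^ m * coeff (trinomial m a b) k"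
    using coeff_root_poly_scale[of "{..<m}" c k v] by (simp add: v)
  also have "\<dots> = c ^ k * coeff (trinomial m (c ^ (m - 1) * a) (c ^ m * b)) k"
    using m_ge power_Suc[of c "m - 1"] by (auto simp: coeff_trinomial)
  finally show "coeff (root_poly {..<m} (\<lambda>i. c * v i)) k
    = coeff (trinomial m (c ^ (m - 1) * a) (c ^ m * b)) k"
    using c by simp
qed

lemma finite_root_vectors:
  fixes p :: "'a poly"
  assumes "p \<noteq> 0"
  shows "finite {v \<in> coord_space m. root_poly {..<m} v = p}"
proof (rule finite_subset)
  show "{v \<in> coord_space m. root_poly {..<m} v = p}
    \<subseteq> {v. \<forall>i. (i \<in> {..<m} \<longrightarrow> v i \<in> {z. poly p z = 0}) \<and> (i \<notin> {..<m} \<longrightarrow> v i = 0)}"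
    by (auto simp: coord_space_def poly_root_poly_root)
  show "finite {v. \<forall>i. (i \<in> {..<m} \<longrightarrow> v i \<in> {z. poly p z = 0}) \<and> (i \<notin> {..<m} \<longrightarrow> v i = 0)}"
    using poly_roots_finite[OF assms] by (intro finite_set_of_finite_funs) auto
qed

text \<open>A nonzero point can be scaled to a = 1, or to a = 0 and b = 1. For a = 1 the norm of
  \<open>f\<close> becomes a polynomial in b alone, and each of its roots belongs to finitely many
  coordinate vectors.\<close>

lemma hpol_finite_zeros:
  fixes f :: "'a pt \<Rightarrow> 'a fps"
  assumes f: "hpol m d f" and nonnull: "f \<notin> ps_null m"
  obtains S where "finite S" "\<And>v. v \<in> coord_space m \<Longrightarrow> v \<noteq> 0 \<Longrightarrow> const_pt v \<in> ps_cone m \<Longrightarrow>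
    f (const_pt v) = 0 \<Longrightarrow> \<exists>c. c \<noteq> 0 \<and> scale_fun c v \<in> S"
proof -
  obtain \<eta> where \<eta>: "arc \<eta> (- 1) fps_X" "\<And>\<sigma>. \<sigma> permutes {..<m} \<Longrightarrow> \<sigma> \<in> stab \<eta>"
    using full_stab by blast
  have f\<eta>: "f (\<eta> \<circ> \<sigma>) \<noteq> 0" if "\<sigma> permutes {..<m}" for \<sigma>
  proof
    assume "f (\<eta> \<circ> \<sigma>) = 0"
    then have "f \<eta> = 0" using stabD[OF \<eta>(2)[OF that] f] by blast
    then have "f \<in> ps_null m"
      using stabD[OF \<eta>(2) f] by (intro arc_vanishing[OF \<eta>(1) f]) blast
    then show False using nonnull by blast
  qed
  obtain n L where n: "n \<in> tower m 0" and L: "id \<in> set L" "\<And>\<sigma>. \<sigma> \<in> set L \<Longrightarrow> \<sigma> permutes {..<m}"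
    and nL: "\<And>x. x \<in> ps_cone m \<Longrightarrow> n x = (\<Prod>\<sigma>\<leftarrow>L. f (x \<circ> \<sigma>))"
    using tower_norm[OF hpol_in_tower[OF f], of 0] by auto
  obtain g h where gh: "g \<in> base_ring m" "h \<in> ps_null m" "n = g + h"
    using n by (elim tower_0E)
  obtain H e where H: "\<And>x. g x = (\<Sum>i\<le>e. fps_eval (H i) (ecoeff m 0 x) * ecoeff m 1 x ^ i)"
    using base_ringE[OF gh(1)] by blast
  \<comment> \<open>The norm restricted to a = 1, as a polynomial in b.\<close>
  define q where "q = (\<Sum>i\<le>e. H i)"
  have nq: "n x = fps_eval q (ecoeff m 0 x)" if "x \<in> ps_cone m" "ecoeff m 1 x = 1" for x
    using that ps_null_cone[OF gh(2)] by (simp add: gh(3) H q_def fps_eval_sum)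
  have "q \<noteq> 0"
  proof
    assume "q = 0"
    \<comment> \<open>Scaling by \<open>c\<close> takes \<eta> from a = -1 to a = 1, where no factor
      of the norm vanishes.\<close>
    obtain c where c: "c ^ (m - 1) = (- 1 :: 'a)"
      using nth_root_exists[of "m - 1" "- 1 :: 'a"] m_ge by auto
    then have "c \<noteq> 0" using m_ge by (auto simp: power_0_left)
    define x where "x = (\<lambda>i. fps_const c * \<eta> i)"
    have x: "x \<in> ps_cone m"
      unfolding x_def by (rule cone_scale[OF arc_in_cone[OF \<eta>(1)]])
    have "ecoeff m 1 \<eta> = - 1"
      using \<eta>(1) cone_trinomial(3)[of \<eta> "- 1" fps_X] by (simp add: arc_def)
    moreover have "c ^ m = - c"
      using m_ge c power_Suc[of c "m - 1"] by simp
    ultimately have "fps_const c * ecoeff m 1 x = fps_const c * 1"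
      unfolding x_def ecoeff_scale by (simp add: fps_const_power flip: fps_const_neg)
    then have "ecoeff m 1 x = 1" using \<open>c \<noteq> 0\<close> by simp
    then have "n x = 0" using nq[OF x] \<open>q = 0\<close> by simp
    then have "0 \<in> set (map (\<lambda>\<sigma>. f (x \<circ> \<sigma>)) L)"
      using nL[OF x] by (simp only: prod_list_zero_iff)
    then obtain \<sigma> where \<sigma>: "\<sigma> \<in> set L" "f (x \<circ> \<sigma>) = 0" by auto
    have "f (x \<circ> \<sigma>) = fps_const c ^ d * f (\<eta> \<circ> \<sigma>)"
      using hpol_scale[OF f, of "fps_const c" "\<eta> \<circ> \<sigma>"] by (simp add: x_def o_def)
    then show False
      using \<sigma>(2) f\<eta>[OF L(2)[OF \<sigma>(1)]] \<open>c \<noteq> 0\<close> by simp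
  qed
  define T where "T p = {v \<in> coord_space m. root_poly {..<m} v = (p :: 'a poly)}" for p
  define S where "S = T (trinomial m 0 1) \<union> (\<Union>\<beta>\<in>{\<beta>. poly q \<beta> = 0}. T (trinomial m 1 \<beta>))"
  have "trinomial m a b \<noteq> 0" for a b :: 'a
    using degree_trinomial[of m a b] m_ge by force
  then have "finite S"
    unfolding S_def T_def using poly_roots_finite[OF \<open>q \<noteq> 0\<close>]
    by (intro finite_UnI finite_UN_I finite_root_vectors)
  moreover have "\<exists>c. c \<noteq> 0 \<and> scale_fun c v \<in> S"
    if v: "v \<in> coord_space m" "v \<noteq> 0" "const_pt v \<in> ps_cone m" "f (const_pt v) = 0" for v
  proof -
    obtain a b where ab: "root_poly {..<m} v = trinomial m a b"
      using const_pt_cone[OF v(3)] .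
    have space: "scale_fun c v \<in> coord_space m" for c
      using v(1) by (simp add: coord_space_def scale_fun_def)
    show ?thesis
    proof (cases "a = 0")
      case True
      have "b \<noteq> 0"
      proof
        assume "b = 0"
        have "v i = 0" if "i < m" for i
        proof -
          have "v i ^ m = 0"
            using poly_root_poly_root[of "{..<m}" i v] that by (simp add: ab poly_trinomial True \<open>b = 0\<close>)
          then show ?thesis by simp
        qed
        then have "v = 0"
          using v(1) by (auto simp: fun_eq_iff coord_space_def) (metis not_le)
        then show False using v(2) by simp
      qed
      obtain c where c: "c ^ m = 1 / b"
        using nth_root_exists[of m "1 / b"] m_ge by auto
      then have "c \<noteq> 0" using \<open>b \<noteq> 0\<close> m_ge by (auto simp: power_0_left)
      then have "scale_fun c v \<in> S"
        using root_poly_scale_trinomial[OF ab] c \<open>b \<noteq> 0\<close> True space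
        by (simp add: S_def T_def scale_fun_def)
      then show ?thesis using \<open>c \<noteq> 0\<close> by blast
    next
      case False
      obtain c where c: "c ^ (m - 1) = 1 / a"
        using nth_root_exists[of "m - 1" "1 / a"] m_ge by auto
      then have "c \<noteq> 0" using False m_ge by (auto simp: power_0_left)
      let ?w = "scale_fun c v"
      have rw: "root_poly {..<m} ?w = trinomial m 1 (c ^ m * b)"
        using root_poly_scale_trinomial[OF ab \<open>c \<noteq> 0\<close>] c False by (simp add: scale_fun_def)
      note w = cone_trinomial[OF const_pt_trinomial[OF rw]]
      have "const_pt ?w = (\<lambda>i. fps_const c * const_pt v i)"
        by (simp add: const_pt_def scale_fun_def fun_eq_iff)
      then have "f (const_pt ?w) = 0"
        using hpol_scale[OF f, of "fps_const c" "const_pt v"] v(4) by simp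
      then have "n (const_pt ?w) = 0"
        using nL[OF w(1)] L(1) by (auto simp: prod_list_zero_iff intro!: image_eqI[of _ _ id])
      then have "poly q (c ^ m * b) = 0"
        using nq[OF w(1)] w(2,3) by (simp add: fps_eval_const)
      then have "?w \<in> S"
        using rw space by (auto simp: S_def T_def)
      then show ?thesis using \<open>c \<noteq> 0\<close> by blast
    qed
  qed
  ultimately show thesis by (rule that)
qed

end

subsection \<open>Evaluation of multivariate polynomials\<close>

abbreviation (input) "keys \<equiv> Poly_Mapping.keys"
abbreviation (input) "lookup \<equiv> Poly_Mapping.lookup"
abbreviation (input) "single \<equiv> Poly_Mapping.single"

definition mon_eval :: "(nat \<Rightarrow> 'b::comm_ring_1) \<Rightarrow> (nat \<Rightarrow>\<^sub>0 nat) \<Rightarrow> 'b" where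
  "mon_eval v \<mu> = (\<Prod>i\<in>keys \<mu>. v i ^ lookup \<mu> i)"

text \<open>Counterpart of \<open>mv_eval\<close> with values in K[[t]], which is not a
  field.\<close>

definition fps_mv_eval :: "'a::field mvpoly \<Rightarrow> (nat \<Rightarrow> 'a fps) \<Rightarrow> 'a fps" where
  "fps_mv_eval F v = (\<Sum>\<mu>\<in>keys F. fps_const (lookup F \<mu>) * mon_eval v \<mu>)"

definition homog :: "nat \<Rightarrow> nat \<Rightarrow> 'a::field mvpoly \<Rightarrow> bool" where
  "homog n d F \<longleftrightarrow> (\<forall>\<mu>\<in>keys F. keys \<mu> \<subseteq> {..n} \<and>
     (\<Sum>i\<in>keys \<mu>. lookup \<mu> i) = d)"

lemma hom_polys_homog: "F \<in> hom_polys n \<longleftrightarrow> (\<exists>d. homog n d F)"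
  by (simp add: hom_polys_def homog_def)

lemma mon_eval_superset:
  assumes "finite S" "keys \<mu> \<subseteq> S"
  shows "mon_eval v \<mu> = (\<Prod>i\<in>S. v i ^ lookup \<mu> i)"
  unfolding mon_eval_def using assms
  by (intro prod.mono_neutral_left) (auto simp: in_keys_iff)

lemma mon_eval_add: "mon_eval v (\<mu> + \<nu>) = mon_eval v \<mu> * mon_eval v \<nu>"
proof -
  let ?S = "keys \<mu> \<union> keys \<nu>"
  have "mon_eval v (\<mu> + \<nu>) = (\<Prod>i\<in>?S. v i ^ lookup (\<mu> + \<nu>) i)"
    using keys_add[of \<mu> \<nu>] by (intro mon_eval_superset) auto
  then show ?thesis
    by (simp add: lookup_add power_add prod.distrib mon_eval_superset[of ?S])
qed

lemma mon_eval_single [simp]: "mon_eval v (single i k) = v i ^ k"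
  by (simp add: mon_eval_def)

lemma fps_mv_eval_superset:
  assumes "finite S" "keys F \<subseteq> S"
  shows "fps_mv_eval F v = (\<Sum>\<mu>\<in>S. fps_const (lookup F \<mu>) * mon_eval v \<mu>)"
  unfolding fps_mv_eval_def using assms
  by (intro sum.mono_neutral_left) (auto simp: in_keys_iff)

lemma fps_mv_eval_add: "fps_mv_eval (F + G) v = fps_mv_eval F v + fps_mv_eval G v"
proof -
  let ?S = "keys F \<union> keys G"
  have "fps_mv_eval (F + G) v
    = (\<Sum>\<mu>\<in>?S. fps_const (lookup (F + G) \<mu>) * mon_eval v \<mu>)"
    using keys_add[of F G] by (intro fps_mv_eval_superset) auto
  then show ?thesis
    by (simp add: lookup_add sum.distrib distrib_right fps_mv_eval_superset[of ?S] flip: fps_const_add)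
qed

lemma fps_mv_eval_sum: "fps_mv_eval (\<Sum>i\<in>I. F i) v = (\<Sum>i\<in>I. fps_mv_eval (F i) v)"
  by (induction I rule: infinite_finite_induct) (auto simp: fps_mv_eval_add fps_mv_eval_def[of 0])

lemma fps_mv_eval_single [simp]: "fps_mv_eval (single \<mu> c) v = fps_const c * mon_eval v \<mu>"
  by (simp add: fps_mv_eval_def)

lemma mvpoly_sum_single:
  "F = (\<Sum>\<mu>\<in>keys F. single \<mu> (lookup F \<mu>))"
  by (rule poly_mapping_eqI) (simp add: lookup_sum lookup_single when_def in_keys_iff)

lemma fps_mv_eval_mult: "fps_mv_eval (F * G) v = fps_mv_eval F v * fps_mv_eval G v"
proof -
  have "F * G = (\<Sum>\<mu>\<in>keys F. \<Sum>\<nu>\<in>keys G.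
    single (\<mu> + \<nu>) (lookup F \<mu> * lookup G \<nu>))"
    by (subst (1) mvpoly_sum_single[of F], subst (1) mvpoly_sum_single[of G])
      (simp add: sum_product mult_single)
  then have "fps_mv_eval (F * G) v = (\<Sum>\<mu>\<in>keys F. \<Sum>\<nu>\<in>keys G.
    (fps_const (lookup F \<mu>) * mon_eval v \<mu>) * (fps_const (lookup G \<nu>) * mon_eval v \<nu>))"
    by (simp add: fps_mv_eval_sum mon_eval_add mult_ac flip: fps_const_mult)
  then show ?thesis
    by (simp add: fps_mv_eval_def sum_product)
qed

lemma fps_mv_eval_1 [simp]: "fps_mv_eval 1 v = 1"
  using fps_mv_eval_single[of 0 1 v] by (simp add: mon_eval_def)

lemma fps_mv_eval_power: "fps_mv_eval (F ^ k) v = fps_mv_eval F v ^ k"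
  by (induction k) (simp_all add: fps_mv_eval_mult)

lemma fps_mv_eval_prod: "fps_mv_eval (\<Prod>i\<in>I. F i) v = (\<Prod>i\<in>I. fps_mv_eval (F i) v)"
  by (induction I rule: infinite_finite_induct) (auto simp: fps_mv_eval_mult)

lemma mon_eval_const: "mon_eval (\<lambda>i. fps_const (v i)) \<mu> = fps_const (mon_eval v \<mu>)"
proof -
  have "(\<Prod>i\<in>I. fps_const (v i) ^ e i) = fps_const (\<Prod>i\<in>I. v i ^ e i)" for I e
    by (induction I rule: infinite_finite_induct) (auto simp: fps_const_power)
  then show ?thesis by (simp add: mon_eval_def)
qed

lemma fps_const_sum: "fps_const (\<Sum>i\<in>I. f i) = (\<Sum>i\<in>I. fps_const (f i))"
  by (induction I rule: infinite_finite_induct) (auto simp flip: fps_const_add)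

lemma fps_const_prod: "fps_const (\<Prod>i\<in>I. f i) = (\<Prod>i\<in>I. fps_const (f i))"
  by (induction I rule: infinite_finite_induct) (auto simp flip: fps_const_mult)

lemma mv_eval_mon_eval:
  "mv_eval F v = (\<Sum>\<mu>\<in>keys F. lookup F \<mu> * mon_eval v \<mu>)"
  by (simp add: mv_eval_def mon_eval_def)

lemma fps_mv_eval_const: "fps_mv_eval F (\<lambda>i. fps_const (v i)) = fps_const (mv_eval F v)"
  by (simp add: fps_mv_eval_def mv_eval_mon_eval mon_eval_const fps_const_sum)

text \<open>\<open>fps_const\<close> is injective, so that the rules for power series descend to
  K.\<close>

lemma mv_eval_mult: "mv_eval (F * G) v = mv_eval F v * mv_eval G v"
  and mv_eval_sum: "mv_eval (\<Sum>i\<in>I. H i) v = (\<Sum>i\<in>I. mv_eval (H i) v)"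
  and mv_eval_prod: "mv_eval (\<Prod>i\<in>I. H i) v = (\<Prod>i\<in>I. mv_eval (H i) v)"
  and mv_eval_power: "mv_eval (F ^ k) v = mv_eval F v ^ k"
  and mv_eval_single: "mv_eval (single \<mu> c) v = c * mon_eval v \<mu>"
proof -
  have *: "x = y" if "fps_const x = fps_const y" for x y :: 'a
    using that by simp
  show "mv_eval (F * G) v = mv_eval F v * mv_eval G v"
    by (rule *) (simp add: fps_mv_eval_mult flip: fps_mv_eval_const fps_const_mult)
  show "mv_eval (\<Sum>i\<in>I. H i) v = (\<Sum>i\<in>I. mv_eval (H i) v)"
    by (rule *) (simp add: fps_mv_eval_sum fps_const_sum flip: fps_mv_eval_const)
  show "mv_eval (\<Prod>i\<in>I. H i) v = (\<Prod>i\<in>I. mv_eval (H i) v)"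
    by (rule *) (simp add: fps_mv_eval_prod fps_const_prod flip: fps_mv_eval_const)
  show "mv_eval (F ^ k) v = mv_eval F v ^ k"
    by (rule *) (simp add: fps_mv_eval_power flip: fps_mv_eval_const fps_const_power)
  show "mv_eval (single \<mu> c) v = c * mon_eval v \<mu>"
    by (simp add: mv_eval_mon_eval)
qed

subsection \<open>Homogeneous polynomials\<close>

lemma homog_single:
  "keys \<mu> \<subseteq> {..n} \<Longrightarrow> homog n (\<Sum>i\<in>keys \<mu>. lookup \<mu> i) (single \<mu> c)"
  by (simp add: homog_def)

lemma homog_add: "homog n d F \<Longrightarrow> homog n d G \<Longrightarrow> homog n d (F + G)"
  unfolding homog_def using keys_add[of F G] by blast

lemma homog_sum: "(\<And>i. i \<in> I \<Longrightarrow> homog n d (F i)) \<Longrightarrow> homog n d (\<Sum>i\<in>I. F i)"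
  by (induction I rule: infinite_finite_induct) (auto simp: homog_add homog_def[of _ _ 0])

lemma degree_superset:
  assumes "finite S" "keys \<mu> \<subseteq> S"
  shows "(\<Sum>i\<in>keys \<mu>. lookup \<mu> i) = (\<Sum>i\<in>S. lookup \<mu> i)"
  using assms by (intro sum.mono_neutral_left) (auto simp: in_keys_iff)

lemma homog_mult:
  assumes "homog n d F" "homog n e G"
  shows "homog n (d + e) (F * G)"
  unfolding homog_def
proof
  fix \<mu> assume "\<mu> \<in> keys (F * G)"
  then obtain a b where ab: "\<mu> = a + b" "a \<in> keys F" "b \<in> keys G"
    using keys_mult[of F G] by blast
  have sub: "keys a \<subseteq> {..n}" "keys b \<subseteq> {..n}"
    and deg: "(\<Sum>i\<le>n. lookup a i) = d" "(\<Sum>i\<le>n. lookup b i) = e"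
    using assms ab(2,3) degree_superset[of "{..n}" a] degree_superset[of "{..n}" b]
    by (auto simp: homog_def)
  have "keys \<mu> \<subseteq> {..n}"
    using keys_add[of a b] sub ab(1) by blast
  then show "keys \<mu> \<subseteq> {..n} \<and>
    (\<Sum>i\<in>keys \<mu>. lookup \<mu> i) = d + e"
    using deg degree_superset[of "{..n}" \<mu>] by (simp add: ab(1) lookup_add sum.distrib)
qed

lemma homog_1: "homog n 0 1"
  by (simp add: homog_def)

lemma homog_power: "homog n d F \<Longrightarrow> homog n (k * d) (F ^ k)"
  by (induction k) (simp_all add: homog_1 homog_mult)

lemma hom_polys_mult: "F \<in> hom_polys n \<Longrightarrow> G \<in> hom_polys n \<Longrightarrow> F * G \<in> hom_polys n"
  unfolding hom_polys_homog using homog_mult by blast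

lemma hom_polys_prod: "(\<And>i. i \<in> I \<Longrightarrow> F i \<in> hom_polys n) \<Longrightarrow> (\<Prod>i\<in>I. F i) \<in> hom_polys n"
  by (induction I rule: infinite_finite_induct)
    (auto simp: hom_polys_mult intro: homog_1[THEN exI[of "\<lambda>d. homog n d 1"]] simp: hom_polys_homog[of 1])

definition linear_form :: "nat \<Rightarrow> (nat \<Rightarrow> 'a::field) \<Rightarrow> 'a mvpoly" where
  "linear_form n c = (\<Sum>j\<le>n. single (single j 1) (c j))"

lemma homog_linear_form: "homog n 1 (linear_form n c)"
  unfolding linear_form_def
proof (rule homog_sum)
  fix j assume "j \<in> {..n}"
  then show "homog n 1 (single (single j 1) (c j))"
    using homog_single[of "single j 1" n "c j"] by simp
qed

lemma fps_mv_eval_linear_form: "fps_mv_eval (linear_form n c) v = (\<Sum>j\<le>n. fps_const (c j) * v j)"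
  by (simp add: linear_form_def fps_mv_eval_sum)

lemma mv_eval_linear_form: "mv_eval (linear_form n c) v = (\<Sum>j\<le>n. c j * v j)"
  by (simp add: linear_form_def mv_eval_sum mv_eval_single)

lemma mv_eval_scale:
  assumes "homog n d F"
  shows "mv_eval F (scale_fun c v) = c ^ d * mv_eval F v"
proof -
  have "mon_eval (scale_fun c v) \<mu> = c ^ d * mon_eval v \<mu>" if "\<mu> \<in> keys F" for \<mu>
  proof -
    have "(\<Sum>i\<in>keys \<mu>. lookup \<mu> i) = d"
      using assms that by (simp add: homog_def)
    then show ?thesis
      by (simp add: mon_eval_def scale_fun_def power_mult_distrib prod.distrib flip: power_sum)
  qed
  then show ?thesis
    by (simp add: mv_eval_mon_eval sum_distrib_left mult_ac)
qed

lemma fps_line_power: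
  "(fps_const a + fps_const b * fps_X) ^ e $ 0 = (a :: 'a::comm_ring_1) ^ e"
  "(fps_const a + fps_const b * fps_X) ^ e $ 1 = of_nat e * a ^ (e - 1) * b"
proof -
  let ?z = "fps_const a + fps_const b * fps_X"
  show *: "?z ^ e $ 0 = a ^ e" for e
    by (simp add: fps_power_zeroth)
  show "?z ^ e $ 1 = of_nat e * a ^ (e - 1) * b"
  proof (induction e)
    case (Suc e)
    have "?z ^ Suc e $ 1 = a * (?z ^ e $ 1) + b * (?z ^ e $ 0)"
      by (simp add: fps_mult_nth)
    also have "\<dots> = of_nat (Suc e) * a ^ e * b"
      unfolding Suc.IH * by (cases e) (simp_all add: algebra_simps)
    finally show ?case by simp
  qed simp
qed

lemma mon_eval_line:
  "mon_eval (\<lambda>i. fps_const (w i) + fps_const (u i) * fps_X) \<mu> $ 0 = mon_eval w \<mu>"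
  "mon_eval (\<lambda>i. fps_const (w i) + fps_const (u i) * fps_X) \<mu> $ 1
    = (\<Sum>i\<in>keys \<mu>. of_nat (lookup \<mu> i)
        * mon_eval w (\<mu> - single i 1) * u i)"
proof -
  let ?z = "\<lambda>i. fps_const (w i) + fps_const (u i) * fps_X"
  have p: "(?z i ^ e) $ 0 = w i ^ e" "(?z i ^ e) $ 1 = of_nat e * w i ^ (e - 1) * u i" for i e
    by (simp_all only: fps_line_power)
  have prod: "(\<Prod>i\<in>I. ?z i ^ e i) $ 0 = (\<Prod>i\<in>I. w i ^ e i) \<and>
    (\<Prod>i\<in>I. ?z i ^ e i) $ 1 = (\<Sum>i\<in>I. of_nat (e i) * (w i ^ (e i - 1) * (\<Prod>j\<in>I - {i}. w j ^ e j)) * u i)"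
    if "finite I" for I e
    using that
  proof induction
    case (insert a I)
    have "(\<Prod>j\<in>insert a I - {i}. w j ^ e j) = w a ^ e a * (\<Prod>j\<in>I - {i}. w j ^ e j)" if "i \<in> I" for i
    proof -
      have "insert a I - {i} = insert a (I - {i})" using that insert by auto
      then show ?thesis using insert by simp
    qed
    moreover have "insert a I - {a} = I" using insert by auto
    ultimately show ?case
      using insert p
      by (simp add: fps_mult_nth sum_distrib_left mult_ac)
  qed simp
  show "mon_eval ?z \<mu> $ 0 = mon_eval w \<mu>"
    unfolding mon_eval_def using prod[of "keys \<mu>" "lookup \<mu>"] by simp
  have "mon_eval w (\<mu> - single i 1) = w i ^ (lookup \<mu> i - 1)
      * (\<Prod>j\<in>keys \<mu> - {i}. w j ^ lookup \<mu> j)"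
    if "i \<in> keys \<mu>" for i
  proof -
    have "mon_eval w (\<mu> - single i 1)
      = (\<Prod>j\<in>keys \<mu>. w j ^ lookup (\<mu> - single i 1) j)"
      by (rule mon_eval_superset) (auto simp: in_keys_iff lookup_minus)
    also have "\<dots> = w i ^ (lookup \<mu> i - 1)
      * (\<Prod>j\<in>keys \<mu> - {i}. w j ^ lookup \<mu> j)"
      using that by (simp add: prod.remove[of _ i] lookup_minus lookup_single when_def)
    finally show ?thesis .
  qed
  then show "mon_eval ?z \<mu> $ 1 = (\<Sum>i\<in>keys \<mu>. of_nat (lookup \<mu> i)
        * mon_eval w (\<mu> - single i 1) * u i)"
    unfolding mon_eval_def[of ?z] using prod[of "keys \<mu>" "lookup \<mu>"] by simp
qed

text \<open>Modulo t^2 power series are dual numbers, so the coefficient of t along the line w + tu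
  is the derivative in the direction u. This ties the formal \<open>mv_deriv\<close> to values at
  points.\<close>

lemma fps_mv_eval_line:
  assumes "homog n d F"
  shows "fps_mv_eval F (\<lambda>i. fps_const (w i) + fps_const (u i) * fps_X) $ 1
    = (\<Sum>i\<le>n. gradient n F w i * u i)"
proof -
  let ?z = "\<lambda>i. fps_const (w i) + fps_const (u i) * fps_X"
  have "fps_mv_eval F ?z $ 1 = (\<Sum>\<mu>\<in>keys F. lookup F \<mu> * mon_eval ?z \<mu> $ 1)"
    by (simp add: fps_mv_eval_def fps_sum_nth)
  also have "\<dots> = (\<Sum>\<mu>\<in>keys F. \<Sum>i\<le>n. of_nat (lookup \<mu> i) * lookup F \<mu>
        * mon_eval w (\<mu> - single i 1) * u i)"
  proof (rule sum.cong[OF refl])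
    fix \<mu> assume \<mu>: "\<mu> \<in> keys F"
    have "mon_eval ?z \<mu> $ 1 = (\<Sum>i\<le>n. of_nat (lookup \<mu> i)
        * mon_eval w (\<mu> - single i 1) * u i)"
      unfolding mon_eval_line
      using \<mu> assms by (intro sum.mono_neutral_left) (auto simp: homog_def in_keys_iff)
    then show "lookup F \<mu> * mon_eval ?z \<mu> $ 1 = (\<Sum>i\<le>n. of_nat (lookup \<mu> i)
        * lookup F \<mu> * mon_eval w (\<mu> - single i 1) * u i)"
      by (simp add: sum_distrib_left mult_ac)
  qed
  also have "\<dots> = (\<Sum>i\<le>n. gradient n F w i * u i)"
    by (subst sum.swap)
      (simp add: gradient_def mv_deriv_def mv_eval_sum mv_eval_single sum_distrib_right)
  finally show ?thesis .
qed

subsection \<open>Projective varieties\<close>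

lemma coord_space_0: "0 \<in> coord_space k"
  by (simp add: coord_space_def)

lemma scale_coord_space: "w \<in> coord_space k \<Longrightarrow> scale_fun c w \<in> coord_space k"
  by (simp add: coord_space_def scale_fun_def)

definition unit :: "nat \<Rightarrow> nat \<Rightarrow> 'a::field" where
  "unit j = (\<lambda>i. if i = j then 1 else 0)"

lemma coord_space_expand:
  assumes "w \<in> coord_space k"
  shows "w = (\<Sum>j<k. scale_fun (w j) (unit j))"
proof
  fix i
  have "(\<Sum>j<k. scale_fun (w j) (unit j)) i = (\<Sum>j<k. if j = i then w j else 0)"
    unfolding sum_fun_apply by (intro sum.cong) (auto simp: scale_fun_def unit_def)
  then show "w i = (\<Sum>j<k. scale_fun (w j) (unit j)) i"
    using assms by (simp add: coord_space_def)
qed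

lemma linear_coord_space_expand:
  assumes "Vector_Spaces.linear scale_fun scale_fun f" "w \<in> coord_space k"
  shows "f w i = (\<Sum>j<k. f (unit j) i * w j)"
proof -
  interpret f: Vector_Spaces.linear scale_fun scale_fun f by fact
  have "f w = (\<Sum>j<k. scale_fun (w j) (f (unit j)))"
    by (subst coord_space_expand[OF assms(2)]) (simp only: f.sum f.scale)
  then show ?thesis
    by (simp add: sum_fun_apply scale_fun_def mult.commute)
qed

lemma proj_point_self: "v \<in> proj_point v"
  by (auto simp: proj_point_def scale_fun_def intro!: exI[of _ 1])

lemma proj_point_scale:
  assumes "c \<noteq> 0"
  shows "proj_point (scale_fun c v) = proj_point v"
proof (intro equalityI subsetI)
  fix x assume "x \<in> proj_point (scale_fun c v)"
  then obtain d where "d \<noteq> 0" "x = scale_fun d (scale_fun c v)"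
    by (auto simp: proj_point_def)
  then have "d * c \<noteq> 0" "x = scale_fun (d * c) v"
    using assms by (simp_all add: scale_fun_def mult.assoc)
  then show "x \<in> proj_point v" unfolding proj_point_def by blast
next
  fix x assume "x \<in> proj_point v"
  then obtain d where "d \<noteq> 0" "x = scale_fun d v"
    by (auto simp: proj_point_def)
  then have "d / c \<noteq> 0" "x = scale_fun (d / c) (scale_fun c v)"
    using assms by (simp_all add: scale_fun_def)
  then show "x \<in> proj_point (scale_fun c v)" unfolding proj_point_def by blast
qed

lemma PG_cases:
  assumes "P \<in> PG n"
  obtains w where "w \<in> coord_space (Suc n)" "w \<noteq> 0" "P = proj_point w"
  using assms by (auto simp: PG_def)

lemma PG_I: "w \<in> coord_space (Suc n) \<Longrightarrow> w \<noteq> 0 \<Longrightarrow> proj_point w \<in> PG n"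
  by (auto simp: PG_def)

lemma proj_point_mem:
  assumes "P \<in> PG n" "w \<in> P"
  shows "w \<in> coord_space (Suc n)" "w \<noteq> 0" "P = proj_point w"
proof -
  obtain v where v: "v \<in> coord_space (Suc n)" "v \<noteq> 0" "P = proj_point v"
    using assms(1) by (rule PG_cases)
  then obtain c where c: "c \<noteq> 0" "w = scale_fun c v"
    using assms(2) by (auto simp: proj_point_def)
  show "w \<in> coord_space (Suc n)" "w \<noteq> 0"
    using c v by (auto simp: coord_space_def scale_fun_def fun_eq_iff)
  show "P = proj_point w"
    using c v proj_point_scale by metis
qed

lemma mv_eval_proj_point:
  assumes "F \<in> hom_polys n"
  shows "(\<forall>v\<in>proj_point w. mv_eval F v = 0) \<longleftrightarrow> mv_eval F w = 0"
  using assms proj_point_self[of w] mv_eval_scale[of n _ F _ w]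
  by (auto simp: hom_polys_homog proj_point_def)

lemma zero_locus_proj_point:
  assumes "S \<subseteq> hom_polys n" "w \<in> coord_space (Suc n)" "w \<noteq> 0"
  shows "proj_point w \<in> zero_locus n S \<longleftrightarrow> (\<forall>F\<in>S. mv_eval F w = 0)"
  using assms mv_eval_proj_point PG_I[OF assms(2,3)] unfolding zero_locus_def by blast

lemma proj_separate:
  fixes P Q :: "(nat \<Rightarrow> 'a::field) set"
  assumes "P \<in> PG n" "Q \<in> PG n" "P \<noteq> Q"
  shows "\<exists>F\<in>hom_polys n. (\<forall>v\<in>Q. mv_eval F v = 0) \<and> (\<forall>v\<in>P. mv_eval F v \<noteq> 0)"
proof -
  obtain p where p: "p \<in> coord_space (Suc n)" "p \<noteq> 0" "P = proj_point p"
    using assms(1) by (rule PG_cases)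
  obtain q where q: "q \<in> coord_space (Suc n)" "q \<noteq> 0" "Q = proj_point q"
    using assms(2) by (rule PG_cases)
  obtain k where k: "q k \<noteq> 0"
    using q(2) by (auto simp: fun_eq_iff)
  then have kn: "k \<le> n"
    using q(1) by (auto simp: coord_space_def) (metis not_less_eq_eq)
  have "\<exists>i. q k * p i \<noteq> p k * q i"
  proof (rule ccontr)
    assume "\<nexists>i. q k * p i \<noteq> p k * q i"
    then have "q k * p i = p k * q i" for i by blast
    then have "p = scale_fun (p k / q k) q"
      using k by (simp add: scale_fun_def fun_eq_iff field_simps)
    then obtain c where c: "p = scale_fun c q" by blast
    moreover have "c \<noteq> 0"
      using c p(2) by (auto simp: scale_fun_def fun_eq_iff)
    ultimately have "proj_point p = proj_point q"
      using proj_point_scale by metis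
    then show False using assms(3) p q by simp
  qed
  then obtain i where i: "q k * p i \<noteq> p k * q i" by blast
  then have "i \<le> n"
    using p(1) q(1) by (cases "i \<le> n") (auto simp: coord_space_def)
  \<comment> \<open>A 2x2 minor of the matrix with rows q and X: it vanishes at all multiples of q,
    and at p by the choice of i it does not.\<close>
  define F where "F = linear_form n (\<lambda>j. (if j = i then q k else 0) + (if j = k then - q i else 0))"
  have hF: "homog n 1 F"
    by (simp only: F_def homog_linear_form)
  have F: "mv_eval F v = q k * v i - q i * v k" for v
    using kn \<open>i \<le> n\<close>
    by (simp add: F_def mv_eval_linear_form distrib_right sum.distrib if_distrib[where f = "\<lambda>c. c * _"] cong: if_cong)
  have "mv_eval F v = 0" if "v \<in> Q" for v
    using that q by (auto simp: F proj_point_def scale_fun_def)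
  moreover have "mv_eval F v \<noteq> 0" if v: "v \<in> P" for v
  proof -
    obtain c where c: "c \<noteq> 0" "v = scale_fun c p"
      using v p by (auto simp: proj_point_def)
    have "mv_eval F v = c * (q k * p i - q i * p k)"
      by (simp add: F c scale_fun_def algebra_simps)
    then show ?thesis using c(1) i by (simp add: mult.commute)
  qed
  ultimately show ?thesis
    using hF hom_polys_homog by blast
qed

lemma proj_closed_point:
  assumes "P \<in> PG n"
  shows "proj_closed n {P}"
proof -
  define S where "S = {F \<in> hom_polys n. \<forall>v\<in>P. mv_eval F v = 0}"
  have "Q = P" if "Q \<in> zero_locus n S" for Q
  proof (rule ccontr)
    assume "Q \<noteq> P"
    have Q: "Q \<in> PG n" using that by (simp add: zero_locus_def)
    then obtain F where F: "F \<in> hom_polys n" "\<forall>v\<in>P. mv_eval F v = 0" "\<forall>v\<in>Q. mv_eval F v \<noteq> 0"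
      using proj_separate[OF Q assms \<open>Q \<noteq> P\<close>] by blast
    obtain v where "v \<in> Q" using Q proj_point_self by (metis PG_cases)
    then show False
      using that F by (auto simp: zero_locus_def S_def)
  qed
  moreover have "P \<in> zero_locus n S"
    using assms by (auto simp: zero_locus_def S_def)
  ultimately have "{P} = zero_locus n S" by blast
  moreover have "S \<subseteq> hom_polys n" by (auto simp: S_def)
  ultimately show ?thesis
    unfolding proj_closed_def by blast
qed

lemma irreducible_point: "P \<in> PG n \<Longrightarrow> irreducible_variety n {P}"
  unfolding irreducible_variety_def using proj_closed_point by (auto simp: singleton_Un_iff)

text \<open>The product of forms separating \<open>P\<close> from each of the other points cuts out
  the rest of \<open>A\<close>, which is therefore closed.\<close>

lemma irreducible_finite_singleton:
  assumes irr: "irreducible_variety n A" and fin: "finite A"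
  obtains P where "A = {P}"
proof -
  obtain P where P: "P \<in> A"
    using irr by (auto simp: irreducible_variety_def)
  obtain S where S: "S \<subseteq> hom_polys n" "A = zero_locus n S"
    using irr by (auto simp: irreducible_variety_def proj_closed_def)
  have PG: "A \<subseteq> PG n" using S by (auto simp: zero_locus_def)
  have "\<forall>Q\<in>A - {P}. \<exists>F\<in>hom_polys n. (\<forall>v\<in>Q. mv_eval F v = 0) \<and> (\<forall>v\<in>P. mv_eval F v \<noteq> 0)"
    using proj_separate PG P by blast
  then obtain F where F: "\<And>Q. Q \<in> A - {P} \<Longrightarrow> F Q \<in> hom_polys n"
    "\<And>Q v. Q \<in> A - {P} \<Longrightarrow> v \<in> Q \<Longrightarrow> mv_eval (F Q) v = 0"
    "\<And>Q v. Q \<in> A - {P} \<Longrightarrow> v \<in> P \<Longrightarrow> mv_eval (F Q) v \<noteq> 0"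
    by metis
  define G where "G = (\<Prod>Q\<in>A - {P}. F Q)"
  have G: "mv_eval G v = 0 \<longleftrightarrow> (\<exists>Q\<in>A - {P}. mv_eval (F Q) v = 0)" for v
    using fin by (simp add: G_def mv_eval_prod)
  obtain p where p: "p \<in> P" using P PG proj_point_self by (metis PG_cases subsetD)
  have "A - {P} = zero_locus n (insert G S)"
  proof (intro equalityI subsetI)
    fix Q assume "Q \<in> A - {P}"
    then show "Q \<in> zero_locus n (insert G S)"
      using F(2) G S(2) by (auto simp: zero_locus_def)
  next
    fix Q assume Q: "Q \<in> zero_locus n (insert G S)"
    then have "Q \<noteq> P"
      using p F(3) G by (auto simp: zero_locus_def)
    then show "Q \<in> A - {P}"
      using Q S(2) by (auto simp: zero_locus_def)
  qed
  moreover have "insert G S \<subseteq> hom_polys n"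
    using S(1) F(1) by (auto simp: G_def intro: hom_polys_prod)
  ultimately have "proj_closed n (A - {P})"
    unfolding proj_closed_def by blast
  moreover have "A = {P} \<union> (A - {P})" using P by blast
  ultimately have "A = {P} \<or> A = A - {P}"
    using irr proj_closed_point[of P n] P PG unfolding irreducible_variety_def by blast
  then show thesis using that P by blast
qed

text \<open>Duality for finitely many linear functionals, by induction. Either the common kernel of
  the others lies in that of \<open>g a\<close>, which then gets coefficient 0, or some
  \<open>u0\<close> in it has a nonzero value under \<open>g a\<close>, and this determines the
  coefficient. Later it converts orthogonality to tangent vectors into membership in a span.\<close>

lemma double_annihilator:
  fixes g :: "'k \<Rightarrow> nat \<Rightarrow> 'a::field"
  assumes "finite K" "\<And>u. u \<in> coord_space (Suc n) \<Longrightarrow> (\<And>k. k \<in> K \<Longrightarrow> (\<Sum>i\<le>n. g k i * u i) = 0) \<Longrightarrow>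
    (\<Sum>i\<le>n. f i * u i) = 0"
  shows "\<exists>l. \<forall>i\<le>n. f i = (\<Sum>k\<in>K. l k * g k i)"
  using assms
proof (induction K arbitrary: f)
  case empty
  have "f i = 0" if "i \<le> n" for i
  proof -
    have "(\<Sum>j\<le>n. f j * (if j = i then 1 else 0)) = 0"
      using that by (intro empty.prems) (auto simp: coord_space_def)
    then show ?thesis using that by (simp add: if_distrib cong: if_cong)
  qed
  then show ?case by simp
next
  case (insert a K)
  show ?case
  proof (cases "\<exists>u0\<in>coord_space (Suc n). (\<forall>k\<in>K. (\<Sum>i\<le>n. g k i * u0 i) = 0) \<and> (\<Sum>i\<le>n. g a i * u0 i) \<noteq> 0")
    case False
    then have "\<exists>l. \<forall>i\<le>n. f i = (\<Sum>k\<in>K. l k * g k i)"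
      by (intro insert.IH insert.prems) auto
    then obtain l where l: "\<forall>i\<le>n. f i = (\<Sum>k\<in>K. l k * g k i)" by blast
    have "(\<Sum>k\<in>K. (l(a := 0)) k * g k i) = (\<Sum>k\<in>K. l k * g k i)" for i
      using insert.hyps by (intro sum.cong) auto
    then show ?thesis
      using l insert.hyps by (intro exI[of _ "l(a := 0)"]) simp
  next
    case True
    then obtain u0 where u0: "u0 \<in> coord_space (Suc n)" "\<And>k. k \<in> K \<Longrightarrow> (\<Sum>i\<le>n. g k i * u0 i) = 0"
      "(\<Sum>i\<le>n. g a i * u0 i) \<noteq> 0" by blast
    define s where "s = (\<Sum>i\<le>n. g a i * u0 i)"
    define t where "t = (\<Sum>i\<le>n. f i * u0 i) / s"
    have "\<exists>l. \<forall>i\<le>n. f i - t * g a i = (\<Sum>k\<in>K. l k * g k i)"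
    proof (rule insert.IH)
      fix u :: "nat \<Rightarrow> 'a" assume u: "u \<in> coord_space (Suc n)" "\<And>k. k \<in> K \<Longrightarrow> (\<Sum>i\<le>n. g k i * u i) = 0"
      define c where "c = (\<Sum>i\<le>n. g a i * u i) / s"
      \<comment> \<open>Projection along \<open>u0\<close> into the kernel of \<open>g a\<close>;
        the other kernels are not left.\<close>
      define u' where "u' = (\<lambda>i. u i - c * u0 i)"
      have lin: "(\<Sum>i\<le>n. h i * u' i) = (\<Sum>i\<le>n. h i * u i) - c * (\<Sum>i\<le>n. h i * u0 i)" for h
        by (simp add: u'_def algebra_simps sum_subtractf sum_distrib_left)
      have "(\<Sum>i\<le>n. f i * u' i) = 0"
      proof (rule insert.prems)
        show "u' \<in> coord_space (Suc n)"
          using u(1) u0(1) by (simp add: u'_def coord_space_def)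
        show "(\<Sum>i\<le>n. g k i * u' i) = 0" if "k \<in> insert a K" for k
          using that u(2) u0(2,3) by (auto simp: lin c_def s_def)
      qed
      then have "(\<Sum>i\<le>n. f i * u i) = c * (\<Sum>i\<le>n. f i * u0 i)"
        by (simp add: lin)
      moreover have "c * (\<Sum>i\<le>n. f i * u0 i) = t * (\<Sum>i\<le>n. g a i * u i)"
        by (simp add: c_def t_def)
      ultimately show "(\<Sum>i\<le>n. (f i - t * g a i) * u i) = 0"
        by (simp add: left_diff_distrib sum_subtractf sum_distrib_left mult.assoc)
    qed
    then obtain l where l: "\<And>i. i \<le> n \<Longrightarrow> f i - t * g a i = (\<Sum>k\<in>K. l k * g k i)" by blast
    have "(\<Sum>k\<in>K. (l(a := t)) k * g k i) = (\<Sum>k\<in>K. l k * g k i)" for i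
      using insert.hyps by (intro sum.cong) auto
    then have "f i = (\<Sum>k\<in>insert a K. (l(a := t)) k * g k i)" if "i \<le> n" for i
      using l[OF that] insert.hyps by (simp add: algebra_simps)
    then show ?thesis by blast
  qed
qed

lemma homog_power_sum: "m > 0 \<Longrightarrow> homog (m - 1) k (power_sum m k)"
  unfolding power_sum_def
proof (rule homog_sum)
  fix i assume "i \<in> {..<m}"
  then show "homog (m - 1) k (single (single i k) 1)"
    using homog_single[of "single i k" "m - 1" 1] by (cases "k = 0") (auto simp: single_zero)
qed

lemma power_sum_hom_polys: "m > 0 \<Longrightarrow> power_sum m k \<in> hom_polys (m - 1)"
  unfolding hom_polys_homog using homog_power_sum by blast

lemma mv_eval_power_sum: "mv_eval (power_sum m k) v = (\<Sum>i<m. v i ^ k)"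
  by (simp add: power_sum_def mv_eval_sum mv_eval_single)

section \<open>Forms under linear substitution and the coordinates of a point\<close>

context power_sums
begin

lemma hpol_zero: "hpol m d (\<lambda>x::'a pt. 0)"
proof -
  have "hpol m d (\<lambda>x::'a pt. x 0 ^ d)"
  proof (induction d)
    case 0
    show ?case using hpol_const[of m 1] by simp
  next
    case (Suc d)
    then show ?case using hpol_mult[OF hpol_coord[of 0 m] Suc] m_ge by simp
  qed
  from hpol_mult[OF hpol_const[of m 0] this] show ?thesis by simp
qed

lemma hpol_sum:
  fixes f :: "'i \<Rightarrow> 'a pt \<Rightarrow> 'a fps"
  shows "(\<And>i. i \<in> I \<Longrightarrow> hpol m d (f i)) \<Longrightarrow> hpol m d (\<lambda>x. \<Sum>i\<in>I. f i x)"
proof (induction I rule: infinite_finite_induct)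
  case (insert a I)
  then show ?case using hpol_add[of m d "f a"] by simp
qed (simp_all add: hpol_zero)

lemma hpol_power: "hpol m d f \<Longrightarrow> hpol m (k * d) (\<lambda>x. f x ^ k)"
proof (induction k)
  case 0
  show ?case using hpol_const[of m 1] by simp
next
  case (Suc k)
  then show ?case using hpol_mult[of m d f "k * d"] by simp
qed

lemma hpol_linear_substitution:
  fixes B :: "nat \<Rightarrow> nat \<Rightarrow> 'a"
  assumes "homog n d F"
  shows "hpol m d (\<lambda>x. fps_mv_eval F (\<lambda>j. \<Sum>i<m. fps_const (B j i) * x i))"
  unfolding fps_mv_eval_def
proof (rule hpol_sum)
  fix \<mu> assume \<mu>: "\<mu> \<in> keys F"
  have lin: "hpol m 1 (\<lambda>x. \<Sum>i<m. fps_const (B j i) * x i)" for j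
  proof (rule hpol_sum)
    fix i assume "i \<in> {..<m}"
    then show "hpol m 1 (\<lambda>x. fps_const (B j i) * x i)"
      using hpol_mult[OF hpol_const[of m "B j i"] hpol_coord[of i m]] by simp
  qed
  have "hpol m (\<Sum>j\<in>keys \<mu>. lookup \<mu> j)
      (\<lambda>x. mon_eval (\<lambda>j. \<Sum>i<m. fps_const (B j i) * x i) \<mu>)"
    unfolding mon_eval_def using hpol_power[OF lin] by (intro hpol_prod) simp
  moreover have "(\<Sum>j\<in>keys \<mu>. lookup \<mu> j) = d"
    using assms \<mu> by (simp add: homog_def)
  ultimately show "hpol m d (\<lambda>x. fps_const (lookup F \<mu>)
      * mon_eval (\<lambda>j. \<Sum>i<m. fps_const (B j i) * x i) \<mu>)"
    using hpol_mult[OF hpol_const[of m "lookup F \<mu>"]] by fastforce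
qed

lemma psum_const_pt: "psum {..<m} (const_pt v) k = fps_const (\<Sum>i<m. v i ^ k)"
  by (simp add: psum_def const_pt_def fps_const_sum fps_const_power)

lemma const_pt_cone_iff: "const_pt v \<in> ps_cone m \<longleftrightarrow> (\<forall>k\<in>{1..m - 2}. (\<Sum>i<m. v i ^ k) = 0)"
  by (simp add: ps_cone_def psum_const_pt)

text \<open>A triple root is a zero of the second derivative m(m - 1)X^(m-2).\<close>

lemma trinomial_triple_root:
  fixes v :: "nat \<Rightarrow> 'a"
  assumes f: "root_poly {..<m} v = trinomial m a b"
    and ijk: "i < m" "j < m" "k < m" "i \<noteq> j" "i \<noteq> k" "j \<noteq> k" "v i = v j" "v i = v k"
  shows "v i = 0"
proof -
  define q where "q = root_poly ({..<m} - {i} - {j} - {k}) v"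
  have "trinomial m a b = [:- v i, 1:] * ([:- v i, 1:] * ([:- v i, 1:] * q))"
    using ijk root_poly_remove[of "{..<m}" i v] root_poly_remove[of "{..<m} - {i}" j v]
      root_poly_remove[of "{..<m} - {i} - {j}" k v]
    by (simp add: f[symmetric] q_def)
  then have "poly (pderiv (pderiv (trinomial m a b))) (v i) = 0"
    by (simp add: pderiv_mult pderiv_add pderiv_pCons del: mult_pCons_left mult_pCons_right)
  then have "of_nat (m - 1) * of_nat m * v i ^ (m - 1 - 1) = 0"
    by (simp add: trinomial_def pderiv_add pderiv_monom pderiv_pCons poly_monom)
  then show ?thesis
    using of_nat_nonzero[of m] of_nat_nonzero[of "m - 1"] m_ge by auto
qed

text \<open>\<open>X\<^sup>m + aX + b\<close> has at most one multiple root, and that is a double root.\<close>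

lemma cone_card:
  fixes v :: "nat \<Rightarrow> 'a"
  assumes v: "const_pt v \<in> ps_cone m" and nz: "\<exists>i<m. v i \<noteq> 0"
  shows "card (v ` {..<m}) \<ge> m - 1"
proof -
  obtain a b where ab: "root_poly {..<m} v = trinomial m a b"
    using const_pt_cone[OF v] .
  \<comment> \<open>A multiple root y will determine the trinomial: a = -m y^(m-1) and b = (m -
    1)y^m. Were y = 0, all coordinates would be 0.\<close>
  have root: "v i ^ m + a * v i + b = 0" if "i < m" for i
    using poly_root_poly_root[of "{..<m}" i v] that by (simp add: ab poly_trinomial)
  have dbl: "of_nat m * v i ^ (m - 1) + a = 0" "b = of_nat (m - 1) * v i ^ m" "v i \<noteq> 0"
    if ij: "i < m" "j < m" "i \<noteq> j" "v i = v j" for i j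
  proof -
    show 1: "of_nat m * v i ^ (m - 1) + a = 0"
      by (rule trinomial_multiple_root(1)[OF ab ij])
    have pow: "v i ^ (m - 1) * v i = v i ^ m"
      using m_ge by (simp flip: power_Suc2)
    have "a = - (of_nat m * v i ^ (m - 1))"
      using 1 by (simp add: add_eq_0_iff)
    then have "a * v i = - (of_nat m * (v i ^ (m - 1) * v i))"
      by (simp only: mult_minus_left mult.assoc)
    then have av: "a * v i = - (of_nat m * v i ^ m)"
      unfolding pow .
    then show 2: "b = of_nat (m - 1) * v i ^ m"
      using root[OF ij(1)] m_ge by (simp add: of_nat_diff algebra_simps)
    show "v i \<noteq> 0"
    proof
      assume "v i = 0"
      then have "a = 0" "b = 0"
        using 1 2 m_ge by (simp_all add: power_0_left)
      then show False using root nz by auto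
    qed
  qed
  \<comment> \<open>Conversely a and b determine y^(m-1) and y^m, hence the nonzero y, so there is
    only one multiple root.\<close>
  have same: "v i = v k" if "i < m" "j < m" "i \<noteq> j" "v i = v j" "k < m" "l < m" "k \<noteq> l" "v k = v l" for i j k l
  proof -
    have "of_nat m * v i ^ (m - 1) = of_nat m * v k ^ (m - 1)"
      "of_nat (m - 1) * v i ^ m = of_nat (m - 1) * v k ^ m"
      using dbl[of i j] dbl[of k l] that by (metis add_right_cancel, metis)
    then have "v i ^ (m - 1) = v k ^ (m - 1)" "v i ^ m = v k ^ m"
      using of_nat_nonzero[of m] of_nat_nonzero[of "m - 1"] m_ge by auto
    moreover have "v i * v i ^ (m - 1) = v i ^ m" "v k * v k ^ (m - 1) = v k ^ m"
      using m_ge by (simp_all flip: power_Suc)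
    ultimately have "(v i - v k) * v k ^ (m - 1) = 0"
      by (simp add: left_diff_distrib)
    then show ?thesis
      using dbl(3)[of k l] that by simp
  qed
  obtain i0 where i0: "i0 < m" "inj_on v ({..<m} - {i0})"
  proof (cases "inj_on v {..<m}")
    case True
    then show thesis
      using that[of 0] m_ge inj_on_subset[OF True, of "{..<m} - {0}"] by auto
  next
    case False
    then obtain i j where ij: "i < m" "j < m" "i \<noteq> j" "v i = v j"
      by (auto simp: inj_on_def)
    have "inj_on v ({..<m} - {i})"
    proof (rule inj_onI, rule ccontr)
      fix k l assume kl: "k \<in> {..<m} - {i}" "l \<in> {..<m} - {i}" "v k = v l" "k \<noteq> l"
      then have "v i = v k" using same[OF ij, of k l] by auto
      then have "v i = 0"
        using trinomial_triple_root[OF ab, of i k l] ij kl by auto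
      then show False using dbl(3)[OF ij] by simp
    qed
    then show thesis using that ij(1) by blast
  qed
  have "m - 1 = card (v ` ({..<m} - {i0}))"
    using i0 by (simp add: card_image)
  also have "\<dots> \<le> card (v ` {..<m})"
    by (intro card_mono) auto
  finally show ?thesis .
qed

end

subsection \<open>The curve in the hyperplane\<close>

locale hyperplane_section = power_sums m ty for m and ty :: "'a::alg_closed_field itself" +
  fixes \<phi> :: "(nat \<Rightarrow> 'a) \<Rightarrow> nat \<Rightarrow> 'a"
  assumes identification: "hyperplane_identification m \<phi>"
begin

definition Z :: "(nat \<Rightarrow> 'a) set set" where
  "Z = transport (m - 2) \<phi> (power_sum_variety m)"

lemma Suc_m: "Suc (m - 2) = m - 1" "Suc (m - 1) = m"
  using m_ge by auto

sublocale phi: Vector_Spaces.linear scale_fun scale_fun \<phi>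
  using identification by (simp add: hyperplane_identification_def)

lemma phi_inj: "w \<in> coord_space (m - 1) \<Longrightarrow> w' \<in> coord_space (m - 1) \<Longrightarrow> \<phi> w = \<phi> w' \<Longrightarrow> w = w'"
  using identification by (auto simp: hyperplane_identification_def bij_betw_def inj_on_def)

lemma phi_mem: "w \<in> coord_space (m - 1) \<Longrightarrow> \<phi> w \<in> coord_space m \<and> (\<Sum>i<m. \<phi> w i) = 0"
  using identification by (fastforce simp: hyperplane_identification_def bij_betw_def)

lemma phi_surj:
  assumes "v \<in> coord_space m" "(\<Sum>i<m. v i) = 0"
  obtains w where "w \<in> coord_space (m - 1)" "\<phi> w = v"
proof -
  have "\<phi> ` coord_space (m - 1) = {v \<in> coord_space m. (\<Sum>i<m. v i) = 0}"
    using identification unfolding hyperplane_identification_def bij_betw_def by blast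
  then have "v \<in> \<phi> ` coord_space (m - 1)" using assms by blast
  then show thesis using that by blast
qed

lemma phi_nonzero: "w \<in> coord_space (m - 1) \<Longrightarrow> w \<noteq> 0 \<Longrightarrow> \<phi> w \<noteq> 0"
  using phi_inj[of w 0] phi.zero coord_space_0 by auto

lemma mem_Z:
  assumes w: "w \<in> coord_space (m - 1)" "w \<noteq> 0"
  shows "proj_point w \<in> Z \<longleftrightarrow> const_pt (\<phi> w) \<in> ps_cone m"
proof -
  have "\<phi> ` proj_point w = proj_point (\<phi> w)"
    by (auto simp: proj_point_def phi.scale intro!: image_eqI)
  moreover have "proj_point w \<in> PG (m - 2)"
    using w by (intro PG_I) (simp_all add: Suc_m)
  moreover have "power_sum m ` {1..m - 2} \<subseteq> (hom_polys (m - 1) :: 'a mvpoly set)"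
    using power_sum_hom_polys[of m] m_ge by auto
  then have "proj_point (\<phi> w) \<in> power_sum_variety m
    \<longleftrightarrow> (\<forall>F\<in>power_sum m ` {1..m - 2}. mv_eval F (\<phi> w) = 0)"
    using zero_locus_proj_point[of "power_sum m ` {1..m - 2}" "m - 1" "\<phi> w"]
      phi_mem[OF w(1)] phi_nonzero[OF w]
    unfolding power_sum_variety_def Suc_m by blast
  ultimately show ?thesis
    by (simp add: Z_def transport_def const_pt_cone_iff mv_eval_power_sum)
qed

lemma Z_cases:
  assumes "P \<in> Z"
  obtains w where "w \<in> coord_space (m - 1)" "w \<noteq> 0" "P = proj_point w" "const_pt (\<phi> w) \<in> ps_cone m"
proof -
  have "P \<in> PG (m - 2)"
    using assms by (simp add: Z_def transport_def)
  then obtain w where w: "w \<in> coord_space (Suc (m - 2))" "w \<noteq> 0" "P = proj_point w"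
    by (rule PG_cases)
  then show thesis
    using that[of w] mem_Z[of w] assms by (simp add: Suc_m)
qed

lemma phi_expand:
  assumes w: "w \<in> coord_space (m - 1)"
  shows "\<phi> w i = (\<Sum>j\<le>m - 2. \<phi> (unit j) i * w j)"
proof -
  have "{..m - 2} = {..<m - 1}" using m_ge by auto
  then show ?thesis
    using linear_coord_space_expand[OF phi.linear_axioms w] by simp
qed

text \<open>The k-th power sum in the coordinates of the hyperplane. For k = 1 it is 0, which is why
  the gradients are counted from exponent 2 on.\<close>

definition pulled_psum :: "nat \<Rightarrow> 'a mvpoly" where
  "pulled_psum k = (\<Sum>i<m. linear_form (m - 2) (\<lambda>j. \<phi> (unit j) i) ^ k)"

lemma homog_pulled_psum: "homog (m - 2) k (pulled_psum k)"
  unfolding pulled_psum_def using homog_power[OF homog_linear_form] by (intro homog_sum) simp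

lemma pulled_psum_hom_polys: "pulled_psum k \<in> hom_polys (m - 2)"
  unfolding hom_polys_homog using homog_pulled_psum by blast

lemma mv_eval_pulled_psum:
  "w \<in> coord_space (m - 1) \<Longrightarrow> mv_eval (pulled_psum k) w = (\<Sum>i<m. \<phi> w i ^ k)"
  by (simp add: pulled_psum_def mv_eval_sum mv_eval_power mv_eval_linear_form phi_expand)

lemma fps_mv_eval_pulled_psum:
  assumes "w \<in> coord_space (m - 1)" "u \<in> coord_space (m - 1)"
  shows "fps_mv_eval (pulled_psum k) (\<lambda>i. fps_const (w i) + fps_const (u i) * fps_X)
    = psum {..<m} (\<lambda>i. fps_const (\<phi> w i) + fps_const (\<phi> u i) * fps_X) k"
  by (simp add: pulled_psum_def fps_mv_eval_sum fps_mv_eval_power fps_mv_eval_linear_form psum_def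
      phi_expand[OF assms(1)] phi_expand[OF assms(2)] fps_const_sum distrib_left sum.distrib
      sum_distrib_right mult.assoc flip: fps_const_mult)

lemma psum_line:
  "psum {..<m} (\<lambda>i. fps_const (v i) + fps_const (u i) * fps_X) k $ 0 = (\<Sum>i<m. v i ^ k)"
  "psum {..<m} (\<lambda>i. fps_const (v i) + fps_const (u i) * fps_X) k $ 1
    = of_nat k * (\<Sum>i<m. v i ^ (k - 1) * u i)" for u v :: "nat \<Rightarrow> 'a"
  unfolding psum_def fps_sum_nth fps_line_power by (simp_all add: sum_distrib_left mult.assoc)

lemma gradient_pulled_psum:
  assumes "w \<in> coord_space (m - 1)" "u \<in> coord_space (m - 1)"
  shows "(\<Sum>i\<le>m - 2. gradient (m - 2) (pulled_psum k) w i * u i)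
    = of_nat k * (\<Sum>i<m. \<phi> w i ^ (k - 1) * \<phi> u i)"
  using fps_mv_eval_line[OF homog_pulled_psum, of k w u]
  by (simp only: fps_mv_eval_pulled_psum[OF assms] psum_line)

lemma Z_zero_locus: "Z = zero_locus (m - 2) (pulled_psum ` {1..m - 2})"
proof -
  have hom: "pulled_psum ` {1..m - 2} \<subseteq> hom_polys (m - 2)"
    using pulled_psum_hom_polys by auto
  have *: "proj_point w \<in> Z \<longleftrightarrow> proj_point w \<in> zero_locus (m - 2) (pulled_psum ` {1..m - 2})"
    if w: "w \<in> coord_space (m - 1)" "w \<noteq> 0" for w
    using mem_Z[OF w] zero_locus_proj_point[OF hom, of w] w
    by (simp add: Suc_m const_pt_cone_iff mv_eval_pulled_psum)
  show ?thesis
  proof (intro equalityI subsetI)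
    fix P assume "P \<in> Z"
    then show "P \<in> zero_locus (m - 2) (pulled_psum ` {1..m - 2})"
      by (elim Z_cases) (metis * \<open>P \<in> Z\<close>)
  next
    fix P assume P: "P \<in> zero_locus (m - 2) (pulled_psum ` {1..m - 2})"
    then have "P \<in> PG (m - 2)" by (simp add: zero_locus_def)
    then show "P \<in> Z"
      using P * by (elim PG_cases) (metis Suc_m(1))
  qed
qed

lemma pulled_psum_vanishing: "k \<in> {1..m - 2} \<Longrightarrow> pulled_psum k \<in> vanishing_polys (m - 2) Z"
  using pulled_psum_hom_polys by (auto simp: vanishing_polys_def Z_zero_locus zero_locus_def)

text \<open>A linear left inverse of \<open>\<phi>\<close> on the hyperplane extends to all vectors;
  \<open>B\<close> is its matrix. It allows a form in the hyperplane coordinates to be read as a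
  form in all m coordinates.\<close>

lemma phi_inverse:
  obtains B :: "nat \<Rightarrow> nat \<Rightarrow> 'a"
    where "\<And>w j. w \<in> coord_space (m - 1) \<Longrightarrow> w j = (\<Sum>i<m. B j i * \<phi> w i)"
proof -
  interpret vector_space_pair "scale_fun :: 'a \<Rightarrow> _ \<Rightarrow> nat \<Rightarrow> 'a" "scale_fun :: 'a \<Rightarrow> _ \<Rightarrow> nat \<Rightarrow> 'a"
    by (simp add: vector_space_pair_def vector_space_scale_fun)
  have "phi.vs1.subspace (coord_space (m - 1))"
    by (auto simp: phi.vs1.subspace_def coord_space_def scale_fun_def)
  moreover have "inj_on \<phi> (coord_space (m - 1))"
    using phi_inj by (rule inj_onI)
  ultimately obtain g where g: "Vector_Spaces.linear scale_fun scale_fun g"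
    "\<And>w. w \<in> coord_space (m - 1) \<Longrightarrow> g (\<phi> w) = w"
    using linear_exists_left_inverse_on[OF phi.linear_axioms] by blast
  show thesis
  proof (rule that)
    fix w :: "nat \<Rightarrow> 'a" and j assume w: "w \<in> coord_space (m - 1)"
    then have "\<phi> w \<in> coord_space m" using phi_mem by blast
    from linear_coord_space_expand[OF g(1) this] show "w j = (\<Sum>i<m. g (unit i) j * \<phi> w i)"
      unfolding g(2)[OF w] .
  qed
qed

section \<open>Forms on the hyperplane as forms in m coordinates\<close>

definition back_coeff :: "nat \<Rightarrow> nat \<Rightarrow> 'a" where
  "back_coeff = (SOME B. \<forall>w\<in>coord_space (m - 1). \<forall>j. w j = (\<Sum>i<m. B j i * \<phi> w i))"

definition pullback :: "'a mvpoly \<Rightarrow> 'a pt \<Rightarrow> 'a fps" where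
  "pullback F x = fps_mv_eval F (\<lambda>j. \<Sum>i<m. fps_const (back_coeff j i) * x i)"

lemma back_coeff: "w \<in> coord_space (m - 1) \<Longrightarrow> w j = (\<Sum>i<m. back_coeff j i * \<phi> w i)"
proof -
  obtain B where "\<And>w j. w \<in> coord_space (m - 1) \<Longrightarrow> w j = (\<Sum>i<m. B j i * \<phi> w i)"
    using phi_inverse by blast
  then have "\<exists>B. \<forall>w\<in>coord_space (m - 1). \<forall>j. w j = (\<Sum>i<m. B j i * \<phi> w i)" by blast
  then have "\<forall>w\<in>coord_space (m - 1). \<forall>j. w j = (\<Sum>i<m. back_coeff j i * \<phi> w i)"
    unfolding back_coeff_def by (rule someI_ex)
  then show "w \<in> coord_space (m - 1) \<Longrightarrow> w j = (\<Sum>i<m. back_coeff j i * \<phi> w i)" by blast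
qed

lemma hpol_pullback: "homog (m - 2) d F \<Longrightarrow> hpol m d (pullback F)"
  unfolding pullback_def by (rule hpol_linear_substitution)

lemma pullback_mult: "pullback (F * G) x = pullback F x * pullback G x"
  by (simp add: pullback_def fps_mv_eval_mult)

lemma pullback_line:
  assumes "w \<in> coord_space (m - 1)" "u \<in> coord_space (m - 1)"
  shows "pullback F (\<lambda>i. fps_const (\<phi> w i) + fps_const (\<phi> u i) * fps_X)
    = fps_mv_eval F (\<lambda>j. fps_const (w j) + fps_const (u j) * fps_X)"
proof -
  have "(\<Sum>i<m. fps_const (back_coeff j i) * (fps_const (\<phi> w i) + fps_const (\<phi> u i) * fps_X))
    = fps_const (\<Sum>i<m. back_coeff j i * \<phi> w i) + fps_const (\<Sum>i<m. back_coeff j i * \<phi> u i) * fps_X" for j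
    by (simp add: fps_const_sum distrib_left sum.distrib sum_distrib_right mult.assoc flip: fps_const_mult)
  then show ?thesis
    unfolding pullback_def using back_coeff[OF assms(1)] back_coeff[OF assms(2)] by simp
qed

lemma pullback_const: "w \<in> coord_space (m - 1) \<Longrightarrow> pullback F (const_pt (\<phi> w)) = fps_const (mv_eval F w)"
  using pullback_line[OF _ coord_space_0, of w F] by (simp add: phi.zero const_pt_def fps_mv_eval_const)

lemma vanishing_polys_Z:
  assumes F: "F \<in> hom_polys (m - 2)"
  shows "F \<in> vanishing_polys (m - 2) Z \<longleftrightarrow>
    (\<forall>w\<in>coord_space (m - 1). w \<noteq> 0 \<longrightarrow> const_pt (\<phi> w) \<in> ps_cone m \<longrightarrow> mv_eval F w = 0)" (is "_ \<longleftrightarrow> ?R")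
proof
  assume "F \<in> vanishing_polys (m - 2) Z"
  then show ?R
    using mem_Z proj_point_self unfolding vanishing_polys_def by blast
next
  assume R: ?R
  have "mv_eval F v = 0" if "P \<in> Z" "v \<in> P" for P v
    using that R mv_eval_proj_point[OF F] by (elim Z_cases) blast
  then show "F \<in> vanishing_polys (m - 2) Z"
    using F by (auto simp: vanishing_polys_def)
qed

text \<open>From left to right one evaluates at points over K. The converse is the radical property
  of the ideal: points with distinct coordinates suffice, they are nonzero, and they come from the
  hyperplane because the first power sum is among the equations.\<close>

lemma pullback_null:
  assumes F: "F \<in> hom_polys (m - 2)"
  shows "pullback F \<in> ps_null m \<longleftrightarrow> F \<in> vanishing_polys (m - 2) Z"
proof
  assume null: "pullback F \<in> ps_null m"
  show "F \<in> vanishing_polys (m - 2) Z"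
    unfolding vanishing_polys_Z[OF F] using ps_null_cone[OF null] pullback_const by force
next
  assume F0: "F \<in> vanishing_polys (m - 2) Z"
  obtain d where "homog (m - 2) d F" using F hom_polys_homog by blast
  note hp = hpol_pullback[OF this]
  show "pullback F \<in> ps_null m"
  proof (rule hpol_vanishing[OF hp])
    fix v :: "nat \<Rightarrow> 'a" assume v: "const_pt v \<in> ps_cone m" "inj_on v {..<m}"
    \<comment> \<open>The cone constrains only the first m coordinates; the others are set to 0 to
      bring the point into the image of \<open>\<phi>\<close>.\<close>
    define v' where "v' i = (if i < m then v i else 0)" for i
    have v': "v' \<in> coord_space m" "\<forall>k\<in>{1..m - 2}. (\<Sum>i<m. v' i ^ k) = 0"
      using v(1) by (simp_all add: v'_def coord_space_def const_pt_cone_iff)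
    then have "(\<Sum>i<m. v' i ^ 1) = 0"
      using m_ge by (intro v'(2)[rule_format]) auto
    then obtain w where w: "w \<in> coord_space (m - 1)" "\<phi> w = v'"
      using phi_surj[OF v'(1)] by auto
    have "w \<noteq> 0"
    proof
      assume "w = 0"
      then have "v' = 0"
        using w(2) phi.zero by simp
      have "v 0 = v 1"
        using fun_cong[OF \<open>v' = 0\<close>, of 0] fun_cong[OF \<open>v' = 0\<close>, of 1] m_ge by (simp add: v'_def)
      then show False using inj_onD[OF v(2), of 0 1] m_ge by auto
    qed
    then have "mv_eval F w = 0"
      using F0 w v'(2) unfolding vanishing_polys_Z[OF F] by (simp add: const_pt_cone_iff)
    then have "pullback F (const_pt v') = 0"
      using pullback_const[OF w(1)] w(2) by simp
    moreover have "pullback F (const_pt v) = pullback F (const_pt v')"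
      by (rule hpol_cong[OF hp]) (simp add: const_pt_def v'_def)
    ultimately show "pullback F (const_pt v) = 0" by simp
  qed
qed

section \<open>Irreducibility and dimension\<close>

lemma Z_subset_PG: "Z \<subseteq> PG (m - 2)"
  by (auto simp: Z_def transport_def)

lemma proj_closed_Z: "proj_closed (m - 2) Z"
  unfolding proj_closed_def
  by (intro exI[of _ "pulled_psum ` {1..m - 2}"]) (use pulled_psum_hom_polys Z_zero_locus in blast)

lemma point_of_trinomial:
  assumes "(a, b) \<noteq> (0, 0)"
  obtains w where "w \<in> coord_space (m - 1)" "w \<noteq> 0" "root_poly {..<m} (\<phi> w) = trinomial m a b"
    "proj_point w \<in> Z"
proof -
  obtain v0 :: "nat \<Rightarrow> 'a" where v0: "root_poly {..<m} v0 = trinomial m a b"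
    by (rule exists_trinomial_roots)
  define v where "v i = (if i < m then v0 i else 0)" for i
  have v: "root_poly {..<m} v = trinomial m a b"
    using v0 by (simp add: root_poly_def v_def)
  have cone: "const_pt v \<in> ps_cone m"
    by (rule cone_trinomial(1)[OF const_pt_trinomial[OF v]])
  then have "\<forall>k\<in>{1..m - 2}. (\<Sum>i<m. v i ^ k) = 0"
    by (simp only: const_pt_cone_iff)
  moreover have "1 \<in> {1..m - 2}" using m_ge by auto
  ultimately have "(\<Sum>i<m. v i ^ 1) = 0" by (rule bspec)
  moreover have "v \<in> coord_space m" by (simp add: v_def coord_space_def)
  ultimately obtain w where w: "w \<in> coord_space (m - 1)" "\<phi> w = v"
    using phi_surj by auto
  have "w \<noteq> 0"
  proof
    assume "w = 0"
    then have "v = 0" using w(2) phi.zero by simp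
    then have "trinomial m a b = monom 1 m"
      using v by (simp add: root_poly_def monom_altdef)
    then have "coeff (trinomial m a b) 0 = 0" "coeff (trinomial m a b) 1 = 0"
      using m_ge by (simp_all del: One_nat_def)
    then show False using assms m_ge by (simp add: coeff_trinomial)
  qed
  then show thesis
    using that[OF w(1)] w mem_Z[OF w(1)] v cone by simp
qed

text \<open>The roots of X^m + X and of X^m + 1 give two different points, as scaling cannot make a
  nonzero a vanish.\<close>

lemma Z_not_point: "Z \<noteq> {}" "Z \<noteq> {P}"
proof -
  obtain w where w: "w \<in> coord_space (m - 1)" "w \<noteq> 0" "root_poly {..<m} (\<phi> w) = trinomial m 1 0"
    "proj_point w \<in> Z"
    by (rule point_of_trinomial[of 1 0]) auto
  obtain w' where w': "w' \<in> coord_space (m - 1)" "w' \<noteq> 0" "root_poly {..<m} (\<phi> w') = trinomial m 0 1"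
    "proj_point w' \<in> Z"
    by (rule point_of_trinomial[of 0 1]) auto
  show "Z \<noteq> {}" using w(4) by blast
  have "proj_point w' \<noteq> proj_point w"
  proof
    assume "proj_point w' = proj_point w"
    then obtain c where c: "c \<noteq> 0" "w = scale_fun c w'"
      using proj_point_self[of w] by (auto simp: proj_point_def)
    have "\<phi> w = scale_fun c (\<phi> w')"
      unfolding c(2) by (rule phi.scale)
    then have "\<phi> w = (\<lambda>i. c * \<phi> w' i)"
      by (simp only: scale_fun_def)
    then have "trinomial m 1 0 = trinomial m 0 (c ^ m * 1)"
      using root_poly_scale_trinomial[OF w'(3) c(1)] w(3) by simp
    then have "coeff (trinomial m 1 0) 1 = coeff (trinomial m 0 (c ^ m * 1)) 1" by simp
    then show False using m_ge by (simp add: coeff_trinomial)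
  qed
  then show "Z \<noteq> {P}" using w(4) w'(4) by auto
qed

lemma irreducible_Z: "irreducible_variety (m - 2) Z"
  unfolding irreducible_variety_def
proof (intro conjI allI impI)
  fix A B assume AB: "proj_closed (m - 2) A \<and> proj_closed (m - 2) B \<and> Z = A \<union> B"
  then obtain S T where S: "S \<subseteq> hom_polys (m - 2)" "A = zero_locus (m - 2) S"
    and T: "T \<subseteq> hom_polys (m - 2)" "B = zero_locus (m - 2) T"
    unfolding proj_closed_def by blast
  show "Z = A \<or> Z = B"
  proof (rule ccontr)
    assume "\<not> (Z = A \<or> Z = B)"
    then obtain P Q where PQ: "P \<in> Z" "P \<notin> A" "Q \<in> Z" "Q \<notin> B"
      using AB by blast
    obtain F where F: "F \<in> S" "F \<notin> vanishing_polys (m - 2) Z"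
      using PQ S Z_subset_PG by (auto simp: zero_locus_def vanishing_polys_def)
    obtain G where G: "G \<in> T" "G \<notin> vanishing_polys (m - 2) Z"
      using PQ T Z_subset_PG by (auto simp: zero_locus_def vanishing_polys_def)
    have hom: "F \<in> hom_polys (m - 2)" "G \<in> hom_polys (m - 2)"
      using F(1) G(1) S(1) T(1) by auto
    then obtain d e where de: "homog (m - 2) d F" "homog (m - 2) e G"
      using hom_polys_homog by blast
    have FG: "F * G \<in> vanishing_polys (m - 2) Z"
    proof -
      have "mv_eval (F * G) v = 0" if R: "R \<in> Z" "v \<in> R" for R v
      proof -
        have "R \<in> A \<or> R \<in> B" using R(1) AB by blast
        then show ?thesis
          using S(2) T(2) F(1) G(1) R(2) by (auto simp: zero_locus_def mv_eval_mult)
      qed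
      then show ?thesis
        using hom_polys_mult[OF hom] by (auto simp: vanishing_polys_def)
    qed
    then have "(\<lambda>x. pullback F x * pullback G x) \<in> ps_null m"
      using pullback_null[OF hom_polys_mult[OF hom]] by (simp flip: pullback_mult)
    then show False
      using hpol_null_prime[OF hpol_pullback[OF de(1)] hpol_pullback[OF de(2)]]
        pullback_null[OF hom(1)] pullback_null[OF hom(2)] F(2) G(2) by blast
  qed
qed (use proj_closed_Z Z_not_point in auto)

lemma proper_closed_finite:
  assumes A: "proj_closed (m - 2) A" "A \<subset> Z"
  shows "finite A"
proof -
  obtain S where S: "S \<subseteq> hom_polys (m - 2)" "A = zero_locus (m - 2) S"
    using A(1) unfolding proj_closed_def by blast
  obtain P where P: "P \<in> Z" "P \<notin> A" using A(2) by blast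
  obtain F where F: "F \<in> S" "F \<notin> vanishing_polys (m - 2) Z"
    using P S Z_subset_PG by (auto simp: zero_locus_def vanishing_polys_def)
  have hom: "F \<in> hom_polys (m - 2)" using F(1) S(1) by blast
  then obtain d where d: "homog (m - 2) d F"
    using hom_polys_homog by blast
  have "pullback F \<notin> ps_null m"
    using pullback_null[OF hom] F(2) by blast
  then obtain T where T: "finite T" "\<And>v. v \<in> coord_space m \<Longrightarrow> v \<noteq> 0 \<Longrightarrow> const_pt v \<in> ps_cone m \<Longrightarrow>
    pullback F (const_pt v) = 0 \<Longrightarrow> \<exists>c. c \<noteq> 0 \<and> scale_fun c v \<in> T"
    using hpol_finite_zeros[OF hpol_pullback[OF d]] by blast
  have "A \<subseteq> (\<lambda>v. proj_point (inv_into (coord_space (m - 1)) \<phi> v)) ` T"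
  proof
    fix Q assume Q: "Q \<in> A"
    then have "Q \<in> Z" using A(2) by blast
    then obtain w where w: "w \<in> coord_space (m - 1)" "w \<noteq> 0" "Q = proj_point w" "const_pt (\<phi> w) \<in> ps_cone m"
      by (rule Z_cases)
    have "mv_eval F w = 0"
      using Q S(2) F(1) w(3) proj_point_self[of w] by (auto simp: zero_locus_def)
    then have "pullback F (const_pt (\<phi> w)) = 0" using pullback_const[OF w(1)] by simp
    then obtain c where c: "c \<noteq> 0" "scale_fun c (\<phi> w) \<in> T"
      using T(2)[of "\<phi> w"] phi_mem[OF w(1)] phi_nonzero[OF w(1,2)] w(4) by blast
    have "inj_on \<phi> (coord_space (m - 1))"
      using phi_inj by (rule inj_onI)
    then have "inv_into (coord_space (m - 1)) \<phi> (scale_fun c (\<phi> w)) = scale_fun c w"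
      using inv_into_f_f[of \<phi> "coord_space (m - 1)" "scale_fun c w"] scale_coord_space[OF w(1)]
      by (simp add: phi.scale)
    then have "Q = proj_point (inv_into (coord_space (m - 1)) \<phi> (scale_fun c (\<phi> w)))"
      using proj_point_scale[OF c(1), of w] w(3) by simp
    then show "Q \<in> (\<lambda>v. proj_point (inv_into (coord_space (m - 1)) \<phi> v)) ` T"
      using c(2) by blast
  qed
  then show ?thesis using T(1) finite_subset by blast
qed

lemma variety_dim_Z: "variety_dim (m - 2) Z = 1"
proof -
  let ?D = "{enat d | d. \<exists>C :: nat \<Rightarrow> (nat \<Rightarrow> 'a) set set.
     (\<forall>i\<le>d. irreducible_variety (m - 2) (C i) \<and> C i \<subseteq> Z) \<and> (\<forall>i<d. C i \<subset> C (Suc i))}"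
  obtain P where P: "P \<in> Z" using Z_not_point(1) by blast
  have "enat 1 \<in> ?D"
  proof -
    define C where "C i = (if i = 0 then {P} else Z)" for i :: nat
    have "irreducible_variety (m - 2) (C i) \<and> C i \<subseteq> Z" for i
      using P Z_subset_PG irreducible_point[of P "m - 2"] irreducible_Z by (auto simp: C_def)
    moreover have "C i \<subset> C (Suc i)" if "i < 1" for i
      using that P Z_not_point(2)[of P] by (auto simp: C_def)
    ultimately show ?thesis by blast
  qed
  moreover have "x \<le> enat 1" if "x \<in> ?D" for x
  proof (rule ccontr)
    assume "\<not> x \<le> enat 1"
    obtain d C where x: "x = enat d" and
      C: "\<And>i. i \<le> d \<Longrightarrow> irreducible_variety (m - 2) (C i) \<and> C i \<subseteq> Z" "\<And>i. i < d \<Longrightarrow> C i \<subset> C (Suc i)"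
      using \<open>x \<in> ?D\<close> by blast
    have d: "2 \<le> d" using \<open>\<not> x \<le> enat 1\<close> x by simp
    have chain: "C 0 \<subset> C 1" "C 1 \<subset> C 2" "C 2 \<subseteq> Z"
      using C(2)[of 0] C(2)[of 1] C(1)[of 2] d by (simp_all add: numeral_2_eq_2)
    have irr: "irreducible_variety (m - 2) (C 1)" "C 0 \<noteq> {}"
      using C(1)[of 0] C(1)[of 1] d by (auto simp: irreducible_variety_def)
    \<comment> \<open>\<open>C 1\<close> is a proper closed subset of \<open>Z\<close>, hence finite
      and, being irreducible, a single point; this leaves nothing for \<open>C 0\<close>.\<close>
    have "finite (C 1)"
    proof (rule proper_closed_finite)
      show "proj_closed (m - 2) (C 1)"
        using irr(1) unfolding irreducible_variety_def by blast
      show "C 1 \<subset> Z"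
        using chain(2,3) by (rule psubset_subset_trans)
    qed
    with irr(1) obtain Q where "C 1 = {Q}"
      by (rule irreducible_finite_singleton)
    then have "C 0 = {}"
      using chain(1) by (auto simp: psubset_eq subset_singleton_iff)
    then show False using irr(2) by contradiction
  qed
  ultimately have "Sup ?D = enat 1"
    by (intro antisym Sup_least Sup_upper) auto
  then show ?thesis
    by (simp add: variety_dim_def one_enat_def)
qed

section \<open>Tangent vectors and the rank of the Jacobian matrix\<close>

text \<open>The conditions on \<open>u\<close> make all power sums vanish to first order at the
  image of w + tu. This point need not lie on the cone, but \<open>pullback F\<close> is still a
  combination of the power sums there with coefficients in K[[t]], so it vanishes to first order as
  well.\<close>

lemma gradient_orthogonal:
  assumes F: "F \<in> vanishing_polys (m - 2) Z"
    and w: "w \<in> coord_space (m - 1)" "const_pt (\<phi> w) \<in> ps_cone m"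
    and u: "u \<in> coord_space (m - 1)" "\<And>k. k \<in> {2..m - 2} \<Longrightarrow> (\<Sum>i<m. \<phi> w i ^ (k - 1) * \<phi> u i) = 0"
  shows "(\<Sum>i\<le>m - 2. gradient (m - 2) F w i * u i) = 0"
proof -
  have hom: "F \<in> hom_polys (m - 2)"
    using F by (auto simp: vanishing_polys_def)
  then obtain d where d: "homog (m - 2) d F"
    using hom_polys_homog by blast
  let ?x = "\<lambda>i. fps_const (\<phi> w i) + fps_const (\<phi> u i) * fps_X"
  obtain q where q: "pullback F ?x = (\<Sum>k\<in>{1..m - 2}. q k * psum {..<m} ?x k)"
    using pullback_null[OF hom] F by (auto simp: ps_null_def ps_ideal_def)
  have "(q k * psum {..<m} ?x k) $ 1 = 0" if k: "k \<in> {1..m - 2}" for k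
  proof -
    have "(\<Sum>i<m. \<phi> w i ^ k) = 0"
      using w(2) k by (simp add: const_pt_cone_iff)
    \<comment> \<open>For k = 1 this is the equation of the hyperplane, satisfied by
      \<open>\<phi> u\<close>.\<close>
    moreover have "(\<Sum>i<m. \<phi> w i ^ (k - 1) * \<phi> u i) = 0"
      using u(2)[of k] k phi_mem[OF u(1)] by (cases "k = 1") auto
    ultimately have "psum {..<m} ?x k $ 0 = 0" "psum {..<m} ?x k $ 1 = 0"
      unfolding psum_line by simp_all
    then show ?thesis
      by (simp add: fps_mult_nth)
  qed
  then have "pullback F ?x $ 1 = 0"
    unfolding q fps_sum_nth by (intro sum.neutral) blast
  then show ?thesis
    using pullback_line[OF w(1) u(1)] fps_mv_eval_line[OF d, of w u] by simp
qed

text \<open>Vandermonde: the coordinates of the point take at least \<open>m - 1\<close> values.\<close>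

lemma pulled_gradients_independent:
  assumes w: "w \<in> coord_space (m - 1)" "w \<noteq> 0" "const_pt (\<phi> w) \<in> ps_cone m"
    and l: "\<And>i. i \<le> m - 2 \<Longrightarrow> (\<Sum>k\<in>{2..m - 2}. l k * gradient (m - 2) (pulled_psum k) w i) = 0"
    and k: "k \<in> {2..m - 2}"
  shows "l k = 0"
proof -
  \<comment> \<open>Collects the linear relation between the gradients; the exponents run from 1 to
    m - 3.\<close>
  define q where "q = (\<Sum>k\<in>{2..m - 2}. monom (l k * of_nat k) (k - 1))"
  have orth: "(\<Sum>i<m. poly q (\<phi> w i) * \<phi> u i) = 0" if u: "u \<in> coord_space (m - 1)" for u
  proof -
    have "0 = (\<Sum>i\<le>m - 2. (\<Sum>k\<in>{2..m - 2}. l k * gradient (m - 2) (pulled_psum k) w i) * u i)"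
      using l by simp
    also have "\<dots> = (\<Sum>k\<in>{2..m - 2}. l k * (\<Sum>i\<le>m - 2. gradient (m - 2) (pulled_psum k) w i * u i))"
      unfolding sum_distrib_right sum_distrib_left by (subst sum.swap) (simp add: mult.assoc)
    also have "\<dots> = (\<Sum>k\<in>{2..m - 2}. \<Sum>i<m. (l k * of_nat k * \<phi> w i ^ (k - 1)) * \<phi> u i)"
      unfolding gradient_pulled_psum[OF w(1) u] by (simp add: sum_distrib_left mult.assoc)
    also have "\<dots> = (\<Sum>i<m. poly q (\<phi> w i) * \<phi> u i)"
      by (subst sum.swap) (simp add: q_def poly_sum poly_monom sum_distrib_right)
    finally show ?thesis by simp
  qed
  have same: "poly q (\<phi> w i) = poly q (\<phi> w j)" if ij: "i < m" "j < m" for i j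
  proof (cases "i = j")
    case False
    \<comment> \<open>Differences of two unit vectors lie in the hyperplane; testing the relation on
      them shows that \<open>q\<close> takes one value at all coordinates of the point.\<close>
    define v where "v = (\<lambda>k. (if k = i then 1 else 0) - (if k = j then 1 else (0 :: 'a)))"
    have "v \<in> coord_space m" "(\<Sum>k<m. v k) = 0"
      using ij by (auto simp: v_def coord_space_def sum_subtractf)
    then obtain u where "u \<in> coord_space (m - 1)" "\<phi> u = v"
      by (rule phi_surj)
    then have "(\<Sum>k<m. poly q (\<phi> w k) * v k) = 0"
      using orth by blast
    also have "(\<Sum>k<m. poly q (\<phi> w k) * v k)
      = (\<Sum>k<m. (if k = i then poly q (\<phi> w k) else 0) - (if k = j then poly q (\<phi> w k) else 0))"
      by (intro sum.cong) (auto simp: v_def)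
    finally show ?thesis
      using ij by (simp add: sum_subtractf)
  qed simp
  define c where "c = poly q (\<phi> w 0)"
  \<comment> \<open>Otherwise a polynomial of degree at most m - 3 would have m - 1 roots.\<close>
  have "q - [:c:] = 0"
  proof (rule ccontr)
    assume ne: "q - [:c:] \<noteq> 0"
    have "\<phi> w ` {..<m} \<subseteq> {z. poly (q - [:c:]) z = 0}"
    proof
      fix z assume "z \<in> \<phi> w ` {..<m}"
      then obtain i where i: "i < m" "z = \<phi> w i" by auto
      have "poly q (\<phi> w i) = c"
        unfolding c_def by (rule same) (use i(1) in auto)
      then show "z \<in> {z. poly (q - [:c:]) z = 0}" using i(2) by simp
    qed
    then have "card (\<phi> w ` {..<m}) \<le> card {z. poly (q - [:c:]) z = 0}"
      using poly_roots_finite[OF ne] by (intro card_mono)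
    also have "\<dots> \<le> degree (q - [:c:])"
      using ne by (rule card_poly_roots_bound)
    also have "\<dots> \<le> m - 3"
    proof -
      have "degree q \<le> m - 3"
        unfolding q_def by (intro degree_sum_le) (auto intro!: order.trans[OF degree_monom_le])
      then show ?thesis by (intro degree_diff_le) auto
    qed
    finally have "card (\<phi> w ` {..<m}) \<le> m - 3" .
    moreover have "\<exists>i<m. \<phi> w i \<noteq> 0"
      using phi_nonzero[OF w(1,2)] phi_mem[OF w(1)] unfolding coord_space_def
      by (auto simp: fun_eq_iff) (metis not_le)
    then have "m - 1 \<le> card (\<phi> w ` {..<m})"
      by (rule cone_card[OF w(3)])
    ultimately show False using m_ge by linarith
  qed
  \<comment> \<open>As k is at least 2, the constant \<open>c\<close> does not touch this
    coefficient.\<close>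
  then have "coeff q (k - 1) = coeff [:c:] (k - 1)" by simp
  also have "\<dots> = 0"
    using k by (auto simp: coeff_pCons split: nat.split)
  also have "coeff q (k - 1) = l k * of_nat k"
  proof -
    have "coeff q (k - 1) = (\<Sum>j\<in>{2..m - 2}. if j = k then l j * of_nat j else 0)"
      unfolding q_def coeff_sum using k by (intro sum.cong) (auto)
    then show ?thesis using k by simp
  qed
  finally show "l k = 0"
    using of_nat_nonzero[of k] k m_ge by (auto simp: le_diff_conv2)
qed

text \<open>The gradients of the power sums of exponents 2, ..., m - 2 are a basis: a vector
  orthogonal to them is tangent, so it is orthogonal to the gradient of every vanishing form, and by
  duality that gradient lies in their span. Their number is the codimension of a curve in PG(m - 2,
  K).\<close>

lemma jacobian_rank_Z:
  assumes w: "w \<in> coord_space (m - 1)" "w \<noteq> 0" "const_pt (\<phi> w) \<in> ps_cone m"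
  shows "jacobian_rank (m - 2) Z w = m - 3"
proof -
  let ?K = "{2..m - 2}"
  let ?V = "(\<lambda>F. gradient (m - 2) F w) ` vanishing_polys (m - 2) Z"
  define g where "g k = gradient (m - 2) (pulled_psum k) w" for k
  have indep: "l k = 0" if "(\<Sum>k\<in>?K. scale_fun (l k) (g k)) = 0" "k \<in> ?K" for l k
  proof (rule pulled_gradients_independent[OF w _ that(2)])
    fix i
    show "(\<Sum>k\<in>?K. l k * gradient (m - 2) (pulled_psum k) w i) = 0"
      using fun_cong[OF that(1), of i] by (simp add: sum_fun_apply scale_fun_def g_def)
  qed
  \<comment> \<open>Independence is required of the set of gradients, so the family must be free of
    repetitions.\<close>
  have inj: "inj_on g ?K"
  proof (rule inj_onI, rule ccontr)
    fix j k assume jk: "j \<in> ?K" "k \<in> ?K" "g j = g k" "j \<noteq> k"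
    define l where "l i = (if i = j then 1 else if i = k then - 1 else (0 :: 'a))" for i
    have "(\<Sum>i\<in>?K. scale_fun (l i) (g i)) = (\<Sum>i\<in>{j, k}. scale_fun (l i) (g i))"
      using jk by (intro sum.mono_neutral_right) (auto simp: l_def scale_fun_def fun_eq_iff)
    also have "\<dots> = 0"
      using jk by (simp add: l_def scale_fun_def fun_eq_iff)
    finally have "l j = 0" using indep jk(1) by blast
    then show False by (simp add: l_def)
  qed
  have "phi.vs1.dim ?V = m - 3"
  proof (rule phi.vs1.dim_unique)
    show "g ` ?K \<subseteq> ?V"
      using pulled_psum_vanishing by (auto simp: g_def)
    show "?V \<subseteq> phi.vs1.span (g ` ?K)"
    proof
      fix x assume "x \<in> ?V"
      then obtain F where F: "F \<in> vanishing_polys (m - 2) Z" "x = gradient (m - 2) F w" by blast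
      have "\<exists>l. \<forall>i\<le>m - 2. x i = (\<Sum>k\<in>?K. l k * g k i)"
      proof (rule double_annihilator)
        fix u :: "nat \<Rightarrow> 'a" assume u: "u \<in> coord_space (Suc (m - 2))" "\<And>k. k \<in> ?K \<Longrightarrow> (\<Sum>i\<le>m - 2. g k i * u i) = 0"
        then have u': "u \<in> coord_space (m - 1)" by (simp add: Suc_m)
        have "(\<Sum>i<m. \<phi> w i ^ (k - 1) * \<phi> u i) = 0" if k: "k \<in> ?K" for k
          using u(2)[OF k] gradient_pulled_psum[OF w(1) u', of k] of_nat_nonzero[of k] k m_ge
          by (auto simp: g_def le_diff_conv2)
        then show "(\<Sum>i\<le>m - 2. x i * u i) = 0"
          unfolding F(2) by (rule gradient_orthogonal[OF F(1) w(1,3) u'])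
      qed simp
      then obtain l where l: "\<forall>i\<le>m - 2. x i = (\<Sum>k\<in>?K. l k * g k i)" by blast
      have "x = (\<Sum>k\<in>?K. scale_fun (l k) (g k))"
      proof
        fix i
        show "x i = (\<Sum>k\<in>?K. scale_fun (l k) (g k)) i"
          using l by (cases "i \<le> m - 2") (auto simp: sum_fun_apply scale_fun_def F(2) g_def gradient_def)
      qed
      also have "\<dots> \<in> phi.vs1.span (g ` ?K)"
        by (intro phi.vs1.span_sum phi.vs1.span_scale phi.vs1.span_base) auto
      finally show "x \<in> phi.vs1.span (g ` ?K)" .
    qed
    show "phi.vs1.independent (g ` ?K)"
    proof (rule phi.vs1.independent_if_scalars_zero)
      fix f x assume f: "(\<Sum>x\<in>g ` ?K. scale_fun (f x) x) = 0" and x: "x \<in> g ` ?K"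
      have "(\<Sum>k\<in>?K. scale_fun (f (g k)) (g k)) = 0"
        using f by (simp add: sum.reindex[OF inj])
      then show "f x = 0"
        using indep[of "\<lambda>k. f (g k)"] x by blast
    qed simp
    show "card (g ` ?K) = m - 3"
      using m_ge by (simp add: card_image[OF inj])
  qed
  then show ?thesis
    by (simp add: jacobian_rank_def)
qed

lemma irreducible_nonsingular_curve_Z: "irreducible_nonsingular_curve (m - 2) Z"
  unfolding irreducible_nonsingular_curve_def nonsingular_variety_def
proof (intro conjI ballI)
  fix P v assume P: "P \<in> Z" "v \<in> P"
  then have v: "v \<in> coord_space (m - 1)" "v \<noteq> 0" "P = proj_point v"
    using proj_point_mem[of P "m - 2" v] Z_subset_PG by (auto simp: Suc_m)
  then have "const_pt (\<phi> v) \<in> ps_cone m"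
    using mem_Z P(1) by blast
  then have "jacobian_rank (m - 2) Z v = m - 3"
    by (rule jacobian_rank_Z[OF v(1,2)])
  moreover have "m - 3 + 1 = m - 2" using m_ge by simp
  ultimately show "enat (jacobian_rank (m - 2) Z v) + variety_dim (m - 2) Z = enat (m - 2)"
    by (simp add: variety_dim_Z one_enat_def)
qed (rule irreducible_Z variety_dim_Z)+

end

theorem theorem4p16:
  fixes m :: nat
  assumes "CHAR('a::alg_closed_field) = 0 \<or> prime CHAR('a) \<and> CHAR('a) \<ge> 7 \<and> m \<le> CHAR('a) - 1"
    and "m \<ge> 5"
  shows "(power_sum_variety m :: (nat \<Rightarrow> 'a) set set) \<subseteq> sum_hyperplane m \<and>
    (\<forall>\<phi> :: (nat \<Rightarrow> 'a) \<Rightarrow> (nat \<Rightarrow> 'a). hyperplane_identification m \<phi> \<longrightarrow>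
      irreducible_nonsingular_curve (m - 2) (transport (m - 2) \<phi> (power_sum_variety m)))"
proof (intro conjI allI impI)
  show "(power_sum_variety m :: (nat \<Rightarrow> 'a) set set) \<subseteq> sum_hyperplane m"
    using assms(2) by (auto simp: power_sum_variety_def sum_hyperplane_def zero_locus_def)
next
  fix \<phi> :: "(nat \<Rightarrow> 'a) \<Rightarrow> (nat \<Rightarrow> 'a)" assume \<phi>: "hyperplane_identification m \<phi>"
  \<comment> \<open>In characteristic p, a positive l <= m <= p - 1 is not divisible by p.\<close>
  have "(of_nat l :: 'a) \<noteq> 0" if l: "0 < l" "l \<le> m" for l
  proof
    assume "(of_nat l :: 'a) = 0"
    then have "CHAR('a) dvd l" by (simp add: of_nat_eq_0_iff_char_dvd)
    then show False
      using assms(1) l dvd_imp_le[of "CHAR('a)" l] by auto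
  qed
  then interpret hyperplane_section m "TYPE('a)" \<phi>
    using assms(2) \<phi> by unfold_locales
  show "irreducible_nonsingular_curve (m - 2) (transport (m - 2) \<phi> (power_sum_variety m))"
    using irreducible_nonsingular_curve_Z by (simp add: Z_def)
qed

end
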